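(* Let $d=2$, let $L>0$ be such that $G(L)>0$, and let $f\in\mathcal C_L$ be an $L$-Lipschitz curve such that $\Delta(f)=G(L)$. (i) If $\mathcal C_L=\{\phi:[0,1]\to\mathbb R^2 \text{ curve},\ \mathscr L(\phi)\le L\}$, then $f$ is injective. (ii) If $\mathcal C_L=\{\phi:[0,1]\to\mathbb R^2\text{ curve},\ \mathscr L(\phi)\le L,\ \phi(0)=\phi(1)\}$, then either $f$ restricted to $[0,1)$ is injective or $\mathrm{Im} f$ is a segment.
   Context: $\mathbb R^2$ carries the Euclidean norm $\|\cdot\|$; $d(x,A)=\inf_{y\in A}\|x-y\|$. $X$ is a random vector on a probability space $(\Omega,\mathcal F,\mathbb P)$ with values in $\mathbb R^2$ and $\mathbb E[\|X\|^2]<\infty$. A curve is a continuous function $f:[0,1]\to\mathbb R^2$; its image is $\mathrm{Im} f$ and its length is $\mathscr L(f)=\sup\sum_{i=1}^n\|f(t_i)-f(t_{i-1})\|\in[0,\infty]$, the supremum being over all subdivisions $0=t_0\le\dots\le t_n=1$, $n\ge1$. $\Delta(f)=\mathbb E[d(X,\mathrm{Im} f)^2]$. $\mathcal C_L$ is the set of curves specified in (i) or (ii) respectively, and $G(L)=\min\{\Delta(f): f\in\mathcal C_L\}$ (the minimum is attained). *)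

theory Defs
  imports "HOL-Probability.Probability"
begin

text \<open>A curve is a \<^const>\<open>path\<close>: a function on the reals that is continuous on the
  unit interval; only its values there matter. Its image is \<^const>\<open>path_image\<close>.\<close>

definition curve_length :: "(real \<Rightarrow> 'a::real_normed_vector) \<Rightarrow> ennreal" where
  "curve_length f =
    (SUP (n, t) \<in> {(n::nat, t::nat \<Rightarrow> real).
                     1 \<le> n \<and> t 0 = 0 \<and> t n = 1 \<and> (\<forall>i\<in>{1..n}. t (i - 1) \<le> t i)}.
       ennreal (\<Sum>i=1..n. norm (f (t i) - f (t (i - 1)))))"

definition curves :: "real \<Rightarrow> (real \<Rightarrow> 'a::real_normed_vector) set" where
  "curves L = {\<phi>. path \<phi> \<and> curve_length \<phi> \<le> ennreal L}"

definition closed_curves :: "real \<Rightarrow> (real \<Rightarrow> 'a::real_normed_vector) set" where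
  "closed_curves L = {\<phi>. path \<phi> \<and> curve_length \<phi> \<le> ennreal L \<and> \<phi> 0 = \<phi> 1}"

text \<open>The Bochner integral below is a genuine expectation as soon as \<open>X\<close> is measurable and
  square integrable: the integrand is then nonnegative and integrable.\<close>

definition distortion ::
    "'w measure \<Rightarrow> ('w \<Rightarrow> 'a::real_normed_vector) \<Rightarrow> (real \<Rightarrow> 'a) \<Rightarrow> real" where
  "distortion M X f = (LINT \<omega>|M. (infdist (X \<omega>) (path_image f))\<^sup>2)"

text \<open>The optimal distortion over a class \<open>C\<close> of curves. It is written as an infimum; an
  \<open>f \<in> C\<close> with \<open>distortion M X f = opt_distortion M X C\<close> is exactly a minimiser,
  since distortions are bounded below by 0.\<close>

definition opt_distortion ::
    "'w measure \<Rightarrow> ('w \<Rightarrow> 'a::real_normed_vector) \<Rightarrow> (real \<Rightarrow> 'a) set \<Rightarrow> real" where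
  "opt_distortion M X C = (INF \<phi>\<in>C. distortion M X \<phi>)"

end

theory Submission
  imports Defs
begin

text \<open>
  Let \<open>f\<close> be optimal, let \<open>P = f \<tau>\<close> be a nearest point of \<open>X\<close> on the curve, with a measurable random
  parameter \<open>\<tau>\<close>, and let \<open>Y = X - P\<close> be the residual, thought of as a load that pulls at the curve.

  The balance of forces. Perturb \<open>f\<close> to \<open>f + \<epsilon> g\<close> and rescale the result to length \<open>L\<close>. Optimality
  gives, at first order in \<open>\<epsilon>\<close>, that the work \<open>E[Y \<bullet> g \<tau>]\<close> of the load equals the first variation of the
  length times a factor that does not depend on \<open>g\<close> and is proportional to the tension \<open>E[Y \<bullet> P]\<close>
  (\<open>first_variation\<close>). The tension is positive (\<open>tension_pos\<close>): otherwise shrinking the curve by a factor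
  \<open>1 - \<epsilon>\<close> would cost only \<open>O(\<epsilon>\<^sup>2)\<close>, and the length saved could be spent on a spike that gains more
  than any multiple of \<open>\<epsilon>\<^sup>2\<close>. With ramps for \<open>g\<close>, the balance expresses each chord of \<open>f\<close> by the load, so
  \<open>f\<close> has nonzero one-sided velocities everywhere, and the jump of the velocity at a parameter is a
  multiple of the load carried there (\<open>velocities\<close>).

  Double points. All this holds for every choice of \<open>\<tau>\<close>. If a point of the image is also visited at
  another time, \<open>\<tau>\<close> can be chosen to avoid the first one, which therefore carries no load: there is no
  corner at a double point, and a double point at the end of an open curve would force the velocity
  \<open>0\<close> there. Reversing the loop between the two visits gives another optimal curve with the same image,
  and comparing the two shows that the velocities at the two visits are opposite
  (\<open>opposite_velocities\<close>). So outside the loop the two branches leave the double point in the same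
  direction.

  The role of the plane. Near the double point both branches are graphs over their common tangent
  line. Vertically below a point of the upper branch there is, at some distance \<open>D\<close>, a point of the
  lower one, and a residual at the upper point pulls down by at most \<open>D / 2\<close>, since otherwise the lower
  point would be nearer. The pull that could drive the branches apart is thus controlled by the gap
  itself, and over a short distance no gap can open up: the branches meet again arbitrarily close to
  the double point (\<open>outward_double_point\<close>).

  Conclusion. For an open curve, a double pair \<open>s < t\<close> with \<open>t - s\<close> maximal contradicts this. For a
  closed curve that is not injective, the same maximality argument, now among pairs with
  \<open>t - s \<le> 1 - \<epsilon>\<close> and for every choice of the base point, shows that each parameter either is a double
  point or a U-turn, where the velocity is reversed. On a short arc to one side of a parameter the
  velocity is almost constant; so the arc contains no U-turn, all its points are also visited outside
  the arc, \<open>\<tau>\<close> can avoid the arc, and the unloaded arc is straight. The two arcs at a parameter are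
  parallel, so the whole image lies on a line, and it is a segment.
\<close>

section \<open>Upper bounds for the length of a curve\<close>

text \<open>
  A function \<open>A\<close> whose increments bound those of \<open>\<phi>\<close> plays the part of the arc length. It bounds the
  length from above without any differentiation of \<open>\<phi>\<close>, and it can be checked piece by piece.
\<close>

definition dominated :: "real \<Rightarrow> real \<Rightarrow> (real \<Rightarrow> 'a::real_normed_vector) \<Rightarrow> (real \<Rightarrow> real) \<Rightarrow> bool" where
  "dominated a b \<phi> A \<longleftrightarrow> (\<forall>x y. a \<le> x \<and> x \<le> y \<and> y \<le> b \<longrightarrow> norm (\<phi> y - \<phi> x) \<le> A y - A x)"

lemma dominatedI:
  assumes "\<And>x y. a \<le> x \<Longrightarrow> x \<le> y \<Longrightarrow> y \<le> b \<Longrightarrow> norm (\<phi> y - \<phi> x) \<le> A y - A x"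
  shows "dominated a b \<phi> A"
  using assms by (simp add: dominated_def)

lemma dominated_glue:
  assumes "dominated a b \<phi> A" "dominated b c \<phi> A"
  shows "dominated a c \<phi> A"
proof (rule dominatedI)
  fix x y assume xy: "a \<le> x" "x \<le> y" "y \<le> c"
  consider "y \<le> b" | "b \<le> x" | "x \<le> b" "b \<le> y" by linarith
  then show "norm (\<phi> y - \<phi> x) \<le> A y - A x"
  proof cases
    case 3
    have "norm (\<phi> y - \<phi> x) \<le> norm (\<phi> y - \<phi> b) + norm (\<phi> b - \<phi> x)"
      using norm_triangle_ineq[of "\<phi> y - \<phi> b" "\<phi> b - \<phi> x"] by simp
    also have "\<dots> \<le> (A y - A b) + (A b - A x)"
      using assms xy 3 unfolding dominated_def by (intro add_mono) auto
    finally show ?thesis by simp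
  qed (use assms xy in \<open>auto simp: dominated_def\<close>)
qed

lemma curve_length_le_dominated:
  assumes "dominated 0 1 \<phi> A"
  shows "curve_length \<phi> \<le> ennreal (A 1 - A 0)"
  unfolding curve_length_def
proof (rule SUP_least, clarify)
  fix n :: nat and t :: "nat \<Rightarrow> real"
  assume n: "1 \<le> n" and t0: "t 0 = 0" and tn: "t n = 1" and mono: "\<forall>i\<in>{1..n}. t (i - 1) \<le> t i"
  have le: "t i \<le> t j" if "i \<le> j" "j \<le> n" for i j
    using that
  proof (induction j)
    case (Suc j)
    then show ?case using mono[rule_format, of "Suc j"] by (cases "i = Suc j") auto
  qed simp
  have "(\<Sum>i=1..n. norm (\<phi> (t i) - \<phi> (t (i - 1)))) \<le> (\<Sum>i=1..n. A (t i) - A (t (i - 1)))"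
  proof (rule sum_mono)
    fix i assume i: "i \<in> {1..n}"
    show "norm (\<phi> (t i) - \<phi> (t (i - 1))) \<le> A (t i) - A (t (i - 1))"
      using assms le[of 0 "i-1"] le[of "i-1" i] le[of i n] i t0 tn
      unfolding dominated_def by auto
  qed
  also have "\<dots> = A (t n) - A (t 0)"
  proof -
    have "(\<Sum>i=1..k. A (t i) - A (t (i - 1))) = A (t k) - A (t 0)" for k
      by (induction k) auto
    then show ?thesis .
  qed
  finally show "ennreal (\<Sum>i=1..n. norm (\<phi> (t i) - \<phi> (t (i - 1)))) \<le> ennreal (A 1 - A 0)"
    using t0 tn by (intro ennreal_leI) simp
qed

lemma dominated_scale:
  assumes "dominated a b \<phi> A" "0 \<le> r"
  shows "dominated a b (\<lambda>x. r *\<^sub>R \<phi> x) (\<lambda>x. r * A x)"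
proof (rule dominatedI)
  fix x y assume "a \<le> x" "x \<le> y" "y \<le> b"
  then have "r * norm (\<phi> y - \<phi> x) \<le> r * (A y - A x)"
    using assms by (intro mult_left_mono) (auto simp: dominated_def)
  then show "norm (r *\<^sub>R \<phi> y - r *\<^sub>R \<phi> x) \<le> r * A y - r * A x"
    using assms(2) by (simp only: scaleR_diff_right[symmetric] norm_scaleR abs_of_nonneg right_diff_distrib)
qed

lemma lipschitz_dominated:
  assumes "L-lipschitz_on {0..1} f"
  shows "dominated 0 1 f (\<lambda>x. L * x)"
proof (rule dominatedI)
  fix x y :: real assume "0 \<le> x" "x \<le> y" "y \<le> 1"
  then show "norm (f y - f x) \<le> L * y - L * x"
    using lipschitz_onD[OF assms, of y x] by (simp add: dist_norm algebra_simps)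
qed

lemma lipschitz_path: "L-lipschitz_on {0..1} f \<Longrightarrow> path f"
  unfolding path_def by (rule lipschitz_on_continuous_on)

text \<open>
  The tangent line to the square root at \<open>c\<^sup>2\<close> lies above its graph.
\<close>

lemma le_of_square_le:
  fixes l r c :: real
  assumes "0 < c" and sq: "l\<^sup>2 \<le> 2 * c * r - c\<^sup>2"
  shows "l \<le> r"
proof (rule power2_le_imp_le)
  have "l\<^sup>2 + (r - c)\<^sup>2 \<le> r\<^sup>2"
    using sq by (simp add: power2_diff algebra_simps)
  then show "l\<^sup>2 \<le> r\<^sup>2" using zero_le_power2[of "r - c"] by linarith
  have "0 < 2 * c * r" using sq zero_le_power2[of l] zero_less_power[OF assms(1), of 2] by linarith
  then show "0 \<le> r" using assms(1) by (simp add: zero_less_mult_iff)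
qed

text \<open>
  On an interval where \<open>g\<close> has the constant slope \<open>k\<close>, an increment \<open>d\<close> of \<open>f\<close> over a time \<open>h\<close> becomes
  \<open>d + \<epsilon> h k\<close>, whose norm is at most \<open>L h + (\<epsilon> / L) (k \<bullet> d)\<close> up to a term quadratic in \<open>\<epsilon>\<close>. The
  function \<open>\<Gamma>\<close> stands for the integral of the inner product of the derivatives of \<open>f\<close> and \<open>g\<close>; since \<open>g\<close>
  is affine, \<open>f\<close> does not have to be differentiated.
\<close>

lemma dominated_perturbation:
  fixes f g :: "real \<Rightarrow> 'a::real_inner"
  assumes lip: "L-lipschitz_on {p..q} f" and L: "L > 0"
    and g: "\<And>x y. p \<le> x \<Longrightarrow> x \<le> y \<Longrightarrow> y \<le> q \<Longrightarrow> g y - g x = (y - x) *\<^sub>R k"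
    and \<Gamma>: "\<And>x y. p \<le> x \<Longrightarrow> x \<le> y \<Longrightarrow> y \<le> q \<Longrightarrow> \<Gamma> y - \<Gamma> x = k \<bullet> (f y - f x)"
    and K: "norm k \<le> K"
  shows "dominated p q (\<lambda>x. f x + \<epsilon> *\<^sub>R g x) (\<lambda>x. L * x + \<epsilon> / L * \<Gamma> x + \<epsilon>\<^sup>2 * K\<^sup>2 / (2 * L) * x)"
proof (rule dominatedI)
  fix x y assume xy: "p \<le> x" "x \<le> y" "y \<le> q"
  define h where "h = y - x"
  define d where "d = f y - f x"
  show "norm (f y + \<epsilon> *\<^sub>R g y - (f x + \<epsilon> *\<^sub>R g x))
      \<le> L * y + \<epsilon> / L * \<Gamma> y + \<epsilon>\<^sup>2 * K\<^sup>2 / (2 * L) * y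
       - (L * x + \<epsilon> / L * \<Gamma> x + \<epsilon>\<^sup>2 * K\<^sup>2 / (2 * L) * x)" (is "?l \<le> ?r")
  proof (cases "h = 0")
    case True then show ?thesis by (simp add: h_def)
  next
    case False
    then have h: "h > 0" using xy by (simp add: h_def)
    have dn: "norm d \<le> L * h"
      using lipschitz_onD[OF lip, of y x] xy by (simp add: dist_norm h_def d_def)
    have l: "?l = norm (d + (\<epsilon> * h) *\<^sub>R k)"
    proof -
      have "f y + \<epsilon> *\<^sub>R g y - (f x + \<epsilon> *\<^sub>R g x) = d + \<epsilon> *\<^sub>R (g y - g x)"
        by (simp add: d_def algebra_simps)
      then show ?thesis using g[OF xy] by (simp add: h_def)
    qed
    have r: "?r = L * h + \<epsilon> / L * (k \<bullet> d) + \<epsilon>\<^sup>2 * K\<^sup>2 / (2 * L) * h"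
    proof -
      have "?r = L * h + \<epsilon> / L * (\<Gamma> y - \<Gamma> x) + \<epsilon>\<^sup>2 * K\<^sup>2 / (2 * L) * h"
        by (simp add: h_def algebra_simps diff_divide_distrib)
      then show ?thesis using \<Gamma>[OF xy] by (simp add: d_def)
    qed
    have sq: "?l\<^sup>2 \<le> 2 * (L * h) * ?r - (L * h)\<^sup>2"
    proof -
      have "?l\<^sup>2 = (norm d)\<^sup>2 + 2 * (\<epsilon> * h) * (k \<bullet> d) + (\<epsilon> * h)\<^sup>2 * (norm k)\<^sup>2"
        unfolding l power2_norm_eq_inner by (simp add: algebra_simps inner_commute power2_eq_square)
      also have "\<dots> \<le> (L * h)\<^sup>2 + 2 * (\<epsilon> * h) * (k \<bullet> d) + (\<epsilon> * h)\<^sup>2 * K\<^sup>2"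
        using power_mono[OF dn, of 2] mult_left_mono[OF power_mono[OF K, of 2], of "(\<epsilon> * h)\<^sup>2"]
        by simp
      also have "\<dots> = 2 * (L * h) * ?r - (L * h)\<^sup>2"
        unfolding r using L by (simp add: field_simps power2_eq_square)
      finally show ?thesis .
    qed
    show ?thesis by (rule le_of_square_le[OF _ sq]) (use L h in simp)
  qed
qed

text \<open>
  The function falling from \<open>1\<close> to \<open>0\<close> on \<open>[a, b]\<close>: the test function that isolates the chord of a curve
  over \<open>[a, b]\<close>.
\<close>

definition ramp :: "real \<Rightarrow> real \<Rightarrow> real \<Rightarrow> real" where
  "ramp a b x = max 0 (min 1 ((b - x) / (b - a)))"

lemma ramp_simps:
  assumes "a < b"
  shows "x \<le> a \<Longrightarrow> ramp a b x = 1" "b \<le> x \<Longrightarrow> ramp a b x = 0"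
    "a \<le> x \<Longrightarrow> x \<le> b \<Longrightarrow> ramp a b x = (b - x) / (b - a)"
  using assms by (auto simp: ramp_def field_simps max_def min_def)

lemma ramp_range: "0 \<le> ramp a b x" "ramp a b x \<le> 1"
  by (auto simp: ramp_def)

lemma continuous_ramp: "continuous_on S (ramp a b)"
  unfolding ramp_def divide_inverse by (intro continuous_intros)

lemma measurable_ramp[measurable]: "ramp a b \<in> borel_measurable borel"
  by (intro borel_measurable_continuous_onI continuous_ramp)

text \<open>
  The summand \<open>\<theta> * x\<close> serves closed curves: with \<open>\<theta> = 1\<close> the perturbation takes equal values at \<open>0\<close>
  and \<open>1\<close>.
\<close>

lemma dominated_ramp_perturbation:
  fixes f :: "real \<Rightarrow> 'a::real_inner"
  assumes lip: "L-lipschitz_on {0..1} f" and L: "L > 0" and ab: "0 \<le> a" "a < b" "b \<le> 1"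
  shows "\<exists>K. \<forall>\<epsilon>. \<exists>A. dominated 0 1 (\<lambda>x. f x + \<epsilon> *\<^sub>R (ramp a b x + \<theta> * x) *\<^sub>R v) A \<and>
     A 1 - A 0 = L + \<epsilon> * (v \<bullet> (\<theta> *\<^sub>R (f 1 - f 0) - (f b - f a) /\<^sub>R (b - a)) / L) + \<epsilon>\<^sup>2 * K"
proof -
  define c where "c x = max a (min b x)" for x
  have c: "x \<le> a \<Longrightarrow> c x = a" "b \<le> x \<Longrightarrow> c x = b" "a \<le> x \<Longrightarrow> x \<le> b \<Longrightarrow> c x = x" for x
    using ab by (auto simp: c_def)
  define \<Gamma> where "\<Gamma> x = v \<bullet> (\<theta> *\<^sub>R f x - f (c x) /\<^sub>R (b - a))" for x
  define K where "K = max (norm (\<theta> *\<^sub>R v)) (norm ((\<theta> - 1 / (b - a)) *\<^sub>R v))"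
  define A where "A \<epsilon> x = L * x + \<epsilon> / L * \<Gamma> x + \<epsilon>\<^sup>2 * K\<^sup>2 / (2 * L) * x" for \<epsilon> x
  let ?g = "\<lambda>x. (ramp a b x + \<theta> * x) *\<^sub>R v"
  have lip': "L-lipschitz_on {p..q} f" if "0 \<le> p" "q \<le> 1" for p q
    by (rule lipschitz_on_subset[OF lip]) (use that in auto)
  have "dominated 0 1 (\<lambda>x. f x + \<epsilon> *\<^sub>R ?g x) (A \<epsilon>)" for \<epsilon>
    unfolding A_def
  proof (rule dominated_glue[where b = a], rule_tac [2] dominated_glue[where b = b])
    show "dominated 0 a (\<lambda>x. f x + \<epsilon> *\<^sub>R ?g x)
        (\<lambda>x. L * x + \<epsilon> / L * \<Gamma> x + \<epsilon>\<^sup>2 * K\<^sup>2 / (2 * L) * x)"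
      by (rule dominated_perturbation[OF lip' L, where k = "\<theta> *\<^sub>R v"])
        (use ab in \<open>auto simp: ramp_simps \<Gamma>_def K_def algebra_simps c\<close>)
    show "dominated b 1 (\<lambda>x. f x + \<epsilon> *\<^sub>R ?g x)
        (\<lambda>x. L * x + \<epsilon> / L * \<Gamma> x + \<epsilon>\<^sup>2 * K\<^sup>2 / (2 * L) * x)"
      by (rule dominated_perturbation[OF lip' L, where k = "\<theta> *\<^sub>R v"])
        (use ab in \<open>auto simp: ramp_simps \<Gamma>_def K_def algebra_simps c\<close>)
    show "dominated a b (\<lambda>x. f x + \<epsilon> *\<^sub>R ?g x)
        (\<lambda>x. L * x + \<epsilon> / L * \<Gamma> x + \<epsilon>\<^sup>2 * K\<^sup>2 / (2 * L) * x)"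
    proof (rule dominated_perturbation[OF lip' L, where k = "(\<theta> - 1 / (b - a)) *\<^sub>R v"])
      fix x y assume xy: "a \<le> x" "x \<le> y" "y \<le> b"
      have "(ramp a b y + \<theta> * y) - (ramp a b x + \<theta> * x) = (y - x) * (\<theta> - 1 / (b - a))"
      proof -
        have "(b - y) / (b - a) - (b - x) / (b - a) = - ((y - x) / (b - a))"
          by (simp add: diff_divide_distrib[symmetric] minus_divide_left)
        then show ?thesis using xy ab by (simp add: ramp_simps algebra_simps)
      qed
      then show "?g y - ?g x = (y - x) *\<^sub>R ((\<theta> - 1 / (b - a)) *\<^sub>R v)"
        by (metis scaleR_left_diff_distrib scaleR_scaleR)
      show "\<Gamma> y - \<Gamma> x = (\<theta> - 1 / (b - a)) *\<^sub>R v \<bullet> (f y - f x)"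
        using xy ab by (simp add: \<Gamma>_def c inner_diff_right inner_diff_left inverse_eq_divide
            left_diff_distrib right_diff_distrib diff_divide_distrib)
    qed (use ab in \<open>auto simp: K_def\<close>)
  qed
  moreover have "A \<epsilon> 1 - A \<epsilon> 0 = L
     + \<epsilon> * (v \<bullet> (\<theta> *\<^sub>R (f 1 - f 0) - (f b - f a) /\<^sub>R (b - a)) / L) + \<epsilon>\<^sup>2 * (K\<^sup>2 / (2 * L))" for \<epsilon>
  proof -
    have "A \<epsilon> 1 - A \<epsilon> 0 = L + \<epsilon> / L * (\<Gamma> 1 - \<Gamma> 0) + \<epsilon>\<^sup>2 * K\<^sup>2 / (2 * L)"
      by (simp add: A_def right_diff_distrib)
    moreover have "\<Gamma> 1 - \<Gamma> 0 = v \<bullet> (\<theta> *\<^sub>R (f 1 - f 0) - (f b - f a) /\<^sub>R (b - a))"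
      using ab by (simp add: \<Gamma>_def c inner_diff_right right_diff_distrib)
    ultimately show ?thesis by simp
  qed
  ultimately show ?thesis by blast
qed

section \<open>Optimal curves and nearest parameters\<close>

text \<open>
  The flag \<open>loop\<close> selects the class of curves: it is true for closed curves and false for open ones,
  so that both cases share the theory up to the double points.
\<close>

locale length_constrained = prob_space M for M :: "'w measure" +
  fixes X :: "'w \<Rightarrow> 'a::euclidean_space" and L :: real and loop :: bool
  assumes X_measurable [measurable]: "X \<in> borel_measurable M"
    and X_square: "integrable M (\<lambda>\<omega>. (norm (X \<omega>))\<^sup>2)"
    and L_pos: "L > 0"
begin

definition optimal :: "(real \<Rightarrow> 'a) \<Rightarrow> bool" where
  "optimal f \<longleftrightarrow> L-lipschitz_on {0..1} f \<and> (loop \<longrightarrow> f 0 = f 1) \<and> 0 < distortion M X f \<and>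
     (\<forall>\<phi>. path \<phi> \<and> curve_length \<phi> \<le> ennreal L \<and> (loop \<longrightarrow> \<phi> 0 = \<phi> 1)
        \<longrightarrow> distortion M X f \<le> distortion M X \<phi>)"

text \<open>
  The point \<open>f \<tau>\<close> is the foot of a perpendicular from \<open>X\<close> to the curve. The choice of \<open>\<tau>\<close> among several
  nearest parameters is left open on purpose: the proof varies it.
\<close>

definition foot :: "(real \<Rightarrow> 'a) \<Rightarrow> ('w \<Rightarrow> real) \<Rightarrow> bool" where
  "foot f \<tau> \<longleftrightarrow> \<tau> \<in> borel_measurable M \<and>
     (\<forall>\<omega>. \<tau> \<omega> \<in> {0..1} \<and> norm (X \<omega> - f (\<tau> \<omega>)) = infdist (X \<omega>) (path_image f))"

lemma optimal_lipschitz: "optimal f \<Longrightarrow> L-lipschitz_on {0..1} f"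
  by (simp add: optimal_def)

lemma optimal_path: "optimal f \<Longrightarrow> path f"
  by (metis optimal_lipschitz lipschitz_path)

lemma optimal_loop: "optimal f \<Longrightarrow> loop \<Longrightarrow> f 0 = f 1"
  unfolding optimal_def by blast

text \<open>
  The distortion depends on the image only.
\<close>

lemma optimal_reparametrized:
  assumes opt: "optimal f" and g: "dominated 0 1 g (\<lambda>x. L * x)" "path_image g = path_image f" "loop \<Longrightarrow> g 0 = g 1"
  shows "optimal g"
proof -
  have "L-lipschitz_on {0..1} g"
    using L_pos g(1)
    by (intro lipschitz_on_leI) (auto simp: dominated_def dist_norm norm_minus_commute right_diff_distrib)
  moreover have "distortion M X g = distortion M X f" using g(2) by (simp add: distortion_def)
  ultimately show ?thesis using opt g(3) by (simp add: optimal_def)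
qed

lemma footD:
  assumes "foot f \<tau>"
  shows "\<tau> \<in> borel_measurable M" "\<tau> \<omega> \<in> {0..1}" "0 \<le> \<tau> \<omega>" "\<tau> \<omega> \<le> 1"
    "norm (X \<omega> - f (\<tau> \<omega>)) = infdist (X \<omega>) (path_image f)"
  using assms by (auto simp: foot_def)

lemma foot_nearest:
  assumes "foot f \<tau>" "t \<in> {0..1}"
  shows "norm (X \<omega> - f (\<tau> \<omega>)) \<le> norm (X \<omega> - f t)"
  using footD(5)[OF assms(1), of \<omega>] infdist_le[of "f t" "path_image f" "X \<omega>"] assms(2)
  by (simp add: dist_norm path_image_def)

text \<open>
  The least admissible parameter is measurable: it is at most \<open>c\<close> exactly when the part of the curve
  up to time \<open>c\<close> is as near to \<open>X\<close> as the whole curve. Restricting the parameters to a closed set \<open>T\<close>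
  that still covers the image is what later removes the load from the arcs outside \<open>T\<close>.
\<close>

lemma foot_exists:
  assumes f: "path f" and T: "closed T" "T \<subseteq> {0..1}" and im: "f ` T = path_image f"
  shows "\<exists>\<tau>. foot f \<tau> \<and> (\<forall>\<omega>. \<tau> \<omega> \<in> T)"
proof -
  have cf: "continuous_on S f" if "S \<subseteq> {0..1}" for S
    using f that continuous_on_subset path_def by blast
  have cT: "compact T"
    using T by (meson bounded_closed_interval bounded_subset compact_eq_bounded_closed)
  define N where "N \<omega> = {t \<in> T. infdist (X \<omega>) (path_image f) = dist (X \<omega>) (f t)}" for \<omega>
  define \<tau> where "\<tau> \<omega> = Inf (N \<omega>)" for \<omega>
  have clN: "closed (N \<omega>)" for \<omega>
  proof -
    have "closed {t \<in> T. infdist (X \<omega>) (path_image f) = dist (X \<omega>) (f t)}"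
      by (intro continuous_closed_preimage_constant[of T "\<lambda>t. dist (X \<omega>) (f t)", simplified eq_commute] T
          continuous_intros cf)
    then show ?thesis by (simp add: N_def)
  qed
  have neN: "N \<omega> \<noteq> {}" for \<omega>
  proof -
    have "closed (path_image f)" "path_image f \<noteq> {}"
      using f by (auto simp: closed_path_image)
    then obtain y where "y \<in> path_image f" "infdist (X \<omega>) (path_image f) = dist (X \<omega>) y"
      by (rule infdist_attains_inf)
    moreover from this obtain t where "t \<in> T" "y = f t" using im by (metis imageE)
    ultimately show ?thesis by (auto simp: N_def)
  qed
  have bN: "bdd_below (N \<omega>)" for \<omega>
    using T by (auto simp: N_def intro!: bdd_belowI[of _ 0])
  have \<tau>N: "\<tau> \<omega> \<in> N \<omega>" for \<omega>
    unfolding \<tau>_def by (rule closed_contains_Inf[OF neN bN clN])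
  have le_iff: "\<tau> \<omega> \<le> c \<longleftrightarrow> T \<inter> {..c} \<noteq> {} \<and> infdist (X \<omega>) (f ` (T \<inter> {..c})) \<le> infdist (X \<omega>) (path_image f)"
    for \<omega> c
  proof
    assume "\<tau> \<omega> \<le> c"
    then have "\<tau> \<omega> \<in> T \<inter> {..c}" "infdist (X \<omega>) (path_image f) = dist (X \<omega>) (f (\<tau> \<omega>))"
      using \<tau>N[of \<omega>] by (auto simp: N_def)
    then show "T \<inter> {..c} \<noteq> {} \<and> infdist (X \<omega>) (f ` (T \<inter> {..c})) \<le> infdist (X \<omega>) (path_image f)"
      by (metis empty_iff imageI infdist_le)
  next
    assume r: "T \<inter> {..c} \<noteq> {} \<and> infdist (X \<omega>) (f ` (T \<inter> {..c})) \<le> infdist (X \<omega>) (path_image f)"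
    have "compact (f ` (T \<inter> {..c}))"
      using T by (intro compact_continuous_image cf compact_Int_closed cT) auto
    then have "closed (f ` (T \<inter> {..c}))" by (rule compact_imp_closed)
    moreover have "f ` (T \<inter> {..c}) \<noteq> {}" using r by simp
    ultimately obtain y where "y \<in> f ` (T \<inter> {..c})"
        "infdist (X \<omega>) (f ` (T \<inter> {..c})) = dist (X \<omega>) y"
      by (rule infdist_attains_inf)
    then obtain t where t: "t \<in> T" "t \<le> c" "dist (X \<omega>) (f t) \<le> infdist (X \<omega>) (path_image f)"
      using r by auto
    have "infdist (X \<omega>) (path_image f) \<le> dist (X \<omega>) (f t)"
      using t im by (intro infdist_le) auto
    with t have "t \<in> N \<omega>" by (simp add: N_def)
    then show "\<tau> \<omega> \<le> c" unfolding \<tau>_def using cInf_lower[OF _ bN] t(2) by fastforce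
  qed
  have "\<tau> \<in> borel_measurable M"
  proof (subst borel_measurable_iff_le, intro allI)
    fix c
    have m: "(\<lambda>\<omega>. infdist (X \<omega>) S) \<in> borel_measurable M" for S
      by (rule borel_measurable_continuous_on[OF _ X_measurable]) (intro continuous_intros)
    have "{\<omega> \<in> space M. \<tau> \<omega> \<le> c} = (if T \<inter> {..c} = {} then {} else
      {\<omega> \<in> space M. infdist (X \<omega>) (f ` (T \<inter> {..c})) \<le> infdist (X \<omega>) (path_image f)})"
      by (auto simp: le_iff)
    moreover have "\<dots> \<in> sets M" using borel_measurable_le[OF m m] by simp
    ultimately show "{\<omega> \<in> space M. \<tau> \<omega> \<le> c} \<in> sets M" by simp
  qed
  then have "foot f \<tau>"
    using \<tau>N subsetD[OF T(2)] by (auto simp: foot_def N_def dist_norm)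
  then show ?thesis using \<tau>N by (auto simp: N_def)
qed

lemma some_foot:
  assumes "path f"
  shows "\<exists>\<tau>. foot f \<tau>"
proof -
  have "\<exists>\<tau>. foot f \<tau> \<and> (\<forall>\<omega>. \<tau> \<omega> \<in> {0..1})"
    by (rule foot_exists[OF assms]) (auto simp: path_image_def)
  then show ?thesis by blast
qed

lemma measurable_along:
  assumes "continuous_on {0..1::real} \<phi>" "\<tau> \<in> borel_measurable M" "\<And>\<omega>. \<tau> \<omega> \<in> {0..1}"
  shows "(\<lambda>\<omega>. \<phi> (\<tau> \<omega>) :: 'b::euclidean_space) \<in> borel_measurable M"
proof -
  have "continuous_on UNIV (\<lambda>x. \<phi> (max 0 (min 1 x)))"
  proof (rule continuous_on_compose2[OF assms(1)])
    show "continuous_on UNIV (\<lambda>x::real. max 0 (min 1 x))"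
      by (intro continuous_on_max continuous_on_min continuous_on_const continuous_on_id)
    show "(\<lambda>x::real. max 0 (min 1 x)) ` UNIV \<subseteq> {0..1}" by auto
  qed
  then have "(\<lambda>\<omega>. \<phi> (max 0 (min 1 (\<tau> \<omega>)))) \<in> borel_measurable M"
    by (rule borel_measurable_continuous_on) (rule assms)
  moreover have "max 0 (min 1 (\<tau> \<omega>)) = \<tau> \<omega>" for \<omega> using assms(3)[of \<omega>] by simp
  ultimately show ?thesis by simp
qed

lemma bounded_along:
  assumes "continuous_on {0..1::real} (\<phi> :: real \<Rightarrow> 'b::euclidean_space)"
  obtains B where "B > 0" "\<And>t. t \<in> {0..1} \<Longrightarrow> norm (\<phi> t) \<le> B"
proof -
  have "bounded (\<phi> ` {0..1})"
    by (intro compact_imp_bounded compact_continuous_image assms compact_Icc)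
  then show ?thesis using that unfolding bounded_pos by auto
qed

lemma foot_measurable:
  assumes "path f" "foot f \<tau>"
  shows "(\<lambda>\<omega>. f (\<tau> \<omega>)) \<in> borel_measurable M"
  using measurable_along[OF _ footD(1,2)[OF assms(2)]] assms(1) by (simp add: path_def)

lemma X_integrable: "integrable M X"
proof (rule Bochner_Integration.integrable_bound)
  show "integrable M (\<lambda>\<omega>. 1 + (norm (X \<omega>))\<^sup>2)" using X_square by simp
  show "AE \<omega> in M. norm (X \<omega>) \<le> norm (1 + (norm (X \<omega>))\<^sup>2)"
  proof (rule AE_I2)
    fix \<omega>
    have "0 \<le> (norm (X \<omega>) - 1)\<^sup>2" by simp
    then have "2 * norm (X \<omega>) \<le> 1 + (norm (X \<omega>))\<^sup>2" by (simp add: power2_diff)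
    moreover have "0 \<le> (norm (X \<omega>))\<^sup>2" by simp
    ultimately have "norm (X \<omega>) \<le> 1 + (norm (X \<omega>))\<^sup>2" by linarith
    then show "norm (X \<omega>) \<le> norm (1 + (norm (X \<omega>))\<^sup>2)" by simp
  qed
qed simp

lemma integrable_bounded:
  assumes "Z \<in> borel_measurable M" "\<And>\<omega>. norm (Z \<omega>) \<le> B"
  shows "integrable M (Z :: 'w \<Rightarrow> 'b::{banach, second_countable_topology})"
  using assms by (intro integrable_const_bound[where B = B]) auto

lemma integrable_diff_square:
  assumes Z: "Z \<in> borel_measurable M" "\<And>\<omega>. norm (Z \<omega>) \<le> B"
  shows "integrable M (\<lambda>\<omega>. (norm (X \<omega> - Z \<omega>))\<^sup>2)"
proof (rule Bochner_Integration.integrable_bound)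
  show "integrable M (\<lambda>\<omega>. 2 * (norm (X \<omega>))\<^sup>2 + 2 * B\<^sup>2)" using X_square by simp
  show "AE \<omega> in M. norm ((norm (X \<omega> - Z \<omega>))\<^sup>2) \<le> norm (2 * (norm (X \<omega>))\<^sup>2 + 2 * B\<^sup>2)"
  proof (rule AE_I2)
    fix \<omega>
    have "norm (X \<omega> - Z \<omega>) \<le> norm (X \<omega>) + B"
      using norm_triangle_ineq4[of "X \<omega>" "Z \<omega>"] Z(2)[of \<omega>] by linarith
    then have "(norm (X \<omega> - Z \<omega>))\<^sup>2 \<le> (norm (X \<omega>) + B)\<^sup>2" by (intro power_mono) auto
    also have "\<dots> \<le> 2 * (norm (X \<omega>))\<^sup>2 + 2 * B\<^sup>2"
      using zero_le_power2[of "norm (X \<omega>) - B"] by (simp add: power2_sum power2_diff)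
    finally show "norm ((norm (X \<omega> - Z \<omega>))\<^sup>2) \<le> norm (2 * (norm (X \<omega>))\<^sup>2 + 2 * B\<^sup>2)" by simp
  qed
qed (use Z in simp)

lemma integrable_weighted:
  assumes "Z \<in> borel_measurable M" "\<And>\<omega>. norm (Z \<omega>) \<le> B"
    and "w \<in> borel_measurable M" "\<And>\<omega>. \<bar>w \<omega>\<bar> \<le> C"
  shows "integrable M (\<lambda>\<omega>. w \<omega> *\<^sub>R (X \<omega> - Z \<omega>))"
proof (rule Bochner_Integration.integrable_bound)
  show "integrable M (\<lambda>\<omega>. C * norm (X \<omega> - Z \<omega>))"
    by (intro integrable_mult_right integrable_norm Bochner_Integration.integrable_diff
        X_integrable integrable_bounded[OF assms(1,2)])
  show "AE \<omega> in M. norm (w \<omega> *\<^sub>R (X \<omega> - Z \<omega>)) \<le> norm (C * norm (X \<omega> - Z \<omega>))"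
  proof (rule AE_I2)
    fix \<omega>
    have "\<bar>w \<omega>\<bar> * norm (X \<omega> - Z \<omega>) \<le> \<bar>C\<bar> * norm (X \<omega> - Z \<omega>)"
      using assms(4)[of \<omega>] by (intro mult_right_mono) auto
    then show "norm (w \<omega> *\<^sub>R (X \<omega> - Z \<omega>)) \<le> norm (C * norm (X \<omega> - Z \<omega>))"
      by (simp add: abs_mult)
  qed
qed (use assms in simp)

lemma distortion_foot:
  assumes "foot f \<tau>"
  shows "distortion M X f = (\<integral>\<omega>. (norm (X \<omega> - f (\<tau> \<omega>)))\<^sup>2 \<partial>M)"
  unfolding distortion_def using footD(5)[OF assms] by simp

lemma distortion_le:
  assumes "path \<phi>" "\<sigma> \<in> borel_measurable M" "\<And>\<omega>. \<sigma> \<omega> \<in> {0..1}"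
  shows "distortion M X \<phi> \<le> (\<integral>\<omega>. (norm (X \<omega> - \<phi> (\<sigma> \<omega>)))\<^sup>2 \<partial>M)"
proof -
  obtain \<tau> where \<tau>: "foot \<phi> \<tau>" using some_foot[OF assms(1)] by blast
  have c: "continuous_on {0..1} \<phi>" using assms(1) by (simp add: path_def)
  obtain B where B: "\<And>t. t \<in> {0..1} \<Longrightarrow> norm (\<phi> t) \<le> B" using bounded_along[OF c] by metis
  show ?thesis
    unfolding distortion_foot[OF \<tau>]
  proof (rule integral_mono)
    show "integrable M (\<lambda>\<omega>. (norm (X \<omega> - \<phi> (\<tau> \<omega>)))\<^sup>2)"
      by (rule integrable_diff_square[OF foot_measurable[OF assms(1) \<tau>] B[OF footD(2)[OF \<tau>]]])
    show "integrable M (\<lambda>\<omega>. (norm (X \<omega> - \<phi> (\<sigma> \<omega>)))\<^sup>2)"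
      by (rule integrable_diff_square[OF measurable_along[OF c assms(2,3)] B[OF assms(3)]])
    show "(norm (X \<omega> - \<phi> (\<tau> \<omega>)))\<^sup>2 \<le> (norm (X \<omega> - \<phi> (\<sigma> \<omega>)))\<^sup>2" for \<omega>
      using foot_nearest[OF \<tau> assms(3)] by (intro power_mono) auto
  qed
qed

text \<open>
  Any curve of positive length becomes a competitor after rescaling to length \<open>L\<close>. So length saved by a
  perturbation can be spent, and length used by it can be paid for, by a homothety.
\<close>

lemma optimal_le_scaled:
  assumes "optimal f" "path \<phi>" "dominated 0 1 \<phi> A" "A 1 - A 0 \<le> len" "0 < len" "loop \<Longrightarrow> \<phi> 0 = \<phi> 1"
    and "\<sigma> \<in> borel_measurable M" "\<And>\<omega>. \<sigma> \<omega> \<in> {0..1}"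
  shows "distortion M X f \<le> (\<integral>\<omega>. (norm (X \<omega> - (L / len) *\<^sub>R \<phi> (\<sigma> \<omega>)))\<^sup>2 \<partial>M)"
proof -
  define r where "r = L / len"
  define \<psi> where "\<psi> = (\<lambda>x. r *\<^sub>R \<phi> x)"
  have r: "0 \<le> r" using L_pos assms(5) by (simp add: r_def)
  have "path \<psi>" using assms(2) by (auto simp: \<psi>_def path_def intro!: continuous_intros)
  moreover have "curve_length \<psi> \<le> ennreal L"
  proof -
    have "curve_length \<psi> \<le> ennreal (r * A 1 - r * A 0)"
      unfolding \<psi>_def by (rule curve_length_le_dominated[OF dominated_scale[OF assms(3) r]])
    also have "r * A 1 - r * A 0 \<le> r * len"
      using mult_left_mono[OF assms(4) r] by (simp add: right_diff_distrib)
    then have "ennreal (r * A 1 - r * A 0) \<le> ennreal L"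
      using assms(5) by (intro ennreal_leI) (simp add: r_def)
    finally show ?thesis .
  qed
  ultimately have "distortion M X f \<le> distortion M X \<psi>"
    using assms(1,6) by (auto simp: optimal_def \<psi>_def)
  also have "\<dots> \<le> (\<integral>\<omega>. (norm (X \<omega> - \<psi> (\<sigma> \<omega>)))\<^sup>2 \<partial>M)"
    by (rule distortion_le[OF \<open>path \<psi>\<close> assms(7,8)])
  finally show ?thesis by (simp add: \<psi>_def r_def)
qed

end

section \<open>The first variation\<close>

lemma nonpos_if_le_small:
  fixes u w :: real
  assumes "0 < e0" "\<And>e. 0 < e \<Longrightarrow> e \<le> e0 \<Longrightarrow> u \<le> e * w"
  shows "u \<le> 0"
proof (rule tendsto_lowerbound[of "\<lambda>e. e * w" _ "at_right 0"])
  show "((\<lambda>e. e * w) \<longlongrightarrow> 0) (at_right 0)"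
    by (intro tendsto_mult_left_zero tendsto_ident_at)
  show "\<forall>\<^sub>F e in at_right 0. u \<le> e * w"
    unfolding eventually_at_right_field using assms by (intro exI[of _ e0]) auto
qed simp

context length_constrained
begin

lemma integrable_inner_foot:
  assumes "path f" "foot f \<tau>" "W \<in> borel_measurable M" "\<And>\<omega>. norm (W \<omega>) \<le> B"
  shows "integrable M (\<lambda>\<omega>. (X \<omega> - f (\<tau> \<omega>)) \<bullet> W \<omega>)"
proof (rule Bochner_Integration.integrable_bound)
  note [measurable] = foot_measurable[OF assms(1,2)] assms(3)
  obtain C where C: "\<And>t. t \<in> {0..1} \<Longrightarrow> norm (f t) \<le> C"
    using bounded_along assms(1) unfolding path_def by metis
  show "integrable M (\<lambda>\<omega>. B * norm (X \<omega> - f (\<tau> \<omega>)))"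
    by (intro integrable_mult_right integrable_norm Bochner_Integration.integrable_diff
        X_integrable integrable_bounded[OF foot_measurable[OF assms(1,2)] C[OF footD(2)[OF assms(2)]]])
  show "(\<lambda>\<omega>. (X \<omega> - f (\<tau> \<omega>)) \<bullet> W \<omega>) \<in> borel_measurable M" by measurable
  show "AE \<omega> in M. norm ((X \<omega> - f (\<tau> \<omega>)) \<bullet> W \<omega>) \<le> norm (B * norm (X \<omega> - f (\<tau> \<omega>)))"
  proof (rule AE_I2)
    fix \<omega>
    have "\<bar>(X \<omega> - f (\<tau> \<omega>)) \<bullet> W \<omega>\<bar> \<le> norm (X \<omega> - f (\<tau> \<omega>)) * norm (W \<omega>)"
      by (rule Cauchy_Schwarz_ineq2)
    also have "\<dots> \<le> norm (X \<omega> - f (\<tau> \<omega>)) * \<bar>B\<bar>"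
      using assms(4)[of \<omega>] by (intro mult_left_mono) auto
    finally show "norm ((X \<omega> - f (\<tau> \<omega>)) \<bullet> W \<omega>) \<le> norm (B * norm (X \<omega> - f (\<tau> \<omega>)))"
      by (simp add: abs_mult mult.commute)
  qed
qed

lemma foot_square_integrable:
  assumes "path f" "foot f \<tau>"
  shows "integrable M (\<lambda>\<omega>. (norm (X \<omega> - f (\<tau> \<omega>)))\<^sup>2)"
proof -
  obtain C where C: "\<And>t. t \<in> {0..1} \<Longrightarrow> norm (f t) \<le> C"
    using bounded_along assms(1) unfolding path_def by metis
  show ?thesis
    by (rule integrable_diff_square[OF foot_measurable[OF assms] C[OF footD(2)[OF assms(2)]]])
qed

lemma integral_displaced_square_le:
  assumes f: "path f" "foot f \<tau>" and W: "W \<in> borel_measurable M" "\<And>\<omega>. norm (W \<omega>) \<le> B"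
  shows "(\<integral>\<omega>. (norm (X \<omega> - f (\<tau> \<omega>) - W \<omega>))\<^sup>2 \<partial>M)
     \<le> distortion M X f - 2 * (\<integral>\<omega>. (X \<omega> - f (\<tau> \<omega>)) \<bullet> W \<omega> \<partial>M) + B\<^sup>2"
proof -
  note i = foot_square_integrable[OF f] integrable_inner_foot[OF f W]
  have iW: "integrable M (\<lambda>\<omega>. (norm (W \<omega>))\<^sup>2)"
    using W by (intro integrable_bounded[where B = "B\<^sup>2"]) (auto intro!: power_mono)
  have "(\<integral>\<omega>. (norm (X \<omega> - f (\<tau> \<omega>) - W \<omega>))\<^sup>2 \<partial>M)
     = (\<integral>\<omega>. (norm (X \<omega> - f (\<tau> \<omega>)))\<^sup>2 - 2 * ((X \<omega> - f (\<tau> \<omega>)) \<bullet> W \<omega>) + (norm (W \<omega>))\<^sup>2 \<partial>M)"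
    by (intro Bochner_Integration.integral_cong refl)
      (simp add: power2_norm_eq_inner inner_diff_left inner_diff_right inner_commute)
  also have "\<dots> = distortion M X f - 2 * (\<integral>\<omega>. (X \<omega> - f (\<tau> \<omega>)) \<bullet> W \<omega> \<partial>M) + (\<integral>\<omega>. (norm (W \<omega>))\<^sup>2 \<partial>M)"
    using i iW by (simp add: distortion_foot[OF f(2)])
  also have "(\<integral>\<omega>. (norm (W \<omega>))\<^sup>2 \<partial>M) \<le> (\<integral>\<omega>. B\<^sup>2 \<partial>M)"
    using W iW by (intro integral_mono) (auto intro!: power_mono)
  finally show ?thesis by (simp add: prob_space)
qed

text \<open>
  Up to the factor \<open>L\<^sup>2\<close>, this is the Lagrange multiplier of the length constraint: half the rate at
  which the distortion drops when the curve is magnified.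
\<close>

definition tension :: "(real \<Rightarrow> 'a) \<Rightarrow> ('w \<Rightarrow> real) \<Rightarrow> real" where
  "tension f \<tau> = (\<integral>\<omega>. (X \<omega> - f (\<tau> \<omega>)) \<bullet> f (\<tau> \<omega>) \<partial>M)"

text \<open>
  Here \<open>c\<close> bounds the first variation of the length in the direction \<open>g\<close>. If it is attained, rescaling \<open>f + \<epsilon> g\<close> to length \<open>L\<close>
  displaces \<open>f \<tau>\<close> by \<open>\<epsilon> (g \<tau> - (c / L) f \<tau>)\<close> at first order, and optimality forbids that this
  displacement has positive inner product with the residual in the mean.
\<close>

lemma first_variation_le:
  assumes opt: "optimal f" and \<tau>: "foot f \<tau>"
    and g: "continuous_on {0..1} g" "loop \<Longrightarrow> g 0 = g 1"
    and len: "\<And>\<epsilon>. 0 < \<epsilon> \<Longrightarrow> \<exists>A. dominated 0 1 (\<lambda>x. f x + \<epsilon> *\<^sub>R g x) A \<and> A 1 - A 0 \<le> L + \<epsilon> * c + \<epsilon>\<^sup>2 * K"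
  shows "L * (\<integral>\<omega>. (X \<omega> - f (\<tau> \<omega>)) \<bullet> g (\<tau> \<omega>) \<partial>M) \<le> tension f \<tau> * c"
proof -
  have f: "path f" using opt by (rule optimal_path)
  have cf: "continuous_on {0..1} f" using f by (simp add: path_def)
  obtain p where p: "p > 0" "\<And>t. t \<in> {0..1} \<Longrightarrow> norm (f t) \<le> p" using bounded_along[OF cf] by metis
  obtain G where G: "G > 0" "\<And>t. t \<in> {0..1} \<Longrightarrow> norm (g t) \<le> G" using bounded_along[OF g(1)] by metis
  have \<tau>01: "\<tau> \<omega> \<in> {0..1}" for \<omega> using footD(2)[OF \<tau>] .
  have mf[measurable]: "(\<lambda>\<omega>. f (\<tau> \<omega>)) \<in> borel_measurable M" by (rule foot_measurable[OF f \<tau>])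
  have mg[measurable]: "(\<lambda>\<omega>. g (\<tau> \<omega>)) \<in> borel_measurable M"
    by (rule measurable_along[OF g(1) footD(1)[OF \<tau>] \<tau>01])
  define a b where "a = tension f \<tau>" and "b = (\<integral>\<omega>. (X \<omega> - f (\<tau> \<omega>)) \<bullet> g (\<tau> \<omega>) \<partial>M)"
  define N where "N = (\<bar>c\<bar> + \<bar>K\<bar>) * p + L * G"
  have if': "integrable M (\<lambda>\<omega>. (X \<omega> - f (\<tau> \<omega>)) \<bullet> f (\<tau> \<omega>))"
    by (rule integrable_inner_foot[OF f \<tau> mf p(2)[OF \<tau>01]])
  have ig: "integrable M (\<lambda>\<omega>. (X \<omega> - f (\<tau> \<omega>)) \<bullet> g (\<tau> \<omega>))"
    by (rule integrable_inner_foot[OF f \<tau> mg G(2)[OF \<tau>01]])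
  \<comment> \<open>The bound keeps the length of the perturbed curve above \<open>L / 2\<close>.\<close>
  define e0 where "e0 = min 1 (L / (2 * (\<bar>c\<bar> + \<bar>K\<bar> + 1)))"
  have e0: "0 < e0" using L_pos by (simp add: e0_def)
  have step: "2 * (L * b - a * c) \<le> \<epsilon> * (2 * a * K + 2 * N\<^sup>2 / L)" if e: "0 < \<epsilon>" "\<epsilon> \<le> e0" for \<epsilon>
  proof -
    define d where "d = c + \<epsilon> * K"
    define len where "len = L + \<epsilon> * d"
    have "\<epsilon> \<le> 1" using e by (simp add: e0_def)
    have dle: "\<bar>d\<bar> \<le> \<bar>c\<bar> + \<bar>K\<bar>"
    proof -
      have "\<bar>\<epsilon> * K\<bar> \<le> 1 * \<bar>K\<bar>" unfolding abs_mult using e \<open>\<epsilon> \<le> 1\<close> by (intro mult_right_mono) auto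
      then show ?thesis unfolding d_def by linarith
    qed
    have len2: "L / 2 \<le> len"
    proof -
      have "\<bar>\<epsilon> * d\<bar> \<le> L / (2 * (\<bar>c\<bar> + \<bar>K\<bar> + 1)) * (\<bar>c\<bar> + \<bar>K\<bar> + 1)"
        unfolding abs_mult using e dle by (intro mult_mono) (auto simp: e0_def)
      also have "\<dots> = L / 2"
      proof -
        have *: "L / (2 * s) * s = L / 2" if "s > 0" for s using that by simp
        show ?thesis by (rule *) linarith
      qed
      finally show ?thesis unfolding len_def by linarith
    qed
    then have lenp: "len > 0" using L_pos by linarith
    define r where "r = L / len"
    have r1: "r - 1 = - \<epsilon> * d / len" using lenp by (simp add: r_def len_def field_simps)
    obtain A where A: "dominated 0 1 (\<lambda>x. f x + \<epsilon> *\<^sub>R g x) A" "A 1 - A 0 \<le> len"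
      using len[OF e(1)] by (auto simp: len_def d_def algebra_simps power2_eq_square)
    \<comment> \<open>The displacement of the foot under perturbation and rescaling.\<close>
    define W where "W \<omega> = (r - 1) *\<^sub>R f (\<tau> \<omega>) + (r * \<epsilon>) *\<^sub>R g (\<tau> \<omega>)" for \<omega>
    have mW: "W \<in> borel_measurable M" unfolding W_def by measurable
    have nW: "norm (W \<omega>) \<le> \<epsilon> * N / len" for \<omega>
    proof -
      have "norm (W \<omega>) \<le> \<bar>r - 1\<bar> * norm (f (\<tau> \<omega>)) + \<bar>r * \<epsilon>\<bar> * norm (g (\<tau> \<omega>))"
        unfolding W_def by (rule norm_triangle_le) simp
      also have "\<dots> \<le> (\<epsilon> * (\<bar>c\<bar> + \<bar>K\<bar>) / len) * p + (\<epsilon> * L / len) * G"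
      proof (intro add_mono mult_mono p(2) G(2) \<tau>01)
        have "\<bar>r - 1\<bar> = \<epsilon> * \<bar>d\<bar> / len" unfolding r1 using e lenp by (simp add: abs_mult)
        also have "\<dots> \<le> \<epsilon> * (\<bar>c\<bar> + \<bar>K\<bar>) / len"
          using dle e lenp by (intro divide_right_mono mult_left_mono) auto
        finally show "\<bar>r - 1\<bar> \<le> \<epsilon> * (\<bar>c\<bar> + \<bar>K\<bar>) / len" .
        show "\<bar>r * \<epsilon>\<bar> \<le> \<epsilon> * L / len" using e lenp L_pos by (simp add: r_def abs_mult mult.commute)
      qed (use e lenp L_pos in auto)
      also have "\<dots> = \<epsilon> * N / len" by (simp add: N_def add_divide_distrib algebra_simps)
      finally show ?thesis .
    qed
    have "distortion M X f \<le> (\<integral>\<omega>. (norm (X \<omega> - (L / len) *\<^sub>R (f (\<tau> \<omega>) + \<epsilon> *\<^sub>R g (\<tau> \<omega>))))\<^sup>2 \<partial>M)"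
    proof (rule optimal_le_scaled[OF opt _ A lenp _ footD(1)[OF \<tau>] \<tau>01])
      show "path (\<lambda>x. f x + \<epsilon> *\<^sub>R g x)"
        unfolding path_def by (intro continuous_intros cf g)
      show "f 0 + \<epsilon> *\<^sub>R g 0 = f 1 + \<epsilon> *\<^sub>R g 1" if loop
        using that optimal_loop[OF opt] g(2) by simp
    qed
    also have "\<dots> = (\<integral>\<omega>. (norm (X \<omega> - f (\<tau> \<omega>) - W \<omega>))\<^sup>2 \<partial>M)"
      by (simp add: W_def r_def[symmetric] algebra_simps)
    also have "\<dots> \<le> distortion M X f - 2 * (\<integral>\<omega>. (X \<omega> - f (\<tau> \<omega>)) \<bullet> W \<omega> \<partial>M) + (\<epsilon> * N / len)\<^sup>2"
      by (rule integral_displaced_square_le[OF f \<tau> mW nW])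
    also have "(\<integral>\<omega>. (X \<omega> - f (\<tau> \<omega>)) \<bullet> W \<omega> \<partial>M) = (r - 1) * a + r * \<epsilon> * b"
      using if' ig by (simp add: W_def inner_add_right a_def b_def tension_def)
    finally have "2 * ((r - 1) * a + r * \<epsilon> * b) \<le> (\<epsilon> * N / len)\<^sup>2" by simp
    also have "2 * ((r - 1) * a + r * \<epsilon> * b) = (\<epsilon> / len) * (2 * (L * b - a * d))"
      unfolding r1 by (simp add: r_def field_simps diff_divide_distrib)
    also have "(\<epsilon> * N / len)\<^sup>2 = (\<epsilon> / len) * (\<epsilon> * N\<^sup>2 / len)"
      by (simp add: power2_eq_square)
    finally have "2 * (L * b - a * d) \<le> \<epsilon> * N\<^sup>2 / len"
      by (rule mult_left_le_imp_le) (use e lenp in simp)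
    also have "\<dots> \<le> \<epsilon> * N\<^sup>2 / (L / 2)"
      using len2 L_pos lenp e by (intro divide_left_mono) auto
    finally show ?thesis by (simp add: d_def algebra_simps)
  qed
  have "2 * (L * b - a * c) \<le> 0" by (rule nonpos_if_le_small[OF e0 step])
  then show ?thesis by (simp add: a_def b_def)
qed

lemma first_variation:
  assumes opt: "optimal f" and \<tau>: "foot f \<tau>"
    and g: "continuous_on {0..1} g" "loop \<Longrightarrow> g 0 = g 1"
    and len: "\<And>\<epsilon>. \<exists>A. dominated 0 1 (\<lambda>x. f x + \<epsilon> *\<^sub>R g x) A \<and> A 1 - A 0 \<le> L + \<epsilon> * c + \<epsilon>\<^sup>2 * K"
  shows "L * (\<integral>\<omega>. (X \<omega> - f (\<tau> \<omega>)) \<bullet> g (\<tau> \<omega>) \<partial>M) = tension f \<tau> * c"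
proof (rule antisym)
  show "L * (\<integral>\<omega>. (X \<omega> - f (\<tau> \<omega>)) \<bullet> g (\<tau> \<omega>) \<partial>M) \<le> tension f \<tau> * c"
    using assms by (rule first_variation_le)
  have "L * (\<integral>\<omega>. (X \<omega> - f (\<tau> \<omega>)) \<bullet> (- g (\<tau> \<omega>)) \<partial>M) \<le> tension f \<tau> * (- c)"
  proof (rule first_variation_le[OF opt \<tau>])
    show "continuous_on {0..1} (\<lambda>x. - g x)" by (intro continuous_intros g)
    show "- g 0 = - g 1" if loop using g(2)[OF that] by simp
    show "\<exists>A. dominated 0 1 (\<lambda>x. f x + \<epsilon> *\<^sub>R - g x) A \<and> A 1 - A 0 \<le> L + \<epsilon> * - c + \<epsilon>\<^sup>2 * K" for \<epsilon>
      using len[of "- \<epsilon>"] by simp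
  qed
  then show "tension f \<tau> * c \<le> L * (\<integral>\<omega>. (X \<omega> - f (\<tau> \<omega>)) \<bullet> g (\<tau> \<omega>) \<partial>M)" by simp
qed

text \<open>
  Translations do not change the length.
\<close>

lemma centered:
  assumes opt: "optimal f" and \<tau>: "foot f \<tau>"
  shows "(\<integral>\<omega>. X \<omega> - f (\<tau> \<omega>) \<partial>M) = 0"
proof (rule vector_eq_rdot[THEN iffD1], rule allI)
  fix v :: 'a
  have f: "path f" using opt by (rule optimal_path)
  have cf: "continuous_on {0..1} f" using f by (simp add: path_def)
  obtain p where p: "p > 0" "\<And>t. t \<in> {0..1} \<Longrightarrow> norm (f t) \<le> p" using bounded_along[OF cf] by metis
  have i: "integrable M (\<lambda>\<omega>. X \<omega> - f (\<tau> \<omega>))"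
    by (intro Bochner_Integration.integrable_diff X_integrable
        integrable_bounded[OF foot_measurable[OF f \<tau>] p(2)[OF footD(2)[OF \<tau>]]])
  have "L * (\<integral>\<omega>. (X \<omega> - f (\<tau> \<omega>)) \<bullet> v \<partial>M) = tension f \<tau> * 0"
  proof (rule first_variation[OF opt \<tau>])
    fix \<epsilon> :: real
    have "dominated 0 1 (\<lambda>x. f x + \<epsilon> *\<^sub>R v) (\<lambda>x. L * x)"
      using lipschitz_dominated[OF optimal_lipschitz[OF opt]] by (simp add: dominated_def)
    then show "\<exists>A. dominated 0 1 (\<lambda>x. f x + \<epsilon> *\<^sub>R v) A \<and> A 1 - A 0 \<le> L + \<epsilon> * 0 + \<epsilon>\<^sup>2 * 0"
      by (intro exI[of _ "\<lambda>x. L * x"]) simp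
  qed auto
  then have "(\<integral>\<omega>. (X \<omega> - f (\<tau> \<omega>)) \<bullet> v \<partial>M) = 0" using L_pos by simp
  then show "(\<integral>\<omega>. X \<omega> - f (\<tau> \<omega>) \<partial>M) \<bullet> v = 0 \<bullet> v"
    using integral_inner_left[OF i, of v] by simp
qed

end

section \<open>Positivity of the tension\<close>

text \<open>
  As \<open>p\<close> tends to \<open>q\<close>, the residuals \<open>x - p\<close> accumulate only at residuals \<open>z\<close> of points having \<open>q\<close> as a
  nearest point. Such a \<open>z\<close> satisfies \<open>2 * (z \<bullet> (p - q)) \<le> (norm (p - q))\<^sup>2\<close> for each \<open>p\<close> in \<open>\<Gamma>\<close>, so it is
  almost orthogonal to, or points away from, nearby displacements along \<open>\<Gamma>\<close>; by compactness so are
  the residuals close to it.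
\<close>

lemma nearest_point_displacement:
  fixes q :: "'a::euclidean_space"
  assumes \<delta>: "0 < \<delta>"
  shows "\<exists>r>0. \<forall>x p. p \<in> \<Gamma> \<and> norm (x - p) \<le> R \<and> (\<forall>y\<in>\<Gamma>. norm (x - p) \<le> norm (x - y)) \<and> norm (p - q) < r
            \<longrightarrow> (x - p) \<bullet> (p - q) \<le> \<delta> * norm (p - q)"
proof (rule ccontr)
  assume "\<not> ?thesis"
  then have "\<exists>x p. p \<in> \<Gamma> \<and> norm (x - p) \<le> R \<and> (\<forall>y\<in>\<Gamma>. norm (x - p) \<le> norm (x - y)) \<and> norm (p - q) < r
      \<and> \<delta> * norm (p - q) < (x - p) \<bullet> (p - q)" if "r > 0" for r
    using that by (meson not_le_imp_less)
  then have "\<forall>n. \<exists>x p. p \<in> \<Gamma> \<and> norm (x - p) \<le> R \<and> (\<forall>y\<in>\<Gamma>. norm (x - p) \<le> norm (x - y))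
      \<and> norm (p - q) < inverse (real (Suc n)) \<and> \<delta> * norm (p - q) < (x - p) \<bullet> (p - q)"
    by (metis inverse_positive_iff_positive of_nat_0_less_iff zero_less_Suc)
  then obtain x p where xp: "\<And>n::nat. p n \<in> \<Gamma>" "\<And>n. norm (x n - p n) \<le> R"
      "\<And>n y. y \<in> \<Gamma> \<Longrightarrow> norm (x n - p n) \<le> norm (x n - y)"
      "\<And>n. norm (p n - q) < inverse (real (Suc n))"
      "\<And>n. \<delta> * norm (p n - q) < (x n - p n) \<bullet> (p n - q)"
    by metis
  define y where "y n = x n - p n" for n
  have "compact (cball (0::'a) R)" by simp
  moreover have "\<forall>n. y n \<in> cball 0 R" using xp(2) by (simp add: y_def)
  ultimately obtain z s where s: "strict_mono s" and yz: "(y \<circ> s) \<longlonglongrightarrow> z"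
    unfolding compact_def by metis
  have pq: "p \<longlonglongrightarrow> q"
  proof (rule LIM_zero_cancel, rule Lim_null_comparison[where g = "\<lambda>n. inverse (real (Suc n))"])
    show "\<forall>\<^sub>F n in sequentially. norm (p n - q) \<le> inverse (real (Suc n))"
      using xp(4) by (simp add: less_imp_le)
    show "(\<lambda>n. inverse (real (Suc n))) \<longlonglongrightarrow> 0" by (rule LIMSEQ_inverse_real_of_nat)
  qed
  have pqs: "(\<lambda>n. p (s n)) \<longlonglongrightarrow> q"
    using LIMSEQ_subseq_LIMSEQ[OF pq s] by (simp add: comp_def)
  have yzs: "(\<lambda>n. y (s n)) \<longlonglongrightarrow> z" using yz by (simp add: comp_def)
  have z: "norm z \<le> norm (z + q - p n)" for n
  proof (rule tendsto_le[OF sequentially_bot])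
    show "(\<lambda>m. norm (y (s m))) \<longlonglongrightarrow> norm z" by (intro tendsto_norm yzs)
    show "(\<lambda>m. norm (y (s m) + p (s m) - p n)) \<longlonglongrightarrow> norm (z + q - p n)"
      by (intro tendsto_intros yzs pqs)
    show "\<forall>\<^sub>F m in sequentially. norm (y (s m)) \<le> norm (y (s m) + p (s m) - p n)"
      using xp(3)[OF xp(1)] by (simp add: y_def)
  qed
  have z2: "2 * (z \<bullet> (p n - q)) \<le> (norm (p n - q))\<^sup>2" for n
  proof -
    have "(norm z)\<^sup>2 \<le> (norm (z - (p n - q)))\<^sup>2"
      using z[of n] by (intro power_mono) (simp_all add: algebra_simps)
    then show ?thesis
      by (simp add: power2_norm_eq_inner inner_diff_left inner_diff_right inner_commute)
  qed
  have "\<delta> \<le> norm (p (s n) - q) / 2 + norm (y (s n) - z)" for n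
  proof -
    let ?d = "p (s n) - q"
    have "\<delta> * norm ?d < y (s n) \<bullet> ?d" using xp(5) by (simp add: y_def)
    also have "y (s n) \<bullet> ?d = z \<bullet> ?d + (y (s n) - z) \<bullet> ?d" by (simp add: inner_diff_left)
    also have "\<dots> \<le> (norm ?d)\<^sup>2 / 2 + norm (y (s n) - z) * norm ?d"
      using z2[of "s n"] norm_cauchy_schwarz[of "y (s n) - z" ?d] by linarith
    also have "\<dots> = (norm ?d / 2 + norm (y (s n) - z)) * norm ?d"
      by (simp add: power2_eq_square algebra_simps)
    finally show ?thesis by (simp add: mult_less_cancel_right)
  qed
  moreover have "(\<lambda>n. norm (p (s n) - q) / 2 + norm (y (s n) - z)) \<longlonglongrightarrow> norm (q - q) / 2 + norm (z - z)"
    by (intro tendsto_intros pqs yzs) simp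
  ultimately have "\<delta> \<le> norm (q - q) / 2 + norm (z - z)"
    by (intro tendsto_lowerbound[OF _ _ sequentially_bot]) auto
  then show False using \<delta> by simp
qed

context length_constrained
begin

text \<open>
  A positive distortion means that the residual does not vanish almost surely, so with positive
  probability its component along some signed basis vector is bounded away from \<open>0\<close>.
\<close>

lemma tilted_mass:
  assumes f: "path f" and \<tau>: "foot f \<tau>" and pos: "0 < distortion M X f"
  shows "\<exists>e h R. norm e = 1 \<and> 0 < h \<and> 0 < prob {\<omega> \<in> space M. h \<le> (X \<omega> - f (\<tau> \<omega>)) \<bullet> e \<and> norm (X \<omega> - f (\<tau> \<omega>)) \<le> R}"
proof (rule ccontr)
  assume neg: "\<not> ?thesis"
  note [measurable] = foot_measurable[OF f \<tau>]
  define Y where "Y \<omega> = X \<omega> - f (\<tau> \<omega>)" for \<omega>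
  have [measurable]: "Y \<in> borel_measurable M" unfolding Y_def by measurable
  have *: "AE \<omega> in M. \<not> (inverse (real (Suc n)) \<le> Y \<omega> \<bullet> e \<and> norm (Y \<omega>) \<le> real n)" if "norm e = 1" for e n
  proof -
    let ?S = "{\<omega> \<in> space M. inverse (real (Suc n)) \<le> Y \<omega> \<bullet> e \<and> norm (Y \<omega>) \<le> real n}"
    have "?S \<in> events" by measurable
    moreover have "prob ?S = 0"
      using neg that by (metis (no_types, lifting) Y_def inverse_positive_iff_positive measure_nonneg
          of_nat_0_less_iff order_less_le zero_less_Suc Collect_cong)
    ultimately have "AE \<omega> in M. \<omega> \<notin> ?S" using prob_eq_0 by blast
    then show ?thesis using AE_space by eventually_elim auto
  qed
  have "AE \<omega> in M. \<forall>n. \<forall>e \<in> Basis \<union> uminus ` Basis.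
      \<not> (inverse (real (Suc n)) \<le> Y \<omega> \<bullet> e \<and> norm (Y \<omega>) \<le> real n)"
    by (subst AE_all_countable, intro allI AE_finite_allI *) auto
  then have "AE \<omega> in M. (norm (Y \<omega>))\<^sup>2 = 0"
  proof eventually_elim
    case (elim \<omega>)
    show ?case
    proof (rule ccontr)
      assume "(norm (Y \<omega>))\<^sup>2 \<noteq> 0"
      then obtain b where b: "b \<in> Basis" "Y \<omega> \<bullet> b \<noteq> 0" using euclidean_all_zero_iff[of "Y \<omega>"] by auto
      then obtain e where e: "e \<in> Basis \<union> uminus ` Basis" "0 < Y \<omega> \<bullet> e"
        by (metis UnCI image_eqI inner_minus_right linorder_neqE_linordered_idom neg_0_less_iff_less)
      obtain k where k: "inverse (real (Suc k)) < Y \<omega> \<bullet> e" using reals_Archimedean[OF e(2)] by blast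
      obtain j where j: "norm (Y \<omega>) \<le> real j" using real_arch_simple by blast
      define n where "n = max k j"
      have "inverse (real (Suc n)) \<le> inverse (real (Suc k))"
        by (rule le_imp_inverse_le) (auto simp: n_def)
      then have "inverse (real (Suc n)) \<le> Y \<omega> \<bullet> e" using k by linarith
      moreover have "norm (Y \<omega>) \<le> real n" using j by (simp add: n_def)
      ultimately show False using elim e(1) by blast
    qed
  qed
  then have "(\<integral>\<omega>. (norm (Y \<omega>))\<^sup>2 \<partial>M) = 0" by (rule integral_eq_zero_AE)
  then show False using pos by (simp add: distortion_foot[OF \<tau>] Y_def)
qed

text \<open>
  If all short intervals around every point had mass at most \<open>c\<close> times their length, then so would
  \<open>[0, 1]\<close>, by bisection.
\<close>

lemma concentrated_parameter:
  assumes \<tau>: "\<tau> \<in> borel_measurable M" "\<And>\<omega>. \<tau> \<omega> \<in> {0..1}" and S: "S \<in> events" "0 < c" "c < prob S"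
  shows "\<exists>x\<in>{0..1}. \<forall>d>0. \<exists>a b. a \<le> x \<and> x \<le> b \<and> a < b \<and> b - a < d
           \<and> c * (b - a) < prob {\<omega> \<in> S. a \<le> \<tau> \<omega> \<and> \<tau> \<omega> \<le> b}"
proof (rule ccontr)
  assume neg: "\<not> ?thesis"
  note [measurable] = \<tau>(1) S(1)
  have ev[measurable]: "{\<omega> \<in> S. a \<le> \<tau> \<omega> \<and> \<tau> \<omega> \<le> b} \<in> events" for a b
  proof -
    have "{\<omega> \<in> S. a \<le> \<tau> \<omega> \<and> \<tau> \<omega> \<le> b} = {\<omega> \<in> space M. \<omega> \<in> S \<and> a \<le> \<tau> \<omega> \<and> \<tau> \<omega> \<le> b}"
      using sets.sets_into_space[OF S(1)] by auto
    also have "\<dots> \<in> events" by measurable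
    finally show ?thesis .
  qed
  define P where "P a b \<longleftrightarrow> (a < b \<longrightarrow> prob {\<omega> \<in> S. a \<le> \<tau> \<omega> \<and> \<tau> \<omega> \<le> b} \<le> c * (b - a))" for a b
  have "P 0 1"
  proof (rule Bolzano[of 0 1 P])
    fix a b d assume P: "P a b" "P b d" "a \<le> b" "b \<le> d"
    show "P a d"
    proof (cases "a = b \<or> b = d")
      case False
      have "prob {\<omega> \<in> S. a \<le> \<tau> \<omega> \<and> \<tau> \<omega> \<le> d}
          \<le> prob ({\<omega> \<in> S. a \<le> \<tau> \<omega> \<and> \<tau> \<omega> \<le> b} \<union> {\<omega> \<in> S. b \<le> \<tau> \<omega> \<and> \<tau> \<omega> \<le> d})"
        by (intro finite_measure_mono sets.Un ev) auto
      also have "\<dots> \<le> prob {\<omega> \<in> S. a \<le> \<tau> \<omega> \<and> \<tau> \<omega> \<le> b} + prob {\<omega> \<in> S. b \<le> \<tau> \<omega> \<and> \<tau> \<omega> \<le> d}"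
        by (rule measure_Un_le[OF ev ev])
      also have "\<dots> \<le> c * (b - a) + c * (d - b)"
        using P False by (intro add_mono) (auto simp: P_def)
      finally show ?thesis by (simp add: P_def algebra_simps)
    qed (use P in auto)
  next
    fix x :: real assume "0 \<le> x" "x \<le> 1"
    then have "x \<in> {0..1}" by simp
    then show "\<exists>d>0. \<forall>a b. a \<le> x \<and> x \<le> b \<and> b - a < d \<longrightarrow> P a b"
      using neg unfolding P_def by (meson not_le_imp_less)
  qed simp
  moreover have "{\<omega> \<in> S. 0 \<le> \<tau> \<omega> \<and> \<tau> \<omega> \<le> 1} = S" using \<tau>(2) by auto
  ultimately show False using S(3) by (simp add: P_def)
qed

text \<open>
  Scale by the factor \<open>s\<close> and add a spike of height \<open>\<eta>\<close> at time \<open>t0\<close>, carried by the tent function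
  \<open>1 - \<bar>V\<bar>\<close> of width \<open>\<zeta>\<close>. The function \<open>V\<close> itself rises by \<open>2\<close> and accounts for the length \<open>2 * \<eta>\<close> of the
  spike, however narrow it is.
\<close>

lemma tent_perturbation:
  fixes f :: "real \<Rightarrow> 'a"
  assumes lip: "L-lipschitz_on {0..1} f" and s: "0 \<le> s" and \<zeta>: "0 < \<zeta>" "\<zeta> \<le> t0" "t0 \<le> 1 - \<zeta>"
    and e: "norm e = 1" and \<eta>: "0 \<le> \<eta>"
  defines "V \<equiv> \<lambda>t. max (-1) (min 1 ((t - t0) / \<zeta>))"
  defines "\<phi> \<equiv> \<lambda>t. s *\<^sub>R f t + (\<eta> * (1 - \<bar>V t\<bar>)) *\<^sub>R e"
  shows "path \<phi>" "dominated 0 1 \<phi> (\<lambda>t. s * L * t + \<eta> * V t)" "V 1 = 1" "V 0 = -1" "V t0 = 0"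
    "\<zeta> \<le> \<bar>t - t0\<bar> \<Longrightarrow> \<bar>V t\<bar> = 1"
proof -
  have cf: "continuous_on {0..1} f" using lip by (rule lipschitz_on_continuous_on)
  show "path \<phi>"
    unfolding path_def \<phi>_def V_def divide_inverse by (intro continuous_intros cf)
  show "dominated 0 1 \<phi> (\<lambda>t. s * L * t + \<eta> * V t)"
  proof (rule dominatedI)
    fix x y :: real assume xy: "0 \<le> x" "x \<le> y" "y \<le> 1"
    have Vm: "V x \<le> V y"
      unfolding V_def using xy \<zeta> by (intro max.mono min.mono order_refl divide_right_mono) auto
    have "\<phi> y - \<phi> x = s *\<^sub>R (f y - f x) + (\<eta> * (\<bar>V x\<bar> - \<bar>V y\<bar>)) *\<^sub>R e"
      by (simp add: \<phi>_def algebra_simps)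
    then have "norm (\<phi> y - \<phi> x) \<le> s * norm (f y - f x) + \<eta> * \<bar>\<bar>V x\<bar> - \<bar>V y\<bar>\<bar>"
      using s e \<eta> by (auto intro!: norm_triangle_le simp: abs_mult)
    also have "\<dots> \<le> s * (L * (y - x)) + \<eta> * (V y - V x)"
    proof (intro add_mono mult_left_mono s \<eta>)
      show "norm (f y - f x) \<le> L * (y - x)"
        using lipschitz_onD[OF lip, of y x] xy by (simp add: dist_norm)
      show "\<bar>\<bar>V x\<bar> - \<bar>V y\<bar>\<bar> \<le> V y - V x" using Vm by linarith
    qed
    finally show "norm (\<phi> y - \<phi> x) \<le> s * L * y + \<eta> * V y - (s * L * x + \<eta> * V x)"
      by (simp add: algebra_simps)
  qed
  have "1 \<le> (1 - t0) / \<zeta>" "t0 / \<zeta> \<ge> 1" using \<zeta> by (simp_all add: le_divide_eq)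
  then show "V 1 = 1" "V 0 = -1" "V t0 = 0" by (simp_all add: V_def)
  show "\<bar>V t\<bar> = 1" if "\<zeta> \<le> \<bar>t - t0\<bar>"
  proof (cases "t \<le> t0")
    case True
    then have "(t - t0) / \<zeta> \<le> -1" using that \<zeta> by (simp add: divide_le_eq)
    then show ?thesis by (simp add: V_def)
  next
    case False
    then have "(t - t0) / \<zeta> \<ge> 1" using that \<zeta> by (simp add: le_divide_eq)
    then show ?thesis by (simp add: V_def)
  qed
qed

text \<open>
  The bounds on \<open>Y \<bullet> (P - q)\<close> and \<open>Y \<bullet> (q - u)\<close> limit what the residual \<open>Y\<close> loses when its foot \<open>P\<close> moves
  to the root \<open>u\<close> of the spike; its component along the spike outweighs this at the tip.
\<close>

lemma spike_gain:
  fixes Y P q u e :: 'a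
  assumes \<epsilon>: "0 \<le> \<epsilon>" "\<epsilon> \<le> 1" and \<eta>: "0 \<le> \<eta>"
    and Ye: "h \<le> Y \<bullet> e"
    and Yq: "Y \<bullet> (P - q) \<le> \<eta> * h / 4" and Yu: "Y \<bullet> (q - u) \<le> \<eta> * h / 4" and h: "0 \<le> h"
    and W: "(norm ((1 - \<epsilon>) *\<^sub>R u + \<eta> *\<^sub>R e - P))\<^sup>2 \<le> \<eta> * h / 2"
  shows "(norm (Y + P - ((1 - \<epsilon>) *\<^sub>R u + \<eta> *\<^sub>R e)))\<^sup>2 \<le> (norm Y)\<^sup>2 + 2 * \<epsilon> * (Y \<bullet> P) - \<eta> * h / 2"
proof -
  define w where "w = (1 - \<epsilon>) *\<^sub>R u + \<eta> *\<^sub>R e - P"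
  have "Y \<bullet> w = - \<epsilon> * (Y \<bullet> P) - (1 - \<epsilon>) * (Y \<bullet> (q - u) + Y \<bullet> (P - q)) + \<eta> * (Y \<bullet> e)"
    by (simp add: w_def inner_diff_right inner_add_right algebra_simps)
  moreover have "(1 - \<epsilon>) * (Y \<bullet> (q - u) + Y \<bullet> (P - q)) \<le> 1 * (\<eta> * h / 2)"
  proof -
    have "(1 - \<epsilon>) * (Y \<bullet> (q - u) + Y \<bullet> (P - q)) \<le> (1 - \<epsilon>) * (\<eta> * h / 2)"
      using \<epsilon> Yq Yu by (intro mult_left_mono) auto
    also have "\<dots> \<le> 1 * (\<eta> * h / 2)" using \<epsilon> \<eta> h by (intro mult_right_mono) auto
    finally show ?thesis .
  qed
  moreover have "\<eta> * h \<le> \<eta> * (Y \<bullet> e)" using Ye \<eta> by (rule mult_left_mono)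
  ultimately have "Y \<bullet> w \<ge> - \<epsilon> * (Y \<bullet> P) + \<eta> * h / 2" by linarith
  moreover have "(norm (Y - w))\<^sup>2 = (norm Y)\<^sup>2 - 2 * (Y \<bullet> w) + (norm w)\<^sup>2"
    by (simp add: power2_norm_eq_inner inner_diff_left inner_diff_right inner_commute)
  moreover have eq: "Y + P - ((1 - \<epsilon>) *\<^sub>R u + \<eta> *\<^sub>R e) = Y - w" by (simp add: w_def)
  ultimately show ?thesis unfolding eq using W[folded w_def] by linarith
qed

text \<open>
  The cost for a point whose foot follows the shrinking curve, up to an error \<open>d\<close> in its position. The
  term linear in \<open>\<epsilon>\<close> integrates to \<open>2 * \<epsilon>\<close> times the tension.
\<close>

lemma shrink_loss:
  fixes Y P u :: 'a
  assumes \<epsilon>: "0 \<le> \<epsilon>" "\<epsilon> \<le> 1" and u: "norm (u - P) \<le> d" and P: "norm P \<le> p"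
  shows "(norm (Y + P - (1 - \<epsilon>) *\<^sub>R u))\<^sup>2 \<le> (norm Y)\<^sup>2 + 2 * \<epsilon> * (Y \<bullet> P) + 2 * d * norm Y + (\<epsilon> * p + d)\<^sup>2"
proof -
  define w where "w = (1 - \<epsilon>) *\<^sub>R (u - P) - \<epsilon> *\<^sub>R P"
  have d: "norm ((1 - \<epsilon>) *\<^sub>R (u - P)) \<le> d"
  proof -
    have "(1 - \<epsilon>) * norm (u - P) \<le> 1 * norm (u - P)" using \<epsilon> by (intro mult_right_mono) auto
    then show ?thesis using u \<epsilon> by simp
  qed
  have "norm w \<le> norm ((1 - \<epsilon>) *\<^sub>R (u - P)) + norm (\<epsilon> *\<^sub>R P)"
    unfolding w_def by (rule norm_triangle_ineq4)
  also have "\<dots> \<le> d + \<epsilon> * p" using d \<epsilon> P by (intro add_mono) (auto intro: mult_left_mono)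
  finally have "(norm w)\<^sup>2 \<le> (\<epsilon> * p + d)\<^sup>2" by (intro power_mono) auto
  moreover have "(norm (Y - w))\<^sup>2 = (norm Y)\<^sup>2 - 2 * (Y \<bullet> w) + (norm w)\<^sup>2"
    by (simp add: power2_norm_eq_inner inner_diff_left inner_diff_right inner_commute)
  moreover have "Y \<bullet> w = Y \<bullet> ((1 - \<epsilon>) *\<^sub>R (u - P)) - \<epsilon> * (Y \<bullet> P)"
    by (simp add: w_def inner_diff_right)
  moreover have "\<bar>Y \<bullet> ((1 - \<epsilon>) *\<^sub>R (u - P))\<bar> \<le> d * norm Y"
    using Cauchy_Schwarz_ineq2[of Y "(1 - \<epsilon>) *\<^sub>R (u - P)"] mult_left_mono[OF d norm_ge_zero[of Y]]
    by (simp add: mult.commute)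
  moreover have eq: "Y + P - (1 - \<epsilon>) *\<^sub>R u = Y - w" by (simp add: w_def algebra_simps)
  ultimately show ?thesis unfolding eq by linarith
qed

text \<open>
  If the tension were not positive, shrinking by \<open>1 - \<epsilon>\<close> would increase the distortion by \<open>O(\<epsilon>\<^sup>2)\<close> only
  and free the length \<open>2 * \<eta> = \<epsilon> * L\<close> for a spike. Put the spike where the tilted residuals concentrate.
  Their feet within distance of order \<open>m * \<eta>\<close> of the root, whose mass is at least \<open>c * m * \<eta>\<close>, each gain at
  least \<open>\<eta> * h / 2\<close>, which makes \<open>c * m * h * \<eta>\<^sup>2 / 2\<close> in total. Even such distant points
  gain because their residuals have hardly any component along the displacement of the foot, by
  \<open>nearest_point_displacement\<close>.
  As \<open>m\<close> is arbitrary while the loss is at most \<open>C * \<eta>\<^sup>2\<close> with \<open>C\<close> not depending on \<open>m\<close>, the gain wins.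
\<close>

lemma tension_pos:
  assumes opt: "optimal f" and \<tau>: "foot f \<tau>"
  shows "0 < tension f \<tau>"
proof (rule ccontr)
  assume "\<not> 0 < tension f \<tau>"
  then have ten: "tension f \<tau> \<le> 0" by simp
  have f: "path f" using opt by (rule optimal_path)
  have cf: "continuous_on {0..1} f" using f by (simp add: path_def)
  have lip: "L-lipschitz_on {0..1} f" using opt by (rule optimal_lipschitz)
  have lipn: "norm (f s - f t) \<le> L * \<bar>s - t\<bar>" if "s \<in> {0..1}" "t \<in> {0..1}" for s t
    using lipschitz_onD[OF lip that] by (simp add: dist_norm)
  obtain p where p: "p > 0" "\<And>t. t \<in> {0..1} \<Longrightarrow> norm (f t) \<le> p" using bounded_along[OF cf] by metis
  have \<tau>01: "\<tau> \<omega> \<in> {0..1}" for \<omega> using footD(2)[OF \<tau>] .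
  define P where "P \<omega> = f (\<tau> \<omega>)" for \<omega>
  define Y where "Y \<omega> = X \<omega> - P \<omega>" for \<omega>
  have mP[measurable]: "P \<in> borel_measurable M"
    using foot_measurable[OF f \<tau>] by (simp add: P_def[abs_def])
  have mY[measurable]: "Y \<in> borel_measurable M" unfolding Y_def by measurable
  note m\<tau>[measurable] = footD(1)[OF \<tau>]
  have iY: "integrable M Y"
    unfolding Y_def[abs_def] P_def
    by (intro Bochner_Integration.integrable_diff X_integrable
        integrable_bounded[OF foot_measurable[OF f \<tau>] p(2)[OF \<tau>01]])
  have iYP: "integrable M (\<lambda>\<omega>. Y \<omega> \<bullet> P \<omega>)"
    unfolding Y_def[abs_def] P_def
    by (rule integrable_inner_foot[OF f \<tau> foot_measurable[OF f \<tau>] p(2)[OF \<tau>01]])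
  have iY2: "integrable M (\<lambda>\<omega>. (norm (Y \<omega>))\<^sup>2)"
    using foot_square_integrable[OF f \<tau>] by (simp add: Y_def P_def)
  have "0 < distortion M X f" using opt by (simp add: optimal_def)
  from tilted_mass[OF f \<tau> this] obtain e h R where e: "norm e = 1" and h: "0 < h"
    and mass: "0 < prob {\<omega> \<in> space M. h \<le> Y \<omega> \<bullet> e \<and> norm (Y \<omega>) \<le> R}" (is "0 < prob ?S")
    unfolding Y_def P_def by blast
  have S: "?S \<in> events" by measurable
  define c where "c = prob ?S / 2"
  have c: "0 < c" "c < prob ?S" using mass by (simp_all add: c_def)
  obtain x where x: "x \<in> {0..1}" and conc: "\<And>d. d > 0 \<Longrightarrow> \<exists>a b. a \<le> x \<and> x \<le> b \<and> a < b \<and> b - a < d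
           \<and> c * (b - a) < prob {\<omega> \<in> ?S. a \<le> \<tau> \<omega> \<and> \<tau> \<omega> \<le> b}"
    using concentrated_parameter[OF m\<tau> \<tau>01 S c] by blast
  define EY where "EY = (\<integral>\<omega>. norm (Y \<omega>) \<partial>M)"
  have EY: "0 \<le> EY" unfolding EY_def by simp
  \<comment> \<open>\<open>C1 * \<eta>\<close> and \<open>C2 * \<eta>\<close> bound the displacement of a foot that follows the shrinking curve and of one
    that is moved to the tip of the spike; \<open>C\<close> collects the losses.\<close>
  define C1 where "C1 = 2 * p / L + 2 * L"
  define C where "C = C1\<^sup>2 + 4 * L * EY"
  define m where "m = 2 * C / (c * h) + 1"
  define C2 where "C2 = 2 * p / L + 1 + L + L * m"
  have C0: "0 \<le> C" using EY L_pos by (simp add: C_def)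
  have m1: "1 \<le> m" using C0 c h by (simp add: m_def)
  have C2: "0 < C2" using p L_pos m1 by (simp add: C2_def add_pos_nonneg)
  obtain r where r: "r > 0" "\<And>z s. \<lbrakk>s \<in> path_image f; norm (z - s) \<le> R;
        \<forall>y\<in>path_image f. norm (z - s) \<le> norm (z - y); norm (s - f x) < r\<rbrakk>
      \<Longrightarrow> (z - s) \<bullet> (s - f x) \<le> h / (4 * L * m) * norm (s - f x)"
    using nearest_point_displacement[of "h / (4 * L * m)" "path_image f" R "f x"] h L_pos m1 by auto
  define \<eta>0 where "\<eta>0 = Min {1/2, L/2, h / (4 * L * (\<bar>R\<bar> + 1)), h / (2 * C2\<^sup>2), r / (L * m)}"
  have \<eta>0: "0 < \<eta>0" using L_pos h C2 r(1) m1 by (simp add: \<eta>0_def)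
  obtain a b where ab: "a \<le> x" "x \<le> b" "a < b" "b - a < m * \<eta>0"
    and G: "c * (b - a) < prob {\<omega> \<in> ?S. a \<le> \<tau> \<omega> \<and> \<tau> \<omega> \<le> b}"
    using conc[of "m * \<eta>0"] \<eta>0 m1 by auto
  define G where "G = {\<omega> \<in> ?S. a \<le> \<tau> \<omega> \<and> \<tau> \<omega> \<le> b}"
  have mG[measurable]: "G \<in> events"
  proof -
    have "G = {\<omega> \<in> space M. (h \<le> Y \<omega> \<bullet> e \<and> norm (Y \<omega>) \<le> R) \<and> a \<le> \<tau> \<omega> \<and> \<tau> \<omega> \<le> b}"
      by (auto simp: G_def)
    also have "\<dots> \<in> events" by measurable
    finally show ?thesis .
  qed
  have iG: "integrable M (indicator G :: 'w \<Rightarrow> real)"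
    by (rule integrable_bounded[where B = 1]) (auto simp: indicator_def)
  define \<eta> where "\<eta> = (b - a) / m"
  have \<eta>pos: "0 < \<eta>" using ab m1 by (simp add: \<eta>_def)
  have w: "b - a = m * \<eta>" using m1 by (simp add: \<eta>_def)
  have "\<eta> < \<eta>0" using ab(4) m1 by (simp add: w)
  then have \<eta>: "\<eta> < 1/2" "\<eta> < L/2" "\<eta> < h / (4 * L * (\<bar>R\<bar> + 1))" "\<eta> < h / (2 * C2\<^sup>2)" "\<eta> < r / (L * m)"
    by (simp_all add: \<eta>0_def)
  \<comment> \<open>The homothety saves exactly the length \<open>2 * \<eta>\<close> of the spike.\<close>
  define \<epsilon> where "\<epsilon> = 2 * \<eta> / L"
  have \<epsilon>: "0 \<le> \<epsilon>" "\<epsilon> \<le> 1" using \<eta>pos \<eta>(2) L_pos by (simp_all add: \<epsilon>_def)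
  \<comment> \<open>The spike is so narrow that detours around it cost \<open>O(\<eta>\<^sup>2)\<close>. Its position is moved by at most \<open>\<zeta>\<close> from \<open>x\<close>
    to keep it away from the ends, so that closed curves remain closed.\<close>
  define \<zeta> where "\<zeta> = \<eta>\<^sup>2"
  have \<zeta>: "0 < \<zeta>" "\<zeta> \<le> \<eta> / 2"
    using \<eta>pos mult_right_mono[of \<eta> "1/2" \<eta>] \<eta>(1) by (simp_all add: \<zeta>_def power2_eq_square)
  define t0 where "t0 = max \<zeta> (min (1 - \<zeta>) x)"
  have t0: "\<zeta> \<le> t0" "t0 \<le> 1 - \<zeta>" "\<bar>t0 - x\<bar> \<le> \<zeta>"
    using x \<zeta> \<eta>(1) by (auto simp: t0_def)
  then have t001: "t0 \<in> {0..1}" using \<zeta> by auto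
  define V where "V t = max (-1) (min 1 ((t - t0) / \<zeta>))" for t :: real
  define \<phi> where "\<phi> t = (1 - \<epsilon>) *\<^sub>R f t + (\<eta> * (1 - \<bar>V t\<bar>)) *\<^sub>R e" for t
  have s0: "0 \<le> 1 - \<epsilon>" using \<epsilon> by simp
  note tent = tent_perturbation[OF lip s0 \<zeta>(1) t0(1,2) e less_imp_le[OF \<eta>pos],
      folded V_def, folded \<phi>_def]
  have path\<phi>: "path \<phi>" using tent(1) by (simp add: \<phi>_def[abs_def])
  \<comment> \<open>Points of \<open>G\<close> use the tip of the spike; all others use the shrunken curve, at the edge of the spike
    if their old parameter has been lifted.\<close>
  define \<sigma> where "\<sigma> \<omega> = (if \<omega> \<in> G then t0 else if \<bar>\<tau> \<omega> - t0\<bar> < \<zeta> then t0 + \<zeta> else \<tau> \<omega>)" for \<omega>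
  have m\<sigma>[measurable]: "\<sigma> \<in> borel_measurable M" unfolding \<sigma>_def by measurable
  have \<sigma>01: "\<sigma> \<omega> \<in> {0..1}" for \<omega> using \<tau>01[of \<omega>] t0 t001 \<zeta>(1) by (auto simp: \<sigma>_def)
  let ?bound = "\<lambda>\<omega>. (norm (Y \<omega>))\<^sup>2 + 2 * \<epsilon> * (Y \<omega> \<bullet> P \<omega>) + (4 * L * \<eta>\<^sup>2) * norm (Y \<omega>) + (C1 * \<eta>)\<^sup>2
                  - (\<eta> * h / 2) * indicator G \<omega>"
  have pointwise: "(norm (X \<omega> - \<phi> (\<sigma> \<omega>)))\<^sup>2 \<le> ?bound \<omega>" for \<omega>
  proof (cases "\<omega> \<in> G")
    case False
    have d: "\<bar>\<sigma> \<omega> - \<tau> \<omega>\<bar> \<le> 2 * \<zeta>" using False \<zeta>(1) by (auto simp: \<sigma>_def)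
    have "\<bar>V (\<sigma> \<omega>)\<bar> = 1" using False \<zeta>(1) by (intro tent(6)) (auto simp: \<sigma>_def)
    then have \<phi>\<sigma>: "\<phi> (\<sigma> \<omega>) = (1 - \<epsilon>) *\<^sub>R f (\<sigma> \<omega>)" by (simp add: \<phi>_def)
    have "norm (f (\<sigma> \<omega>) - P \<omega>) \<le> L * (2 * \<zeta>)"
      unfolding P_def using L_pos
      by (intro order_trans[OF lipn[OF \<sigma>01 \<tau>01] mult_left_mono[OF d]]) auto
    from shrink_loss[OF \<epsilon> this, of p "Y \<omega>"]
    have "(norm (X \<omega> - \<phi> (\<sigma> \<omega>)))\<^sup>2 \<le> (norm (Y \<omega>))\<^sup>2 + 2 * \<epsilon> * (Y \<omega> \<bullet> P \<omega>) + (4 * L * \<eta>\<^sup>2) * norm (Y \<omega>)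
        + (\<epsilon> * p + L * (2 * \<zeta>))\<^sup>2"
      using p(2)[OF \<tau>01, of \<omega>] by (simp add: \<phi>\<sigma> Y_def P_def \<zeta>_def algebra_simps)
    also have "(\<epsilon> * p + L * (2 * \<zeta>))\<^sup>2 \<le> (C1 * \<eta>)\<^sup>2"
    proof (rule power_mono)
      have "L * (2 * \<zeta>) \<le> L * (2 * \<eta>)" using \<zeta> \<eta>pos L_pos by (intro mult_left_mono) auto
      moreover have "C1 * \<eta> = \<epsilon> * p + L * (2 * \<eta>)" by (simp add: C1_def \<epsilon>_def algebra_simps)
      ultimately show "\<epsilon> * p + L * (2 * \<zeta>) \<le> C1 * \<eta>" by linarith
      show "0 \<le> \<epsilon> * p + L * (2 * \<zeta>)" using \<epsilon> p \<zeta> L_pos by simp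
    qed
    finally show ?thesis using False by simp
  next
    case True
    then have YG: "h \<le> Y \<omega> \<bullet> e" "norm (Y \<omega>) \<le> R" "a \<le> \<tau> \<omega>" "\<tau> \<omega> \<le> b" by (auto simp: G_def)
    have \<phi>\<sigma>: "\<phi> (\<sigma> \<omega>) = (1 - \<epsilon>) *\<^sub>R f t0 + \<eta> *\<^sub>R e"
      using True tent(5) by (simp add: \<sigma>_def \<phi>_def)
    have Pq: "norm (P \<omega> - f x) \<le> L * (m * \<eta>)"
    proof -
      have d: "\<bar>\<tau> \<omega> - x\<bar> \<le> m * \<eta>" using YG ab w by linarith
      show ?thesis
        unfolding P_def using L_pos
        by (intro order_trans[OF lipn[OF \<tau>01 x] mult_left_mono[OF d]]) auto
    qed
    have qu: "norm (f x - f t0) \<le> L * \<zeta>"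
    proof -
      have d: "\<bar>x - t0\<bar> \<le> \<zeta>" using t0(3) by (simp add: abs_minus_commute)
      show ?thesis
        using L_pos by (intro order_trans[OF lipn[OF x t001] mult_left_mono[OF d]]) auto
    qed
    have "(norm (Y \<omega> + P \<omega> - ((1 - \<epsilon>) *\<^sub>R f t0 + \<eta> *\<^sub>R e)))\<^sup>2
        \<le> (norm (Y \<omega>))\<^sup>2 + 2 * \<epsilon> * (Y \<omega> \<bullet> P \<omega>) - \<eta> * h / 2"
    proof (rule spike_gain[OF \<epsilon> less_imp_le[OF \<eta>pos] YG(1)])
      have "norm (P \<omega> - f x) < r"
        using Pq \<eta>(5) L_pos m1 by (simp add: less_divide_eq mult.commute mult.left_commute)
      then have "Y \<omega> \<bullet> (P \<omega> - f x) \<le> h / (4 * L * m) * norm (P \<omega> - f x)"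
        unfolding Y_def
        using YG(2) foot_nearest[OF \<tau>, of _ \<omega>] \<tau>01[of \<omega>]
        by (intro r(2)) (auto simp: path_image_def P_def Y_def)
      also have "\<dots> \<le> h / (4 * L * m) * (L * (m * \<eta>))"
        using Pq h L_pos m1 by (intro mult_left_mono) auto
      also have "\<dots> = \<eta> * h / 4" using L_pos m1 by simp
      finally show "Y \<omega> \<bullet> (P \<omega> - f x) \<le> \<eta> * h / 4" .
      have "Y \<omega> \<bullet> (f x - f t0) \<le> norm (Y \<omega>) * norm (f x - f t0)" by (rule norm_cauchy_schwarz)
      also have "\<dots> \<le> (\<bar>R\<bar> + 1) * (L * \<zeta>)" using YG(2) qu by (intro mult_mono) auto
      also have "\<dots> = \<eta> * (\<eta> * (L * (\<bar>R\<bar> + 1)))" by (simp add: \<zeta>_def power2_eq_square)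
      also have "\<dots> \<le> \<eta> * (h / 4)"
      proof (intro mult_left_mono)
        have "\<eta> * (4 * L * (\<bar>R\<bar> + 1)) \<le> h"
          using \<eta>(3) L_pos by (simp add: pos_less_divide_eq less_imp_le)
        then show "\<eta> * (L * (\<bar>R\<bar> + 1)) \<le> h / 4" by simp
      qed (use \<eta>pos in simp)
      finally show "Y \<omega> \<bullet> (f x - f t0) \<le> \<eta> * h / 4" by simp
      have "norm ((1 - \<epsilon>) *\<^sub>R f t0 + \<eta> *\<^sub>R e - P \<omega>) \<le> C2 * \<eta>"
      proof -
        have "(1 - \<epsilon>) *\<^sub>R f t0 + \<eta> *\<^sub>R e - P \<omega>
            = ((f t0 - f x) + (f x - P \<omega>)) + (\<eta> *\<^sub>R e - \<epsilon> *\<^sub>R f t0)" by (simp add: algebra_simps)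
        also have "norm \<dots> \<le> (L * \<zeta> + L * (m * \<eta>)) + (\<eta> + \<epsilon> * p)"
        proof (rule norm_triangle_mono[OF norm_triangle_mono norm_triangle_le_diff])
          show "norm (f t0 - f x) \<le> L * \<zeta>" "norm (f x - P \<omega>) \<le> L * (m * \<eta>)"
            using qu Pq by (simp_all add: norm_minus_commute)
          have "\<epsilon> * norm (f t0) \<le> \<epsilon> * p" using \<epsilon> p(2)[OF t001] by (intro mult_left_mono)
          then show "norm (\<eta> *\<^sub>R e) + norm (\<epsilon> *\<^sub>R f t0) \<le> \<eta> + \<epsilon> * p"
            using e \<eta>pos \<epsilon> by simp
        qed
        also have "\<dots> \<le> (L * \<eta> + L * (m * \<eta>)) + (\<eta> + \<epsilon> * p)"
          using mult_left_mono[of \<zeta> \<eta> L] \<zeta> \<eta>pos L_pos by simp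
        also have "\<dots> = C2 * \<eta>" by (simp add: C2_def \<epsilon>_def algebra_simps)
        finally show ?thesis .
      qed
      then have "(norm ((1 - \<epsilon>) *\<^sub>R f t0 + \<eta> *\<^sub>R e - P \<omega>))\<^sup>2 \<le> (C2 * \<eta>)\<^sup>2" by (intro power_mono) auto
      also have "\<dots> = \<eta> * (\<eta> * C2\<^sup>2)" by (simp add: power2_eq_square)
      also have "\<dots> \<le> \<eta> * (h / 2)"
      proof (intro mult_left_mono)
        have "\<eta> * (2 * C2\<^sup>2) \<le> h" using \<eta>(4) C2 by (simp add: pos_less_divide_eq less_imp_le)
        then show "\<eta> * C2\<^sup>2 \<le> h / 2" by simp
      qed (use \<eta>pos in simp)
      finally show "(norm ((1 - \<epsilon>) *\<^sub>R f t0 + \<eta> *\<^sub>R e - P \<omega>))\<^sup>2 \<le> \<eta> * h / 2" by simp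
    qed (use h in simp)
    moreover have "0 \<le> (4 * L * \<eta>\<^sup>2) * norm (Y \<omega>)" "0 \<le> (C1 * \<eta>)\<^sup>2" using L_pos by simp_all
    moreover have eq: "X \<omega> - \<phi> (\<sigma> \<omega>) = Y \<omega> + P \<omega> - ((1 - \<epsilon>) *\<^sub>R f t0 + \<eta> *\<^sub>R e)"
      and ind: "indicator G \<omega> = (1 :: real)"
      using True by (simp_all add: \<phi>\<sigma> Y_def)
    ultimately show ?thesis unfolding eq ind by linarith
  qed
  have c\<phi>: "continuous_on {0..1} \<phi>" using path\<phi> by (simp add: path_def)
  obtain B where B: "\<And>t. t \<in> {0..1} \<Longrightarrow> norm (\<phi> t) \<le> B" using bounded_along[OF c\<phi>] by metis
  have "distortion M X f \<le> (\<integral>\<omega>. (norm (X \<omega> - (L / L) *\<^sub>R \<phi> (\<sigma> \<omega>)))\<^sup>2 \<partial>M)"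
  proof (rule optimal_le_scaled[OF opt path\<phi> _ _ L_pos _ m\<sigma> \<sigma>01])
    show "dominated 0 1 \<phi> (\<lambda>t. (1 - \<epsilon>) * L * t + \<eta> * V t)" using tent(2) by (simp add: \<phi>_def[abs_def])
    show "(1 - \<epsilon>) * L * 1 + \<eta> * V 1 - ((1 - \<epsilon>) * L * 0 + \<eta> * V 0) \<le> L"
      using L_pos by (simp add: tent(3,4) \<epsilon>_def algebra_simps)
    show "\<phi> 0 = \<phi> 1" if loop using optimal_loop[OF opt that] by (simp add: \<phi>_def tent(3,4))
  qed
  also have "\<dots> = (\<integral>\<omega>. (norm (X \<omega> - \<phi> (\<sigma> \<omega>)))\<^sup>2 \<partial>M)" using L_pos by simp
  also have "\<dots> \<le> (\<integral>\<omega>. ?bound \<omega> \<partial>M)"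
  proof (rule integral_mono[OF _ _ pointwise])
    show "integrable M (\<lambda>\<omega>. (norm (X \<omega> - \<phi> (\<sigma> \<omega>)))\<^sup>2)"
      by (rule integrable_diff_square[OF measurable_along[OF c\<phi> m\<sigma> \<sigma>01] B[OF \<sigma>01]])
    show "integrable M ?bound"
      by (intro Bochner_Integration.integrable_diff Bochner_Integration.integrable_add integrable_mult_right
          integrable_norm iY iYP iY2 iG) simp
  qed
  also have "\<dots> = distortion M X f + 2 * \<epsilon> * tension f \<tau> + (4 * L * \<eta>\<^sup>2) * EY + (C1 * \<eta>)\<^sup>2 - (\<eta> * h / 2) * prob G"
    using iY iYP iY2 iG
    by (simp add: distortion_foot[OF \<tau>] tension_def EY_def prob_space Y_def[symmetric] P_def[symmetric])
  finally have "(\<eta> * h / 2) * prob G \<le> 2 * \<epsilon> * tension f \<tau> + (4 * L * \<eta>\<^sup>2) * EY + (C1 * \<eta>)\<^sup>2" by simp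
  also have "\<dots> \<le> (4 * L * \<eta>\<^sup>2) * EY + (C1 * \<eta>)\<^sup>2"
    using ten \<epsilon> by (simp add: mult_nonneg_nonpos)
  also have "\<dots> = \<eta>\<^sup>2 * C" by (simp add: C_def algebra_simps)
  finally have 1: "(\<eta> * h / 2) * prob G \<le> \<eta>\<^sup>2 * C" .
  have "(\<eta> * h / 2) * (c * (m * \<eta>)) \<le> (\<eta> * h / 2) * prob G"
    using G \<eta>pos h unfolding w G_def by (intro mult_left_mono) auto
  with 1 have "\<eta>\<^sup>2 * (c * h * m / 2) \<le> \<eta>\<^sup>2 * C" by (simp add: power2_eq_square algebra_simps)
  then have "c * h * m / 2 \<le> C" using \<eta>pos by simp
  moreover have "c * h * m = 2 * C + c * h" using c h by (simp add: m_def field_simps)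
  ultimately show False using mult_pos_pos[OF c(1) h] by linarith
qed

end

section \<open>One-sided velocities\<close>

text \<open>
  A strong one-sided derivative: the chords may start after \<open>x\<close>. This makes it possible to compare
  the velocity at \<open>x\<close> with those at nearby parameters, and makes \<open>f\<close> advance monotonically along it.
\<close>

definition right_velocity :: "(real \<Rightarrow> 'a::real_normed_vector) \<Rightarrow> real \<Rightarrow> 'a \<Rightarrow> bool" where
  "right_velocity f x v \<longleftrightarrow> (\<forall>\<epsilon>>0. \<exists>\<rho>>0. \<forall>a b. x \<le> a \<and> a < b \<and> b \<le> x + \<rho> \<longrightarrow>
     norm (f b - f a - (b - a) *\<^sub>R v) \<le> \<epsilon> * (b - a))"

definition left_velocity :: "(real \<Rightarrow> 'a::real_normed_vector) \<Rightarrow> real \<Rightarrow> 'a \<Rightarrow> bool" where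
  "left_velocity f x v \<longleftrightarrow> (\<forall>\<epsilon>>0. \<exists>\<rho>>0. \<forall>a b. x - \<rho> \<le> a \<and> a < b \<and> b \<le> x \<longrightarrow>
     norm (f b - f a - (b - a) *\<^sub>R v) \<le> \<epsilon> * (b - a))"

text \<open>
  Time reversal exchanges left and right and reverses velocities, so facts about left velocities
  follow from those about right velocities.
\<close>

lemma left_velocity_reflect:
  "left_velocity f x v \<longleftrightarrow> right_velocity (\<lambda>t. f (c - t)) (c - x) (- v)"
proof -
  have eq: "norm (f (c - b) - f (c - a) - (b - a) *\<^sub>R (- v)) = norm (f (c - a) - f (c - b) - ((c - a) - (c - b)) *\<^sub>R v)"
    for a b
  proof -
    have "f (c - b) - f (c - a) - (b - a) *\<^sub>R (- v) = - (f (c - a) - f (c - b) - ((c - a) - (c - b)) *\<^sub>R v)"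
      by (simp add: algebra_simps)
    then show ?thesis by (metis norm_minus_cancel)
  qed
  show ?thesis
    unfolding left_velocity_def right_velocity_def eq
  proof (intro all_cong ex_cong conj_cong refl iffI allI impI; (elim conjE)?)
    fix \<epsilon> \<rho> a b :: real
    assume *: "\<forall>a b. x - \<rho> \<le> a \<and> a < b \<and> b \<le> x \<longrightarrow> norm (f b - f a - (b - a) *\<^sub>R v) \<le> \<epsilon> * (b - a)"
      and "c - x \<le> a" "a < b" "b \<le> c - x + \<rho>"
    then show "norm (f (c - a) - f (c - b) - ((c - a) - (c - b)) *\<^sub>R v) \<le> \<epsilon> * (b - a)"
      using *[rule_format, of "c - b" "c - a"] by simp
  next
    fix \<epsilon> \<rho> a b :: real
    assume *: "\<forall>a b. c - x \<le> a \<and> a < b \<and> b \<le> c - x + \<rho> \<longrightarrow>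
        norm (f (c - a) - f (c - b) - ((c - a) - (c - b)) *\<^sub>R v) \<le> \<epsilon> * (b - a)"
      and "x - \<rho> \<le> a" "a < b" "b \<le> x"
    then show "norm (f b - f a - (b - a) *\<^sub>R v) \<le> \<epsilon> * (b - a)"
      using *[rule_format, of "c - b" "c - a"] by simp
  qed
qed

lemma right_velocity_shift:
  assumes "0 < \<delta>" "\<And>t. x \<le> t \<Longrightarrow> t \<le> x + \<delta> \<Longrightarrow> g (t + c) = f t" "right_velocity f x v"
  shows "right_velocity g (x + c) v"
  unfolding right_velocity_def
proof (intro allI impI)
  fix \<epsilon> :: real assume "\<epsilon> > 0"
  then obtain \<rho> where \<rho>: "\<rho> > 0" "\<And>a b. x \<le> a \<Longrightarrow> a < b \<Longrightarrow> b \<le> x + \<rho> \<Longrightarrow>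
      norm (f b - f a - (b - a) *\<^sub>R v) \<le> \<epsilon> * (b - a)"
    using assms(3) unfolding right_velocity_def by metis
  show "\<exists>\<rho>>0. \<forall>a b. x + c \<le> a \<and> a < b \<and> b \<le> x + c + \<rho> \<longrightarrow> norm (g b - g a - (b - a) *\<^sub>R v) \<le> \<epsilon> * (b - a)"
  proof (intro exI[of _ "min \<rho> \<delta>"] conjI allI impI)
    fix a b assume ab: "x + c \<le> a \<and> a < b \<and> b \<le> x + c + min \<rho> \<delta>"
    then have "g a = f (a - c)" "g b = f (b - c)"
      using assms(2)[of "a - c"] assms(2)[of "b - c"] by auto
    then show "norm (g b - g a - (b - a) *\<^sub>R v) \<le> \<epsilon> * (b - a)"
      using \<rho>(2)[of "a - c" "b - c"] ab by auto
  qed (use \<rho> assms in auto)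
qed

lemma left_velocity_shift:
  assumes "0 < \<delta>" "\<And>t. x - \<delta> \<le> t \<Longrightarrow> t \<le> x \<Longrightarrow> g (t + c) = f t" "left_velocity f x v"
  shows "left_velocity g (x + c) v"
proof -
  have "right_velocity (\<lambda>t. g (0 - t)) (- x + - c) (- v)"
    by (rule right_velocity_shift[where f = "\<lambda>t. f (0 - t)" and \<delta> = \<delta>])
      (use assms(1) assms(2)[of "- _"] assms(3) left_velocity_reflect[of f x v 0] in
        \<open>auto simp: add.commute\<close>)
  then show ?thesis using left_velocity_reflect[of g "x + c" v 0] by simp
qed

lemma right_velocity_unique:
  assumes "right_velocity f x v" "right_velocity f x w"
  shows "v = w"
proof (rule ccontr)
  assume "v \<noteq> w"
  define \<epsilon> where "\<epsilon> = norm (v - w) / 3"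
  have e: "\<epsilon> > 0" using \<open>v \<noteq> w\<close> by (simp add: \<epsilon>_def)
  obtain \<rho> where \<rho>: "\<rho> > 0" "\<And>a b. x \<le> a \<and> a < b \<and> b \<le> x + \<rho> \<Longrightarrow> norm (f b - f a - (b - a) *\<^sub>R v) \<le> \<epsilon> * (b - a)"
    using assms(1) e unfolding right_velocity_def by metis
  obtain \<rho>' where \<rho>': "\<rho>' > 0" "\<And>a b. x \<le> a \<and> a < b \<and> b \<le> x + \<rho>' \<Longrightarrow> norm (f b - f a - (b - a) *\<^sub>R w) \<le> \<epsilon> * (b - a)"
    using assms(2) e unfolding right_velocity_def by metis
  define h where "h = min \<rho> \<rho>'"
  have h: "h > 0" using \<rho> \<rho>' by (simp add: h_def)
  have "norm (f (x + h) - f x - h *\<^sub>R v) \<le> \<epsilon> * h" "norm (f (x + h) - f x - h *\<^sub>R w) \<le> \<epsilon> * h"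
    using \<rho>(2)[of x "x + h"] \<rho>'(2)[of x "x + h"] h by (auto simp: h_def)
  then have "norm (h *\<^sub>R v - h *\<^sub>R w) \<le> \<epsilon> * h + \<epsilon> * h"
    using norm_triangle_ineq4[of "f (x + h) - f x - h *\<^sub>R w" "f (x + h) - f x - h *\<^sub>R v"] by simp
  then have "h * norm (v - w) \<le> 2 * \<epsilon> * h"
    using h by (simp add: scaleR_diff_right[symmetric])
  then have "norm (v - w) \<le> 2 * \<epsilon>" using h by (simp add: mult.commute)
  then show False using e by (simp add: \<epsilon>_def)
qed

lemma left_velocity_unique:
  assumes "left_velocity f x v" "left_velocity f x w"
  shows "v = w"
  using right_velocity_unique[of "\<lambda>t. f (0 - t)" "0 - x" "- v" "- w"] assms
    left_velocity_reflect[of f x _ 0] by simp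

context length_constrained
begin

text \<open>
  The total load weighted by \<open>w\<close>; the weight depends only on the parameter at which the load acts.
\<close>

definition load :: "(real \<Rightarrow> 'a) \<Rightarrow> ('w \<Rightarrow> real) \<Rightarrow> (real \<Rightarrow> real) \<Rightarrow> 'a" where
  "load f \<tau> w = (\<integral>\<omega>. w (\<tau> \<omega>) *\<^sub>R (X \<omega> - f (\<tau> \<omega>)) \<partial>M)"

text \<open>
  The balance of forces for ramps is a weak form of the equation \<open>\<kappa> f'' = - load\<close>; the constant of
  integration \<open>W\<close> vanishes for an open curve because its ends are free.
\<close>

lemma chord_representation:
  assumes opt: "optimal f" and \<tau>: "foot f \<tau>"
  obtains \<kappa> W where "0 < \<kappa>" "\<not> loop \<Longrightarrow> W = 0"
    "\<And>a b. 0 \<le> a \<Longrightarrow> a < b \<Longrightarrow> b \<le> 1 \<Longrightarrow>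
       f b - f a = (b - a) *\<^sub>R (W - load f \<tau> (ramp a b) /\<^sub>R \<kappa>)"
proof -
  have f: "path f" using opt by (rule optimal_path)
  have cf: "continuous_on {0..1} f" using f by (simp add: path_def)
  obtain p where p: "p > 0" "\<And>t. t \<in> {0..1} \<Longrightarrow> norm (f t) \<le> p" using bounded_along[OF cf] by metis
  have \<tau>01: "\<tau> \<omega> \<in> {0..1}" for \<omega> using footD(2)[OF \<tau>] .
  note m\<tau>[measurable] = footD(1)[OF \<tau>] foot_measurable[OF f \<tau>]
  define Y where "Y \<omega> = X \<omega> - f (\<tau> \<omega>)" for \<omega>
  define \<theta> :: real where "\<theta> = (if loop then 1 else 0)"
  define \<kappa> where "\<kappa> = tension f \<tau> / L\<^sup>2"
  define J where "J = (\<integral>\<omega>. \<tau> \<omega> *\<^sub>R Y \<omega> \<partial>M)"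
  have \<kappa>: "0 < \<kappa>" using tension_pos[OF opt \<tau>] L_pos by (simp add: \<kappa>_def)
  have iJ: "integrable M (\<lambda>\<omega>. \<tau> \<omega> *\<^sub>R Y \<omega>)"
    unfolding Y_def by (rule integrable_weighted[where B = p and C = 1]) (use p(2) \<tau>01 in auto)
  have "f b - f a = (b - a) *\<^sub>R (- (\<theta> *\<^sub>R J) /\<^sub>R \<kappa> - (\<integral>\<omega>. ramp a b (\<tau> \<omega>) *\<^sub>R Y \<omega> \<partial>M) /\<^sub>R \<kappa>)"
    if ab: "0 \<le> a" "a < b" "b \<le> 1" for a b
  proof -
    define I where "I = (\<integral>\<omega>. ramp a b (\<tau> \<omega>) *\<^sub>R Y \<omega> \<partial>M)"
    define s where "s = (f b - f a) /\<^sub>R (b - a)"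
    have iI: "integrable M (\<lambda>\<omega>. ramp a b (\<tau> \<omega>) *\<^sub>R Y \<omega>)"
      unfolding Y_def
      by (rule integrable_weighted[where B = p and C = 1]) (use p(2) \<tau>01 ramp_range in auto)
    have "- (\<kappa> *\<^sub>R s) = I + \<theta> *\<^sub>R J"
    proof (rule vector_eq_rdot[THEN iffD1], rule allI)
      fix v
      obtain K where K: "\<And>\<epsilon>. \<exists>A. dominated 0 1 (\<lambda>x. f x + \<epsilon> *\<^sub>R (ramp a b x + \<theta> * x) *\<^sub>R v) A \<and>
          A 1 - A 0 = L + \<epsilon> * (v \<bullet> (\<theta> *\<^sub>R (f 1 - f 0) - s) / L) + \<epsilon>\<^sup>2 * K"
        using dominated_ramp_perturbation[OF optimal_lipschitz[OF opt] L_pos ab, of \<theta> v]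
        unfolding s_def by blast
      have "L * (\<integral>\<omega>. (X \<omega> - f (\<tau> \<omega>)) \<bullet> ((ramp a b (\<tau> \<omega>) + \<theta> * \<tau> \<omega>) *\<^sub>R v) \<partial>M)
          = tension f \<tau> * (v \<bullet> (\<theta> *\<^sub>R (f 1 - f 0) - s) / L)"
      proof (rule first_variation[OF opt \<tau>, where K = K])
        show "continuous_on {0..1} (\<lambda>x. (ramp a b x + \<theta> * x) *\<^sub>R v)"
          by (intro continuous_intros continuous_ramp)
        show "(ramp a b 0 + \<theta> * 0) *\<^sub>R v = (ramp a b 1 + \<theta> * 1) *\<^sub>R v" if loop
          using that ab by (simp add: \<theta>_def ramp_simps)
        show "\<exists>A. dominated 0 1 (\<lambda>x. f x + \<epsilon> *\<^sub>R (ramp a b x + \<theta> * x) *\<^sub>R v) A \<and>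
            A 1 - A 0 \<le> L + \<epsilon> * (v \<bullet> (\<theta> *\<^sub>R (f 1 - f 0) - s) / L) + \<epsilon>\<^sup>2 * K" for \<epsilon>
          using K[of \<epsilon>] by auto
      qed
      also have "\<theta> *\<^sub>R (f 1 - f 0) = 0" using optimal_loop[OF opt] by (simp add: \<theta>_def)
      also have "(\<integral>\<omega>. (X \<omega> - f (\<tau> \<omega>)) \<bullet> ((ramp a b (\<tau> \<omega>) + \<theta> * \<tau> \<omega>) *\<^sub>R v) \<partial>M)
          = (\<integral>\<omega>. (ramp a b (\<tau> \<omega>) *\<^sub>R Y \<omega> + \<theta> *\<^sub>R \<tau> \<omega> *\<^sub>R Y \<omega>) \<bullet> v \<partial>M)"
        by (intro Bochner_Integration.integral_cong refl) (simp add: Y_def inner_add_left algebra_simps)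
      also have "\<dots> = (\<integral>\<omega>. ramp a b (\<tau> \<omega>) *\<^sub>R Y \<omega> + \<theta> *\<^sub>R \<tau> \<omega> *\<^sub>R Y \<omega> \<partial>M) \<bullet> v"
          by (intro integral_inner_left Bochner_Integration.integrable_add integrable_scaleR_right iI iJ)
        also have "(\<integral>\<omega>. ramp a b (\<tau> \<omega>) *\<^sub>R Y \<omega> + \<theta> *\<^sub>R \<tau> \<omega> *\<^sub>R Y \<omega> \<partial>M) = I + \<theta> *\<^sub>R J"
          using iI iJ by (simp add: I_def J_def del: scaleR_scaleR)
      finally have "L * ((I + \<theta> *\<^sub>R J) \<bullet> v) = - tension f \<tau> * (s \<bullet> v) / L"
        by (simp add: inner_commute)
      then have "(I + \<theta> *\<^sub>R J) \<bullet> v = - (\<kappa> * (s \<bullet> v))"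
        using L_pos by (simp add: \<kappa>_def field_simps power2_eq_square)
      then show "- (\<kappa> *\<^sub>R s) \<bullet> v = (I + \<theta> *\<^sub>R J) \<bullet> v" by simp
    qed
    then have "\<kappa> *\<^sub>R s = - (I + \<theta> *\<^sub>R J)" by (metis minus_minus)
    then have "\<kappa> *\<^sub>R s = - (\<theta> *\<^sub>R J) - I" by simp
    then have "s = (- (\<theta> *\<^sub>R J) - I) /\<^sub>R \<kappa>" using \<kappa> by (metis divideR_right less_numeral_extra(3))
    moreover have "f b - f a = (b - a) *\<^sub>R s" using ab by (simp add: s_def)
    ultimately show ?thesis by (simp add: I_def scaleR_diff_right)
  qed
  then show ?thesis
    by (intro that[of \<kappa> "- (\<theta> *\<^sub>R J) /\<^sub>R \<kappa>"] \<kappa>) (auto simp: \<theta>_def Y_def load_def)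
qed

text \<open>
  With the constant perturbation \<open>0\<close>, a saving of length would count as a negative first variation,
  which is impossible as the tension is positive.
\<close>

lemma no_shorter_parametrization:
  assumes opt: "optimal f" and A: "dominated 0 1 f A"
  shows "L \<le> A 1 - A 0"
proof (rule ccontr)
  assume "\<not> L \<le> A 1 - A 0"
  define s where "s = L - (A 1 - A 0)"
  have s: "s > 0" using \<open>\<not> L \<le> A 1 - A 0\<close> by (simp add: s_def)
  obtain \<tau> where \<tau>: "foot f \<tau>" using some_foot[OF optimal_path[OF opt]] by blast
  \<comment> \<open>The value of \<open>K\<close> makes \<open>s - \<epsilon> + \<epsilon>\<^sup>2 * K\<close> nonnegative for every \<open>\<epsilon>\<close>, so that the saving \<open>s\<close> passes for a first variation \<open>- 1\<close>.\<close>
  have "L * (\<integral>\<omega>. (X \<omega> - f (\<tau> \<omega>)) \<bullet> 0 \<partial>M) \<le> tension f \<tau> * (- 1)"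
  proof (rule first_variation_le[OF opt \<tau>, where g = "\<lambda>_. 0" and K = "1 / (4 * s)"])
    fix \<epsilon> :: real assume "0 < \<epsilon>"
    have "0 \<le> (\<epsilon> - 2 * s)\<^sup>2 / (4 * s)" using s by simp
    also have "\<dots> = s - \<epsilon> + \<epsilon>\<^sup>2 * (1 / (4 * s))"
      using s by (simp add: power2_eq_square field_simps)
    finally have "A 1 - A 0 \<le> L + \<epsilon> * - 1 + \<epsilon>\<^sup>2 * (1 / (4 * s))" by (simp add: s_def)
    then show "\<exists>A. dominated 0 1 (\<lambda>x. f x + \<epsilon> *\<^sub>R 0) A \<and> A 1 - A 0 \<le> L + \<epsilon> * - 1 + \<epsilon>\<^sup>2 * (1 / (4 * s))"
      using A by auto
  qed auto
  then show False using tension_pos[OF opt \<tau>] by simp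
qed

lemma no_slow_arc:
  assumes opt: "optimal f" and cd: "0 \<le> c" "c < d" "d \<le> 1"
  shows "\<exists>a b. c \<le> a \<and> a < b \<and> b \<le> d \<and> L / 2 * (b - a) < norm (f b - f a)"
proof (rule ccontr)
  assume "\<not> ?thesis"
  then have slow: "norm (f b - f a) \<le> L / 2 * (b - a)" if "c \<le> a" "a \<le> b" "b \<le> d" for a b
    using that by (cases "a = b") force+
  define k where "k x = max c (min d x)" for x
  have k: "x \<le> c \<Longrightarrow> k x = c" "d \<le> x \<Longrightarrow> k x = d" "c \<le> x \<Longrightarrow> x \<le> d \<Longrightarrow> k x = x" for x
    using cd by (auto simp: k_def)
  define A where "A x = L * x - L / 2 * k x" for x
  have lip: "dominated 0 1 f (\<lambda>x. L * x)" by (rule lipschitz_dominated[OF optimal_lipschitz[OF opt]])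
  have "dominated 0 1 f A"
  proof (rule dominated_glue[where b = c], rule_tac [2] dominated_glue[where b = d])
    show "dominated 0 c f A" "dominated d 1 f A"
      using lip cd by (auto simp: dominated_def A_def k)
    show "dominated c d f A"
      using slow by (auto simp: dominated_def A_def k algebra_simps)
  qed
  then have "L \<le> A 1 - A 0" by (rule no_shorter_parametrization[OF opt])
  moreover have "A 1 - A 0 = L - L / 2 * (d - c)" using cd by (simp add: A_def k right_diff_distrib)
  moreover have "L / 2 * (d - c) > 0" using L_pos cd by simp
  ultimately show False by linarith
qed

lemma right_velocity_nonzero:
  assumes opt: "optimal f" and x: "0 \<le> x" "x < 1" and v: "right_velocity f x v"
  shows "v \<noteq> 0"
proof
  assume "v = 0"
  then obtain \<rho> where \<rho>: "\<rho> > 0" "\<And>a b. x \<le> a \<and> a < b \<and> b \<le> x + \<rho> \<Longrightarrow> norm (f b - f a) \<le> L / 2 * (b - a)"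
    using v L_pos unfolding right_velocity_def by (metis diff_zero half_gt_zero scaleR_zero_right)
  obtain a b where "x \<le> a" "a < b" "b \<le> min 1 (x + \<rho>)" "L / 2 * (b - a) < norm (f b - f a)"
    using no_slow_arc[OF opt x(1), of "min 1 (x + \<rho>)"] x \<rho>(1) by auto
  then show False using \<rho>(2)[of a b] by auto
qed

lemma left_velocity_nonzero:
  assumes opt: "optimal f" and x: "0 < x" "x \<le> 1" and v: "left_velocity f x v"
  shows "v \<noteq> 0"
proof
  assume "v = 0"
  then obtain \<rho> where \<rho>: "\<rho> > 0" "\<And>a b. x - \<rho> \<le> a \<and> a < b \<and> b \<le> x \<Longrightarrow> norm (f b - f a) \<le> L / 2 * (b - a)"
    using v L_pos unfolding left_velocity_def by (metis diff_zero half_gt_zero scaleR_zero_right)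
  obtain a b where "max 0 (x - \<rho>) \<le> a" "a < b" "b \<le> x" "L / 2 * (b - a) < norm (f b - f a)"
    using no_slow_arc[OF opt _ _ x(2), of "max 0 (x - \<rho>)"] x \<rho>(1) by auto
  then show False using \<rho>(2)[of a b] by auto
qed

lemma foot_norm_integrable:
  assumes "path f" "foot f \<tau>"
  shows "integrable M (\<lambda>\<omega>. norm (X \<omega> - f (\<tau> \<omega>)))"
proof -
  obtain C where C: "\<And>t. t \<in> {0..1} \<Longrightarrow> norm (f t) \<le> C"
    using bounded_along assms(1) unfolding path_def by metis
  show ?thesis
    by (intro integrable_norm Bochner_Integration.integrable_diff
        X_integrable integrable_bounded[OF foot_measurable[OF assms] C[OF footD(2)[OF assms(2)]]])
qed

lemma foot_weighted_integrable:
  assumes "path f" "foot f \<tau>" "w \<in> borel_measurable borel" "\<And>t. \<bar>w t\<bar> \<le> 1"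
  shows "integrable M (\<lambda>\<omega>. w (\<tau> \<omega>) *\<^sub>R (X \<omega> - f (\<tau> \<omega>)))"
proof -
  obtain C where C: "\<And>t. t \<in> {0..1} \<Longrightarrow> norm (f t) \<le> C"
    using bounded_along assms(1) unfolding path_def by metis
  have "(\<lambda>\<omega>. w (\<tau> \<omega>)) \<in> borel_measurable M"
    by (rule measurable_compose[OF footD(1)[OF assms(2)] assms(3)])
  then show ?thesis
    by (rule integrable_weighted[OF foot_measurable[OF assms(1,2)] C[OF footD(2)[OF assms(2)]] _ assms(4)])
qed

text \<open>
  Meant for one-sided punctured neighbourhoods \<open>N n\<close> of a parameter, which shrink to the empty set.
\<close>

lemma vanishing_load:
  assumes f: "path f" "foot f \<tau>"
    and N: "\<And>n. N n \<in> sets borel" "\<And>t. \<forall>\<^sub>F n in sequentially. t \<notin> N n" and \<delta>: "0 < \<delta>"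
  shows "\<exists>n. (\<integral>\<omega>. indicator (N n) (\<tau> \<omega>) * norm (X \<omega> - f (\<tau> \<omega>)) \<partial>M) < \<delta>"
proof -
  note [measurable] = footD(1)[OF f(2)] foot_measurable[OF f] N(1)
  have "(\<lambda>n. \<integral>\<omega>. indicator (N n) (\<tau> \<omega>) * norm (X \<omega> - f (\<tau> \<omega>)) \<partial>M) \<longlonglongrightarrow> (\<integral>\<omega>. 0 \<partial>M)"
  proof (rule integral_dominated_convergence[where w = "\<lambda>\<omega>. norm (X \<omega> - f (\<tau> \<omega>))"])
    show "integrable M (\<lambda>\<omega>. norm (X \<omega> - f (\<tau> \<omega>)))" by (rule foot_norm_integrable[OF f])
    show "AE \<omega> in M. (\<lambda>n. indicator (N n) (\<tau> \<omega>) * norm (X \<omega> - f (\<tau> \<omega>))) \<longlonglongrightarrow> 0"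
    proof (rule AE_I2)
      fix \<omega>
      have "\<forall>\<^sub>F n in sequentially. indicator (N n) (\<tau> \<omega>) * norm (X \<omega> - f (\<tau> \<omega>)) = 0"
        using N(2)[of "\<tau> \<omega>"] by eventually_elim simp
      then show "(\<lambda>n. indicator (N n) (\<tau> \<omega>) * norm (X \<omega> - f (\<tau> \<omega>))) \<longlonglongrightarrow> 0"
        by (rule tendsto_eventually)
    qed
    show "AE \<omega> in M. norm (indicator (N n) (\<tau> \<omega>) * norm (X \<omega> - f (\<tau> \<omega>))) \<le> norm (X \<omega> - f (\<tau> \<omega>))" for n
      by (rule AE_I2) (simp add: indicator_def)
  qed measurable
  then have "\<forall>\<^sub>F n in sequentially. (\<integral>\<omega>. indicator (N n) (\<tau> \<omega>) * norm (X \<omega> - f (\<tau> \<omega>)) \<partial>M) < \<delta>"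
    using \<delta> by (intro order_tendstoD) auto
  then show ?thesis by (auto simp: eventually_sequentially)
qed

lemma load_difference_le:
  assumes f: "path f" "foot f \<tau>"
    and w: "w \<in> borel_measurable borel" "\<And>t. \<bar>w t\<bar> \<le> 1"
    and w': "w' \<in> borel_measurable borel" "\<And>t. \<bar>w' t\<bar> \<le> 1"
    and N: "N \<in> sets borel" "\<And>t. \<bar>w t - w' t\<bar> \<le> indicator N t"
  shows "norm (load f \<tau> w - load f \<tau> w')
      \<le> (\<integral>\<omega>. indicator N (\<tau> \<omega>) * norm (X \<omega> - f (\<tau> \<omega>)) \<partial>M)"
proof -
  note [measurable] = footD(1)[OF f(2)] foot_measurable[OF f] N(1)
  have "load f \<tau> w - load f \<tau> w'
      = (\<integral>\<omega>. (w (\<tau> \<omega>) - w' (\<tau> \<omega>)) *\<^sub>R (X \<omega> - f (\<tau> \<omega>)) \<partial>M)"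
    unfolding load_def scaleR_left_diff_distrib
    by (rule Bochner_Integration.integral_diff[symmetric])
      (intro foot_weighted_integrable[OF f] w w')+
  also have "norm \<dots> \<le> (\<integral>\<omega>. norm ((w (\<tau> \<omega>) - w' (\<tau> \<omega>)) *\<^sub>R (X \<omega> - f (\<tau> \<omega>))) \<partial>M)"
    by (rule integral_norm_bound)
  also have "\<dots> \<le> (\<integral>\<omega>. indicator N (\<tau> \<omega>) * norm (X \<omega> - f (\<tau> \<omega>)) \<partial>M)"
  proof (rule integral_mono)
    show "integrable M (\<lambda>\<omega>. norm ((w (\<tau> \<omega>) - w' (\<tau> \<omega>)) *\<^sub>R (X \<omega> - f (\<tau> \<omega>))))"
      unfolding scaleR_left_diff_distrib
      by (intro integrable_norm Bochner_Integration.integrable_diff foot_weighted_integrable[OF f] w w')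
    show "integrable M (\<lambda>\<omega>. indicator N (\<tau> \<omega>) * norm (X \<omega> - f (\<tau> \<omega>)))"
      by (rule Bochner_Integration.integrable_bound[OF foot_norm_integrable[OF f]])
        (auto simp: indicator_def)
    show "norm ((w (\<tau> \<omega>) - w' (\<tau> \<omega>)) *\<^sub>R (X \<omega> - f (\<tau> \<omega>))) \<le> indicator N (\<tau> \<omega>) * norm (X \<omega> - f (\<tau> \<omega>))" for \<omega>
      using N(2)[of "\<tau> \<omega>"] by (simp add: mult_right_mono)
  qed
  finally show ?thesis .
qed

text \<open>
  For short chords to the right of \<open>x\<close> the ramp differs from the indicator of \<open>{..x}\<close> only on a small
  punctured neighbourhood of \<open>x\<close>, so the chord slopes converge; likewise on the left with \<open>{..<x}\<close>. The
  two velocities at \<open>x\<close> differ by a multiple of the load carried by \<open>x\<close> alone.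
\<close>

lemma velocities:
  assumes opt: "optimal f" and \<tau>: "foot f \<tau>"
  obtains \<kappa> W where "0 < \<kappa>" "\<not> loop \<Longrightarrow> W = 0"
    "\<And>a b. 0 \<le> a \<Longrightarrow> a < b \<Longrightarrow> b \<le> 1 \<Longrightarrow>
       f b - f a = (b - a) *\<^sub>R (W - load f \<tau> (ramp a b) /\<^sub>R \<kappa>)"
    "\<And>x. 0 \<le> x \<Longrightarrow> x < 1 \<Longrightarrow>
       right_velocity f x (W - load f \<tau> (indicator {..x}) /\<^sub>R \<kappa>)"
    "\<And>x. 0 < x \<Longrightarrow> x \<le> 1 \<Longrightarrow>
       left_velocity f x (W - load f \<tau> (indicator {..<x}) /\<^sub>R \<kappa>)"
proof -
  have f: "path f" using opt by (rule optimal_path)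
  note fo = f \<tau>
  obtain \<kappa> W where \<kappa>: "0 < \<kappa>" and W: "\<not> loop \<Longrightarrow> W = 0"
    and rep: "\<And>a b. 0 \<le> a \<Longrightarrow> a < b \<Longrightarrow> b \<le> 1 \<Longrightarrow>
       f b - f a = (b - a) *\<^sub>R (W - load f \<tau> (ramp a b) /\<^sub>R \<kappa>)"
    by (rule chord_representation[OF opt \<tau>]) (blast intro: that)
  have close: "norm (f b - f a - (b - a) *\<^sub>R (W - load f \<tau> (indicator T) /\<^sub>R \<kappa>)) \<le> \<epsilon> * (b - a)"
    if ab: "0 \<le> a" "a < b" "b \<le> 1" and T: "T \<in> sets borel" and N: "N \<in> sets borel"
      and rN: "\<And>t. \<bar>ramp a b t - indicator T t\<bar> \<le> indicator N t"
      and load: "(\<integral>\<omega>. indicator N (\<tau> \<omega>) * norm (X \<omega> - f (\<tau> \<omega>)) \<partial>M) < \<kappa> * \<epsilon>" for a b T N \<epsilon>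
  proof -
    have "norm (load f \<tau> (ramp a b) - load f \<tau> (indicator T)) \<le> \<kappa> * \<epsilon>"
      by (rule order_trans[OF load_difference_le[OF fo _ _ _ _ N rN] less_imp_le[OF load]])
        (use ramp_range[of a b] T in \<open>auto simp: indicator_def\<close>)
    moreover have "f b - f a - (b - a) *\<^sub>R (W - load f \<tau> (indicator T) /\<^sub>R \<kappa>)
        = - ((b - a) *\<^sub>R (load f \<tau> (ramp a b) - load f \<tau> (indicator T)) /\<^sub>R \<kappa>)"
      using rep[OF ab] by (simp add: algebra_simps)
    then have "norm (f b - f a - (b - a) *\<^sub>R (W - load f \<tau> (indicator T) /\<^sub>R \<kappa>))
        = (b - a) * (norm (load f \<tau> (ramp a b) - load f \<tau> (indicator T)) / \<kappa>)"
      using ab \<kappa> by (simp add: divide_inverse mult.assoc mult.commute)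
    moreover have "norm (load f \<tau> (ramp a b) - load f \<tau> (indicator T)) / \<kappa> \<le> \<epsilon>" if "norm (load f \<tau> (ramp a b) - load f \<tau> (indicator T)) \<le> \<kappa> * \<epsilon>"
      using that \<kappa> by (simp add: divide_le_eq mult.commute)
    ultimately show ?thesis
      using mult_left_mono[of "norm (load f \<tau> (ramp a b) - load f \<tau> (indicator T)) / \<kappa>" \<epsilon> "b - a"] ab
      by (simp only: mult.commute[of \<epsilon>])
  qed
  have "right_velocity f x (W - load f \<tau> (indicator {..x}) /\<^sub>R \<kappa>)" if x: "0 \<le> x" "x < 1" for x
    unfolding right_velocity_def
  proof (intro allI impI)
    fix \<epsilon> :: real assume "\<epsilon> > 0"
    define N where "N n = {x<..<x + inverse (real (Suc n))}" for n
    have "\<forall>\<^sub>F n in sequentially. t \<notin> N n" for t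
    proof (cases "x < t")
      case True
      then have "\<forall>\<^sub>F n in sequentially. inverse (real (Suc n)) < t - x"
        by (intro order_tendstoD(2)[OF LIMSEQ_inverse_real_of_nat]) auto
      then show ?thesis by eventually_elim (auto simp: N_def)
    qed (auto simp: N_def)
    then obtain n where n: "(\<integral>\<omega>. indicator (N n) (\<tau> \<omega>) * norm (X \<omega> - f (\<tau> \<omega>)) \<partial>M) < \<kappa> * \<epsilon>"
      using vanishing_load[OF fo, of N "\<kappa> * \<epsilon>"] \<kappa> \<open>\<epsilon> > 0\<close> by (auto simp: N_def)
    show "\<exists>\<rho>>0. \<forall>a b. x \<le> a \<and> a < b \<and> b \<le> x + \<rho> \<longrightarrow>
        norm (f b - f a - (b - a) *\<^sub>R (W - load f \<tau> (indicator {..x}) /\<^sub>R \<kappa>)) \<le> \<epsilon> * (b - a)"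
    proof (intro exI[of _ "min (inverse (real (Suc n))) (1 - x)"] conjI allI impI)
      fix a b assume ab: "x \<le> a \<and> a < b \<and> b \<le> x + min (inverse (real (Suc n))) (1 - x)"
      show "norm (f b - f a - (b - a) *\<^sub>R (W - load f \<tau> (indicator {..x}) /\<^sub>R \<kappa>)) \<le> \<epsilon> * (b - a)"
      proof (rule close[OF _ _ _ _ _ _ n])
        show "\<bar>ramp a b t - indicator {..x} t\<bar> \<le> indicator (N n) t" for t
          using ramp_range[of a b t] ramp_simps(1,2)[of a b t] ab
          by (cases "t \<le> x"; cases "t < b") (auto simp: N_def)
      qed (use ab x in \<open>auto simp: N_def\<close>)
    qed (use x in auto)
  qed
  moreover have "left_velocity f x (W - load f \<tau> (indicator {..<x}) /\<^sub>R \<kappa>)" if x: "0 < x" "x \<le> 1" for x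
    unfolding left_velocity_def
  proof (intro allI impI)
    fix \<epsilon> :: real assume "\<epsilon> > 0"
    define N where "N n = {x - inverse (real (Suc n))<..<x}" for n
    have "\<forall>\<^sub>F n in sequentially. t \<notin> N n" for t
    proof (cases "t < x")
      case True
      then have "\<forall>\<^sub>F n in sequentially. inverse (real (Suc n)) < x - t"
        by (intro order_tendstoD(2)[OF LIMSEQ_inverse_real_of_nat]) auto
      then show ?thesis by eventually_elim (auto simp: N_def)
    qed (auto simp: N_def)
    then obtain n where n: "(\<integral>\<omega>. indicator (N n) (\<tau> \<omega>) * norm (X \<omega> - f (\<tau> \<omega>)) \<partial>M) < \<kappa> * \<epsilon>"
      using vanishing_load[OF fo, of N "\<kappa> * \<epsilon>"] \<kappa> \<open>\<epsilon> > 0\<close> by (auto simp: N_def)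
    show "\<exists>\<rho>>0. \<forall>a b. x - \<rho> \<le> a \<and> a < b \<and> b \<le> x \<longrightarrow>
        norm (f b - f a - (b - a) *\<^sub>R (W - load f \<tau> (indicator {..<x}) /\<^sub>R \<kappa>)) \<le> \<epsilon> * (b - a)"
    proof (intro exI[of _ "min (inverse (real (Suc n))) x"] conjI allI impI)
      fix a b assume ab: "x - min (inverse (real (Suc n))) x \<le> a \<and> a < b \<and> b \<le> x"
      show "norm (f b - f a - (b - a) *\<^sub>R (W - load f \<tau> (indicator {..<x}) /\<^sub>R \<kappa>)) \<le> \<epsilon> * (b - a)"
      proof (rule close[OF _ _ _ _ _ _ n])
        show "\<bar>ramp a b t - indicator {..<x} t\<bar> \<le> indicator (N n) t" for t
          using ramp_range[of a b t] ramp_simps(1,2)[of a b t] ab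
          by (cases "t \<ge> x"; cases "t > a") (auto simp: N_def)
      qed (use ab x in \<open>auto simp: N_def\<close>)
    qed (use x in auto)
  qed
  ultimately show ?thesis using that \<kappa> W rep by blast
qed

section \<open>Double points\<close>

text \<open>
  Parameters in \<open>S\<close> are replaced by other visits \<open>j\<close> of the same points.
\<close>

lemma foot_exists_avoiding:
  assumes f: "path f" and ST: "S \<subseteq> {0..1}" "\<And>s. s \<in> S \<Longrightarrow> j s \<in> {0..1} - S \<and> f (j s) = f s"
    and m: "S \<in> sets borel" "j \<in> borel_measurable borel"
  shows "\<exists>\<tau>. foot f \<tau> \<and> (\<forall>\<omega>. \<tau> \<omega> \<notin> S)"
proof -
  obtain \<tau> where \<tau>: "foot f \<tau>" using some_foot[OF f] by blast
  note [measurable] = footD(1)[OF \<tau>] m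
  define \<tau>' where "\<tau>' \<omega> = (if \<tau> \<omega> \<in> S then j (\<tau> \<omega>) else \<tau> \<omega>)" for \<omega>
  have "(\<lambda>t. if t \<in> S then j t else t) \<in> borel_measurable borel" by measurable
  from measurable_compose[OF footD(1)[OF \<tau>] this] have "\<tau>' \<in> borel_measurable M"
    by (simp add: \<tau>'_def[abs_def])
  then have "foot f \<tau>'"
    using footD(2,5)[OF \<tau>] ST unfolding foot_def by (auto simp: \<tau>'_def)
  moreover have "\<tau>' \<omega> \<notin> S" for \<omega> using ST(2)[of "\<tau> \<omega>"] by (auto simp: \<tau>'_def)
  ultimately show ?thesis by blast
qed

text \<open>
  Reversal of a loop changes neither the image nor the speed.
\<close>

lemma optimal_reverse_loop:
  assumes opt: "optimal f" and st: "0 \<le> s" "s \<le> t" "t \<le> 1" and eq: "f s = f t"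
  shows "optimal (\<lambda>x. if s \<le> x \<and> x \<le> t then f (s + t - x) else f x)" (is "optimal ?g")
proof (rule optimal_reparametrized[OF opt])
  have lip: "L-lipschitz_on {0..1} f" using opt by (rule optimal_lipschitz)
  have d: "norm (f y - f x) \<le> L * \<bar>y - x\<bar>" if "x \<in> {0..1}" "y \<in> {0..1}" for x y
    using lipschitz_onD[OF lip that(2,1)] by (simp add: dist_norm)
  show "dominated 0 1 ?g (\<lambda>x. L * x)"
  proof (rule dominated_glue[where b = s], rule_tac [2] dominated_glue[where b = t])
    have g1: "?g x = f x" if "x \<le> s" for x using that st eq by (cases "x = s") auto
    have g2: "?g x = f x" if "t \<le> x" for x using that st eq by (cases "x = t") auto
    show "dominated 0 s ?g (\<lambda>x. L * x)"
    proof (rule dominatedI)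
      fix x y assume "0 \<le> x" "x \<le> y" "y \<le> s"
      then show "norm (?g y - ?g x) \<le> L * y - L * x"
        using d[of x y] g1[of x] g1[of y] st by (simp add: right_diff_distrib)
    qed
    show "dominated t 1 ?g (\<lambda>x. L * x)"
    proof (rule dominatedI)
      fix x y assume "t \<le> x" "x \<le> y" "y \<le> 1"
      then show "norm (?g y - ?g x) \<le> L * y - L * x"
        using d[of x y] g2[of x] g2[of y] st by (simp add: right_diff_distrib)
    qed
    show "dominated s t ?g (\<lambda>x. L * x)"
    proof (rule dominatedI)
      fix x y assume "s \<le> x" "x \<le> y" "y \<le> t"
      then show "norm (?g y - ?g x) \<le> L * y - L * x"
        using d[of "s + t - x" "s + t - y"] st by (simp add: right_diff_distrib)
    qed
  qed
  show "path_image ?g = path_image f"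
  proof -
    have "?g ` {0..1} = f ` {0..1}"
    proof (intro equalityI image_subsetI)
      fix x assume x: "x \<in> {0..1::real}"
      show "?g x \<in> f ` {0..1}" using x st by auto
      show "f x \<in> ?g ` {0..1}"
      proof (cases "s \<le> x \<and> x \<le> t")
        case True
        then have "f x = ?g (s + t - x)" by simp
        then show ?thesis using True st by (intro image_eqI[of _ _ "s + t - x"]) auto
      next
        case False
        then have "f x = ?g x" by auto
        then show ?thesis using x by blast
      qed
    qed
    then show ?thesis by (simp add: path_image_def)
  qed
  show "?g 0 = ?g 1" if loop
    using optimal_loop[OF opt that] st eq by auto
qed

text \<open>
  A nearest parameter that avoids \<open>x\<close> puts no load on \<open>x\<close>, hence the velocity does not jump there.
\<close>

lemma smooth_at_double_point:
  assumes opt: "optimal f" and x: "0 < x" "x < 1" and y: "y \<in> {0..1}" "y \<noteq> x" "f y = f x"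
  shows "\<exists>u. right_velocity f x u \<and> left_velocity f x u"
proof -
  have "\<exists>\<tau>. foot f \<tau> \<and> (\<forall>\<omega>. \<tau> \<omega> \<notin> {x})"
    by (rule foot_exists_avoiding[OF optimal_path[OF opt], where j = "\<lambda>_. y"]) (use x y in auto)
  then obtain \<tau> where \<tau>: "foot f \<tau>" "\<And>\<omega>. \<tau> \<omega> \<noteq> x" by auto
  have "indicator {..<x} (\<tau> \<omega>) = (indicator {..x} (\<tau> \<omega>) :: real)" for \<omega>
    using \<tau>(2)[of \<omega>] by (auto simp: indicator_def)
  then have same: "load f \<tau> (indicator {..<x})
      = load f \<tau> (indicator {..x})" by (simp add: load_def)
  show ?thesis
    by (rule velocities[OF opt \<tau>(1)]) (use x same in \<open>metis less_imp_le\<close>)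
qed

text \<open>
  The curve with the loop reversed is smooth at \<open>s\<close> too. There it arrives with the old velocity at \<open>s\<close>
  and departs with the reversed velocity at \<open>t\<close>.
\<close>

lemma opposite_velocities:
  assumes opt: "optimal f" and st: "0 < s" "s < t" "t < 1" and eq: "f s = f t"
  obtains u where "u \<noteq> 0" "right_velocity f t u" "left_velocity f t u"
    "right_velocity f s (- u)" "left_velocity f s (- u)"
proof -
  define g where "g x = (if s \<le> x \<and> x \<le> t then f (s + t - x) else f x)" for x
  have og: "optimal g" unfolding g_def[abs_def] using optimal_reverse_loop[OF opt] st eq by simp
  obtain w where w: "right_velocity f s w" "left_velocity f s w"
    using smooth_at_double_point[OF opt, of s t] st eq by auto
  obtain u where u: "right_velocity f t u" "left_velocity f t u"
    using smooth_at_double_point[OF opt, of t s] st eq by auto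
  obtain w' where w': "right_velocity g s w'" "left_velocity g s w'"
    using smooth_at_double_point[OF og, of s t] st eq by (auto simp: g_def)
  have "left_velocity g (s + 0) w"
    by (rule left_velocity_shift[OF st(1) _ w(2)]) (use st eq in \<open>auto simp: g_def\<close>)
  then have "w = w'" using left_velocity_unique w'(2) by simp
  have "right_velocity g (s + 0) (- u)"
  proof (rule right_velocity_shift[where \<delta> = "t - s"])
    show "right_velocity (\<lambda>x. f (s + t - x)) s (- u)"
      using u(2) left_velocity_reflect[of f t u "s + t"] by simp
  qed (use st in \<open>auto simp: g_def\<close>)
  then have "w' = - u" using right_velocity_unique w'(1) by simp
  with \<open>w = w'\<close> w u right_velocity_nonzero[OF opt _ _ u(1)] st that show ?thesis by auto
qed

end

section \<open>Two tangent branches in the plane\<close>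

lemma weight_mult_le:
  fixes a x c :: real
  assumes "0 \<le> a" "a \<le> 1" "x \<le> c" "0 \<le> c"
  shows "a * x \<le> c"
  using mult_left_mono[OF assms(3,1)] mult_right_mono[OF assms(2,4)] by simp

lemma chord_change:
  fixes W A B :: "'a::real_vector"
  shows "h *\<^sub>R (W - A /\<^sub>R \<kappa>) = h *\<^sub>R (W - B /\<^sub>R \<kappa>) + (h / \<kappa>) *\<^sub>R (B - A)"
  by (simp add: scaleR_diff_right divide_inverse)

text \<open>
  The orthogonal complement of a vector in the plane is a line: the only place where the dimension
  enters.
\<close>

lemma planar_normal:
  fixes u :: "real ^ 2"
  assumes "u \<noteq> 0"
  obtains e where "norm e = 1" "e \<bullet> u = 0" "\<And>z. z \<bullet> u = 0 \<Longrightarrow> z = (z \<bullet> e) *\<^sub>R e"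
proof -
  define w :: "real ^ 2" where "w = vector [- (u $ 2), u $ 1]"
  have w: "w $ 1 = - (u $ 2)" "w $ 2 = u $ 1" by (simp_all add: w_def)
  have uu: "u \<bullet> u = (u $ 1)\<^sup>2 + (u $ 2)\<^sup>2" by (simp add: inner_vec_def sum_2 power2_eq_square)
  have ww: "w \<bullet> w = u \<bullet> u" by (simp add: inner_vec_def sum_2 w)
  have wu: "w \<bullet> u = 0" by (simp add: inner_vec_def sum_2 w)
  have "w \<noteq> 0" using ww assms by (metis inner_eq_zero_iff)
  have z: "(w \<bullet> w) *\<^sub>R z = (z \<bullet> w) *\<^sub>R w" if "z \<bullet> u = 0" for z
  proof -
    have *: "z $ 1 * u $ 1 = - (z $ 2 * u $ 2)" using that by (simp add: inner_vec_def sum_2 eq_neg_iff_add_eq_0)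
    have "z $ 1 * (u $ 1 * u $ 1) = - (z $ 2 * u $ 2 * u $ 1)" "z $ 1 * u $ 1 * u $ 2 = - (z $ 2 * (u $ 2 * u $ 2))"
      using * by (metis mult.assoc mult_minus_left)+
    then show ?thesis
      unfolding ww uu by (simp add: vec_eq_iff forall_2 inner_vec_def sum_2 w power2_eq_square algebra_simps)
  qed
  show ?thesis
  proof (rule that[of "w /\<^sub>R norm w"])
    show "norm (w /\<^sub>R norm w) = 1" using \<open>w \<noteq> 0\<close> by simp
    show "(w /\<^sub>R norm w) \<bullet> u = 0" by (simp add: wu)
    show "z = (z \<bullet> (w /\<^sub>R norm w)) *\<^sub>R (w /\<^sub>R norm w)" if "z \<bullet> u = 0" for z
    proof -
      have "z = (w \<bullet> w) *\<^sub>R z /\<^sub>R (w \<bullet> w)" using \<open>w \<noteq> 0\<close> by simp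
      also have "\<dots> = (z \<bullet> w) *\<^sub>R w /\<^sub>R (w \<bullet> w)" by (simp only: z[OF that])
      also have "\<dots> = (z \<bullet> (w /\<^sub>R norm w)) *\<^sub>R (w /\<^sub>R norm w)"
        by (simp add: power2_norm_eq_inner[symmetric] power2_eq_square)
      finally show ?thesis .
    qed
  qed
qed

lemma continuous_inverse_interval:
  fixes x :: "real \<Rightarrow> real"
  assumes "0 \<le> \<rho>" "continuous_on {0..\<rho>} x" "strict_mono_on {0..\<rho>} x" "x 0 = 0" and c: "c \<le> x \<rho>"
  obtains T where "continuous_on {0..c} T" "\<And>\<xi>. \<xi> \<in> {0..c} \<Longrightarrow> T \<xi> \<in> {0..\<rho>} \<and> x (T \<xi>) = \<xi>"
    "\<And>\<tau>. \<tau> \<in> {0..\<rho>} \<Longrightarrow> T (x \<tau>) = \<tau>"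
proof -
  have inj: "inj_on x {0..\<rho>}" using assms(3) by (rule strict_mono_on_imp_inj_on)
  have sub: "{0..c} \<subseteq> x ` {0..\<rho>}"
  proof
    fix \<xi> assume "\<xi> \<in> {0..c}"
    then have "\<exists>t. 0 \<le> t \<and> t \<le> \<rho> \<and> x t = \<xi>" using assms by (intro IVT') auto
    then show "\<xi> \<in> x ` {0..\<rho>}" by auto
  qed
  let ?T = "inv_into {0..\<rho>} x"
  show ?thesis
  proof (rule that[of ?T])
    have "continuous_on (x ` {0..\<rho>}) ?T"
      by (rule continuous_on_inv[OF assms(2)]) (auto simp: inj)
    then show "continuous_on {0..c} ?T" using sub continuous_on_subset by blast
    show "?T \<xi> \<in> {0..\<rho>} \<and> x (?T \<xi>) = \<xi>" if "\<xi> \<in> {0..c}" for \<xi>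
      using sub that by (meson f_inv_into_f inv_into_into subsetD)
    show "?T (x \<tau>) = \<tau>" if "\<tau> \<in> {0..\<rho>}" for \<tau> using inj that by simp
  qed
qed

text \<open>
  Two branches advancing in the direction \<open>u\<close> from a common point are graphs over the line spanned by
  \<open>u\<close>. If they do not meet again, the vertical gap between them keeps its sign, which is absorbed in
  the choice of the normal \<open>n\<close> such that \<open>b1\<close> is the upper branch. The witnesses \<open>t1\<close>, \<open>t2\<close> mark the widest gap \<open>m\<close>;
  each earlier point of one branch faces a point of the other at a distance of at most \<open>m\<close>.
\<close>

lemma widest_gap_of_branches:
  fixes b1 b2 :: "real \<Rightarrow> real ^ 2"
  assumes \<rho>: "0 < \<rho>" and u: "u \<noteq> 0" and start: "b1 0 = b2 0"
    and cont: "continuous_on {0..\<rho>} b1" "continuous_on {0..\<rho>} b2"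
    and mono: "\<And>a b. 0 \<le> a \<Longrightarrow> a < b \<Longrightarrow> b \<le> \<rho> \<Longrightarrow> b1 a \<bullet> u < b1 b \<bullet> u"
              "\<And>a b. 0 \<le> a \<Longrightarrow> a < b \<Longrightarrow> b \<le> \<rho> \<Longrightarrow> b2 a \<bullet> u < b2 b \<bullet> u"
    and disj: "\<And>a b. 0 < a \<Longrightarrow> a \<le> \<rho> \<Longrightarrow> 0 < b \<Longrightarrow> b \<le> \<rho> \<Longrightarrow> b1 a \<noteq> b2 b"
  obtains n m t1 t2 where "norm n = 1" "n \<bullet> u = 0" "0 < m" "0 < t1" "t1 \<le> \<rho>" "0 < t2" "t2 \<le> \<rho>"
    "b1 t1 - b2 t2 = m *\<^sub>R n"
    "\<forall>a. 0 < a \<and> a \<le> t1 \<longrightarrow> (\<exists>b d. 0 \<le> b \<and> b \<le> \<rho> \<and> 0 < d \<and> d \<le> m \<and> b1 a - b2 b = d *\<^sub>R n)"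
    "\<forall>b. 0 < b \<and> b \<le> t2 \<longrightarrow> (\<exists>a d. 0 \<le> a \<and> a \<le> \<rho> \<and> 0 < d \<and> d \<le> m \<and> b1 a - b2 b = d *\<^sub>R n)"
proof -
  obtain e where e: "norm e = 1" "e \<bullet> u = 0" "\<And>z. z \<bullet> u = 0 \<Longrightarrow> z = (z \<bullet> e) *\<^sub>R e"
    using planar_normal[OF u] by metis
  define x1 where "x1 t = (b1 t - b1 0) \<bullet> u" for t
  define x2 where "x2 t = (b2 t - b2 0) \<bullet> u" for t
  have x0: "x1 0 = 0" "x2 0 = 0" by (simp_all add: x1_def x2_def)
  have sm: "strict_mono_on {0..\<rho>} x1" "strict_mono_on {0..\<rho>} x2"
    using mono by (auto simp: strict_mono_on_def x1_def x2_def inner_diff_left)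
  have cx: "continuous_on {0..\<rho>} x1" "continuous_on {0..\<rho>} x2"
    unfolding x1_def[abs_def] x2_def[abs_def] by (intro continuous_intros cont)+
  define c where "c = min (x1 \<rho>) (x2 \<rho>)"
  have c: "0 < c" using strict_mono_onD[OF sm(1), of 0 \<rho>] strict_mono_onD[OF sm(2), of 0 \<rho>] \<rho> x0 by (simp add: c_def)
  obtain T1 where T1: "continuous_on {0..c} T1" "\<And>\<xi>. \<xi> \<in> {0..c} \<Longrightarrow> T1 \<xi> \<in> {0..\<rho>} \<and> x1 (T1 \<xi>) = \<xi>"
      "\<And>t. t \<in> {0..\<rho>} \<Longrightarrow> T1 (x1 t) = t"
    using continuous_inverse_interval[OF less_imp_le[OF \<rho>] cx(1) sm(1) x0(1), of c] unfolding c_def by auto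
  obtain T2 where T2: "continuous_on {0..c} T2" "\<And>\<xi>. \<xi> \<in> {0..c} \<Longrightarrow> T2 \<xi> \<in> {0..\<rho>} \<and> x2 (T2 \<xi>) = \<xi>"
      "\<And>t. t \<in> {0..\<rho>} \<Longrightarrow> T2 (x2 t) = t"
    using continuous_inverse_interval[OF less_imp_le[OF \<rho>] cx(2) sm(2) x0(2), of c] unfolding c_def by auto
  define D where "D \<xi> = (b1 (T1 \<xi>) - b2 (T2 \<xi>)) \<bullet> e" for \<xi>
  have diff: "b1 (T1 \<xi>) - b2 (T2 \<xi>) = D \<xi> *\<^sub>R e" if "\<xi> \<in> {0..c}" for \<xi>
  proof -
    have "x1 (T1 \<xi>) = x2 (T2 \<xi>)" using T1(2) T2(2) that by simp
    then have "(b1 (T1 \<xi>) - b2 (T2 \<xi>)) \<bullet> u = 0" by (simp add: x1_def x2_def start inner_diff_left)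
    then show ?thesis unfolding D_def by (rule e(3))
  qed
  have cD: "continuous_on {0..c} D"
    unfolding D_def
    by (intro continuous_intros continuous_on_compose2[OF cont(1) T1(1)] continuous_on_compose2[OF cont(2) T2(1)])
      (use T1(2) T2(2) in auto)
  have T0: "T1 0 = 0" "T2 0 = 0" using T1(3)[of 0] T2(3)[of 0] x0 \<rho> by auto
  have Tpos: "0 < T1 \<xi>" "0 < T2 \<xi>" if "0 < \<xi>" "\<xi> \<le> c" for \<xi>
    using T1(2)[of \<xi>] T2(2)[of \<xi>] that x0 by (auto simp: less_le)
  have Dne: "D \<xi> \<noteq> 0" if "0 < \<xi>" "\<xi> \<le> c" for \<xi>
    using disj[OF Tpos(1)[OF that] _ Tpos(2)[OF that]] diff[of \<xi>] T1(2)[of \<xi>] T2(2)[of \<xi>] that by auto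
  define s where "s = sgn (D c)"
  have s: "\<bar>s\<bar> = 1" "s * s = 1" using Dne[of c] c by (auto simp: s_def sgn_real_def)
  have Dpos: "0 < s * D \<xi>" if "0 < \<xi>" "\<xi> \<le> c" for \<xi>
  proof (rule ccontr)
    assume "\<not> 0 < s * D \<xi>"
    moreover have "0 < s * D c" using Dne[of c] c by (auto simp: s_def sgn_real_def mult_neg_neg)
    moreover have "continuous_on {\<xi>..c} (\<lambda>\<xi>. s * D \<xi>)"
      using that by (intro continuous_intros continuous_on_subset[OF cD]) auto
    ultimately have "\<exists>x\<ge>\<xi>. x \<le> c \<and> s * D x = 0"
      using that by (intro IVT'[of "\<lambda>\<xi>. s * D \<xi>" \<xi> 0 c]) auto
    then obtain \<xi>' where "\<xi> \<le> \<xi>'" "\<xi>' \<le> c" "s * D \<xi>' = 0" by blast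
    then show False using Dne[of \<xi>'] that s by auto
  qed
  have "\<exists>\<mu>\<in>{0..c}. \<forall>\<xi>\<in>{0..c}. s * D \<xi> \<le> s * D \<mu>"
    using c by (intro continuous_attains_sup continuous_intros cD) auto
  then obtain \<mu> where \<mu>: "\<mu> \<in> {0..c}" "\<And>\<xi>. \<xi> \<in> {0..c} \<Longrightarrow> s * D \<xi> \<le> s * D \<mu>" by blast
  have "D 0 = 0" by (simp add: D_def T0 start)
  then have \<mu>0: "0 < \<mu>" using \<mu>(1) \<mu>(2)[of c] Dpos[of c] c by (auto simp: less_le)
  have ds: "D \<xi> *\<^sub>R e = (s * D \<xi>) *\<^sub>R (s *\<^sub>R e)" for \<xi> using s(2) by (simp add: mult.commute mult.assoc[symmetric])
  show ?thesis
  proof (rule that[of "s *\<^sub>R e" "s * D \<mu>" "T1 \<mu>" "T2 \<mu>"])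
    show "norm (s *\<^sub>R e) = 1" "(s *\<^sub>R e) \<bullet> u = 0" using e s by simp_all
    show "0 < s * D \<mu>" using Dpos \<mu>(1) \<mu>0 by simp
    show "0 < T1 \<mu>" "0 < T2 \<mu>" using Tpos \<mu>(1) \<mu>0 by simp_all
    show "T1 \<mu> \<le> \<rho>" "T2 \<mu> \<le> \<rho>" using T1(2)[OF \<mu>(1)] T2(2)[OF \<mu>(1)] by simp_all
    show "b1 (T1 \<mu>) - b2 (T2 \<mu>) = (s * D \<mu>) *\<^sub>R s *\<^sub>R e" unfolding ds[symmetric] by (rule diff[OF \<mu>(1)])
  next
    show "\<forall>a. 0 < a \<and> a \<le> T1 \<mu> \<longrightarrow> (\<exists>b d. 0 \<le> b \<and> b \<le> \<rho> \<and> 0 < d \<and> d \<le> s * D \<mu> \<and> b1 a - b2 b = d *\<^sub>R s *\<^sub>R e)"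
    proof (intro allI impI, elim conjE)
      fix a assume a: "0 < a" "a \<le> T1 \<mu>"
      then have a\<rho>: "a \<in> {0..\<rho>}" using T1(2)[OF \<mu>(1)] by simp
      have "x1 a \<le> x1 (T1 \<mu>)" "0 < x1 a"
        using strict_mono_onD[OF sm(1), of a "T1 \<mu>"] strict_mono_onD[OF sm(1), of 0 a] a a\<rho> T1(2)[OF \<mu>(1)] x0
        by (cases "a = T1 \<mu>", auto)+
      then have \<xi>: "0 < x1 a" "x1 a \<le> c" using T1(2)[OF \<mu>(1)] \<mu>(1) by simp_all
      then show "\<exists>b d. 0 \<le> b \<and> b \<le> \<rho> \<and> 0 < d \<and> d \<le> s * D \<mu> \<and> b1 a - b2 b = d *\<^sub>R s *\<^sub>R e"
        using Dpos[OF \<xi>] \<mu>(2)[of "x1 a"] T2(2)[of "x1 a"] diff[of "x1 a"] T1(3)[OF a\<rho>] ds[of "x1 a"]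
        by (intro exI[of _ "T2 (x1 a)"] exI[of _ "s * D (x1 a)"]) auto
    qed
  next
    show "\<forall>b. 0 < b \<and> b \<le> T2 \<mu> \<longrightarrow> (\<exists>a d. 0 \<le> a \<and> a \<le> \<rho> \<and> 0 < d \<and> d \<le> s * D \<mu> \<and> b1 a - b2 b = d *\<^sub>R s *\<^sub>R e)"
    proof (intro allI impI, elim conjE)
      fix b assume b: "0 < b" "b \<le> T2 \<mu>"
      then have b\<rho>: "b \<in> {0..\<rho>}" using T2(2)[OF \<mu>(1)] by simp
      have "x2 b \<le> x2 (T2 \<mu>)" "0 < x2 b"
        using strict_mono_onD[OF sm(2), of b "T2 \<mu>"] strict_mono_onD[OF sm(2), of 0 b] b b\<rho> T2(2)[OF \<mu>(1)] x0
        by (cases "b = T2 \<mu>", auto)+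
      then have \<xi>: "0 < x2 b" "x2 b \<le> c" using T2(2)[OF \<mu>(1)] \<mu>(1) by simp_all
      then show "\<exists>a d. 0 \<le> a \<and> a \<le> \<rho> \<and> 0 < d \<and> d \<le> s * D \<mu> \<and> b1 a - b2 b = d *\<^sub>R s *\<^sub>R e"
        using Dpos[OF \<xi>] \<mu>(2)[of "x2 b"] T1(2)[of "x2 b"] diff[of "x2 b"] T2(3)[OF b\<rho>] ds[of "x2 b"]
        by (intro exI[of _ "T1 (x2 b)"] exI[of _ "s * D (x2 b)"]) auto
    qed
  qed
qed

context length_constrained
begin

lemma load_difference_inner_le:
  assumes f: "path f" "foot f \<tau>"
    and w: "w \<in> borel_measurable borel" "\<And>t. \<bar>w t\<bar> \<le> 1"
    and w': "w' \<in> borel_measurable borel" "\<And>t. \<bar>w' t\<bar> \<le> 1"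
    and le: "\<And>\<omega>. (w (\<tau> \<omega>) - w' (\<tau> \<omega>)) * ((X \<omega> - f (\<tau> \<omega>)) \<bullet> n) \<le> c"
  shows "(load f \<tau> w - load f \<tau> w') \<bullet> n \<le> c"
proof -
  let ?Y = "\<lambda>\<omega>. X \<omega> - f (\<tau> \<omega>)"
  note i = foot_weighted_integrable[OF f w] foot_weighted_integrable[OF f w']
  have id: "integrable M (\<lambda>\<omega>. (w (\<tau> \<omega>) *\<^sub>R ?Y \<omega> - w' (\<tau> \<omega>) *\<^sub>R ?Y \<omega>) \<bullet> n)"
    by (intro integrable_inner_left Bochner_Integration.integrable_diff i)
  have "((\<integral>\<omega>. w (\<tau> \<omega>) *\<^sub>R ?Y \<omega> \<partial>M) - (\<integral>\<omega>. w' (\<tau> \<omega>) *\<^sub>R ?Y \<omega> \<partial>M)) \<bullet> n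
      = (\<integral>\<omega>. (w (\<tau> \<omega>) *\<^sub>R ?Y \<omega> - w' (\<tau> \<omega>) *\<^sub>R ?Y \<omega>) \<bullet> n \<partial>M)"
    by (subst integral_inner_left) (use i in auto)
  also have "\<dots> \<le> (\<integral>\<omega>. c \<partial>M)"
    by (rule integral_mono[OF id]) (use le in \<open>auto simp: scaleR_left_diff_distrib[symmetric]\<close>)
  finally show ?thesis by (simp add: prob_space load_def)
qed

text \<open>
  If the residual had a larger component along \<open>n\<close>, the curve point at distance \<open>d\<close> in that direction
  would be nearer to \<open>X\<close>.
\<close>

lemma nearest_inner_le:
  assumes \<tau>: "foot f \<tau>" and q: "t \<in> {0..1}" "f t = f (\<tau> \<omega>) + d *\<^sub>R n" and n: "norm n = 1" and d: "0 < d"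
  shows "(X \<omega> - f (\<tau> \<omega>)) \<bullet> n \<le> d / 2"
proof -
  let ?Y = "X \<omega> - f (\<tau> \<omega>)"
  have "norm ?Y \<le> norm (?Y - d *\<^sub>R n)"
    using foot_nearest[OF \<tau> q(1), of \<omega>] by (simp add: q(2) algebra_simps)
  then have "(norm ?Y)\<^sup>2 \<le> (norm (?Y - d *\<^sub>R n))\<^sup>2" by (intro power_mono) auto
  also have "\<dots> = (norm ?Y)\<^sup>2 - 2 * d * (?Y \<bullet> n) + d\<^sup>2 * (n \<bullet> n)"
  proof -
    have "(norm (y - d *\<^sub>R n))\<^sup>2 = (norm y)\<^sup>2 - 2 * d * (y \<bullet> n) + d\<^sup>2 * (n \<bullet> n)" for y
      unfolding power2_norm_eq_inner
      by (simp add: inner_diff_left inner_diff_right inner_commute power2_eq_square)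
    then show ?thesis .
  qed
  also have "n \<bullet> n = 1" using n by (simp add: norm_eq_1)
  finally have "d * (2 * (?Y \<bullet> n)) \<le> d * d" by (simp add: power2_eq_square)
  then show ?thesis using d by simp
qed

end

locale planar_length_constrained = length_constrained M X L loop
  for M :: "'w measure" and X :: "'w \<Rightarrow> real ^ 2" and L :: real and loop :: bool
begin

text \<open>
  Suppose that the branches \<open>t + a\<close> and \<open>s - b\<close> do not meet again soon, and let \<open>m\<close> be the widest gap on a
  time span \<open>\<rho>\<close>. Both branches start with the velocity \<open>u\<close>, orthogonal to \<open>n\<close>. The load on the upper
  branch pulls down by at most \<open>m / 2\<close> at each point, that on the lower branch up by at most \<open>m / 2\<close>. The
  curve bends against its load, so by the chord representation neither branch departs from the tangent,
  away from the other branch, by more than \<open>\<rho> * m / (2 * \<kappa>)\<close>. For \<open>\<rho> \<le> \<kappa> / 2\<close> the gap cannot reach \<open>m\<close>.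
\<close>

lemma outward_double_point:
  assumes opt: "optimal f" and st: "0 < s" "s < t" "t < 1" and eq: "f s = f t" and \<eta>: "0 < \<eta>"
  shows "\<exists>a b. 0 < a \<and> a < \<eta> \<and> a \<le> s \<and> 0 < b \<and> b < \<eta> \<and> t + b \<le> 1 \<and> f (s - a) = f (t + b)"
proof (rule ccontr)
  assume neg: "\<not> ?thesis"
  have f: "path f" using opt by (rule optimal_path)
  have cf: "continuous_on {0..1} f" using f by (simp add: path_def)
  obtain u where u: "u \<noteq> 0" and rv: "right_velocity f t u" and lv: "left_velocity f s (- u)"
    by (rule opposite_velocities[OF opt st eq]) (blast intro: that)
  obtain \<tau> where \<tau>: "foot f \<tau>" using some_foot[OF f] by blast
  obtain \<kappa> W where \<kappa>: "0 < \<kappa>"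
    and rep: "\<And>a b. 0 \<le> a \<Longrightarrow> a < b \<Longrightarrow> b \<le> 1 \<Longrightarrow> f b - f a = (b - a) *\<^sub>R (W - load f \<tau> (ramp a b) /\<^sub>R \<kappa>)"
    and rV: "right_velocity f t (W - load f \<tau> (indicator {..t}) /\<^sub>R \<kappa>)"
    and lV: "left_velocity f s (W - load f \<tau> (indicator {..<s}) /\<^sub>R \<kappa>)"
  proof (rule velocities[OF opt \<tau>])
    fix \<kappa> W assume "0 < \<kappa>"
      "\<And>a b. 0 \<le> a \<Longrightarrow> a < b \<Longrightarrow> b \<le> 1 \<Longrightarrow> f b - f a = (b - a) *\<^sub>R (W - load f \<tau> (ramp a b) /\<^sub>R \<kappa>)"
      "\<And>x. 0 \<le> x \<Longrightarrow> x < 1 \<Longrightarrow> right_velocity f x (W - load f \<tau> (indicator {..x}) /\<^sub>R \<kappa>)"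
      "\<And>x. 0 < x \<Longrightarrow> x \<le> 1 \<Longrightarrow> left_velocity f x (W - load f \<tau> (indicator {..<x}) /\<^sub>R \<kappa>)"
    then show thesis using that[of \<kappa> W] st by simp
  qed
  have u1: "u = W - load f \<tau> (indicator {..t}) /\<^sub>R \<kappa>" by (rule right_velocity_unique[OF rv rV])
  have u2: "- u = W - load f \<tau> (indicator {..<s}) /\<^sub>R \<kappa>" by (rule left_velocity_unique[OF lv lV])
  define l where "l = norm u / 2"
  have l: "0 < l" using u by (simp add: l_def)
  obtain \<rho>t where \<rho>t: "\<rho>t > 0" "\<And>a b. t \<le> a \<and> a < b \<and> b \<le> t + \<rho>t \<Longrightarrow> norm (f b - f a - (b - a) *\<^sub>R u) \<le> l * (b - a)"
    using rv l unfolding right_velocity_def by metis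
  obtain \<rho>s where \<rho>s: "\<rho>s > 0" "\<And>a b. s - \<rho>s \<le> a \<and> a < b \<and> b \<le> s \<Longrightarrow> norm (f b - f a - (b - a) *\<^sub>R (- u)) \<le> l * (b - a)"
    using lv l unfolding left_velocity_def by metis
  define \<rho> where "\<rho> = Min {\<rho>t, \<rho>s, \<eta> / 2, s, 1 - t, \<kappa> / 2}"
  have \<rho>0: "0 < \<rho>" using \<rho>t(1) \<rho>s(1) \<eta> st \<kappa> by (simp add: \<rho>_def)
  have \<rho>: "\<rho> \<le> \<rho>t" "\<rho> \<le> \<rho>s" "\<rho> \<le> \<eta> / 2" "\<rho> \<le> s" "\<rho> \<le> 1 - t" "\<rho> \<le> \<kappa> / 2"
    unfolding \<rho>_def by (rule Min_le; simp)+
  \<comment> \<open>This makes both branches graphs over the line spanned by \<open>u\<close>.\<close>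
  have advance: "0 < z \<bullet> u" if "norm (z - h *\<^sub>R u) \<le> l * h" "0 < h" for z h
  proof -
    have "\<bar>(z - h *\<^sub>R u) \<bullet> u\<bar> \<le> (l * h) * norm u"
      using Cauchy_Schwarz_ineq2[of "z - h *\<^sub>R u" u] mult_right_mono[OF that(1), of "norm u"] by simp
    moreover have "(z - h *\<^sub>R u) \<bullet> u = z \<bullet> u - 2 * (l * h * norm u)"
      by (simp add: inner_diff_left l_def power2_norm_eq_inner[symmetric] power2_eq_square)
    moreover have "0 < l * h * norm u" using l that(2) u by simp
    ultimately show ?thesis by linarith
  qed
  obtain n m t1 t2 where n: "norm n = 1" "n \<bullet> u = 0" and m: "0 < m"
    and t1: "0 < t1" "t1 \<le> \<rho>" and t2: "0 < t2" "t2 \<le> \<rho>"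
    and gap: "f (t + t1) - f (s - t2) = m *\<^sub>R n"
    and below: "\<forall>a. 0 < a \<and> a \<le> t1 \<longrightarrow> (\<exists>b d. 0 \<le> b \<and> b \<le> \<rho> \<and> 0 < d \<and> d \<le> m \<and> f (t + a) - f (s - b) = d *\<^sub>R n)"
    and above: "\<forall>b. 0 < b \<and> b \<le> t2 \<longrightarrow> (\<exists>a d. 0 \<le> a \<and> a \<le> \<rho> \<and> 0 < d \<and> d \<le> m \<and> f (t + a) - f (s - b) = d *\<^sub>R n)"
  proof (rule widest_gap_of_branches[OF \<rho>0 u, of "\<lambda>a. f (t + a)" "\<lambda>b. f (s - b)"])
    show "f (t + 0) = f (s - 0)" using eq by simp
    show "continuous_on {0..\<rho>} (\<lambda>a. f (t + a))" "continuous_on {0..\<rho>} (\<lambda>b. f (s - b))"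
      using \<rho> st by (auto intro!: continuous_on_compose2[OF cf] continuous_intros)
    show "f (t + a) \<bullet> u < f (t + b) \<bullet> u" if "0 \<le> a" "a < b" "b \<le> \<rho>" for a b
      using advance[of "f (t + b) - f (t + a)" "b - a"] \<rho>t(2)[of "t + a" "t + b"] that \<rho>
      by (simp add: inner_diff_left)
    show "f (s - a) \<bullet> u < f (s - b) \<bullet> u" if "0 \<le> a" "a < b" "b \<le> \<rho>" for a b
    proof -
      have "norm (f (s - a) - f (s - b) - (b - a) *\<^sub>R (- u)) \<le> l * (b - a)"
        using \<rho>s(2)[of "s - b" "s - a"] that \<rho> by simp
      moreover have "f (s - b) - f (s - a) - (b - a) *\<^sub>R u = - (f (s - a) - f (s - b) - (b - a) *\<^sub>R (- u))" by simp
      ultimately have "norm (f (s - b) - f (s - a) - (b - a) *\<^sub>R u) \<le> l * (b - a)" by (metis norm_minus_cancel)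
      then show ?thesis using advance[of "f (s - b) - f (s - a)" "b - a"] that by (simp add: inner_diff_left)
    qed
    show "f (t + a) \<noteq> f (s - b)" if "0 < a" "a \<le> \<rho>" "0 < b" "b \<le> \<rho>" for a b
      using neg that \<rho> \<eta> by (metis add.commute field_sum_of_halves le_add_diff_inverse2 le_diff_eq less_add_same_cancel1 half_gt_zero order_le_less_trans order_trans)
  qed (rule that; assumption)
  have left: "(f (t + t1) - f t) \<bullet> n \<le> t1 / \<kappa> * (m / 2)"
  proof -
    have "(load f \<tau> (indicator {..t}) - load f \<tau> (ramp t (t + t1))) \<bullet> n \<le> m / 2"
    proof (rule load_difference_inner_le[OF f \<tau>])
      fix \<omega>
      let ?w = "indicator {..t} (\<tau> \<omega>) - ramp t (t + t1) (\<tau> \<omega>)"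
      show "?w * ((X \<omega> - f (\<tau> \<omega>)) \<bullet> n) \<le> m / 2"
      proof (cases "t < \<tau> \<omega> \<and> \<tau> \<omega> < t + t1")
        case True
        then obtain b d where bd: "0 \<le> b" "b \<le> \<rho>" "0 < d" "d \<le> m" "f (\<tau> \<omega>) - f (s - b) = d *\<^sub>R n"
          using below[rule_format, of "\<tau> \<omega> - t"] by auto
        have "(X \<omega> - f (\<tau> \<omega>)) \<bullet> (- n) \<le> d / 2"
          using bd n \<rho> st by (intro nearest_inner_le[OF \<tau>, of "s - b"]) (auto simp: algebra_simps)
        then have "(X \<omega> - f (\<tau> \<omega>)) \<bullet> (- n) \<le> m / 2" using bd by linarith
        then have "ramp t (t + t1) (\<tau> \<omega>) * ((X \<omega> - f (\<tau> \<omega>)) \<bullet> (- n)) \<le> m / 2"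
          using m by (intro weight_mult_le ramp_range) auto
        then show ?thesis using True by simp
      next
        case False
        then have "?w = 0" using t1 by (auto simp: ramp_simps indicator_def not_less)
        then show ?thesis using m by simp
      qed
    qed (use ramp_range in \<open>auto simp: indicator_def\<close>)
    moreover have "f (t + t1) - f t = t1 *\<^sub>R u + (t1 / \<kappa>) *\<^sub>R (load f \<tau> (indicator {..t}) - load f \<tau> (ramp t (t + t1)))"
      using rep[of t "t + t1"] st t1 \<rho> unfolding u1 by (simp only: chord_change[symmetric]) simp
    ultimately show ?thesis
      using n(2) t1 \<kappa> by (simp only: inner_add_left inner_scaleR_left inner_minus_left inner_commute[of u n])
        (auto intro!: mult_left_mono simp del: times_divide_eq_left)
  qed
  have right: "(f s - f (s - t2)) \<bullet> n \<le> t2 / \<kappa> * (m / 2)"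
  proof -
    have "(load f \<tau> (indicator {..<s}) - load f \<tau> (ramp (s - t2) s)) \<bullet> n \<le> m / 2"
    proof (rule load_difference_inner_le[OF f \<tau>])
      fix \<omega>
      let ?w = "indicator {..<s} (\<tau> \<omega>) - ramp (s - t2) s (\<tau> \<omega>)"
      show "?w * ((X \<omega> - f (\<tau> \<omega>)) \<bullet> n) \<le> m / 2"
      proof (cases "s - t2 < \<tau> \<omega> \<and> \<tau> \<omega> < s")
        case True
        then obtain a d where ad: "0 \<le> a" "a \<le> \<rho>" "0 < d" "d \<le> m" "f (t + a) - f (\<tau> \<omega>) = d *\<^sub>R n"
          using above[rule_format, of "s - \<tau> \<omega>"] by auto
        have "(X \<omega> - f (\<tau> \<omega>)) \<bullet> n \<le> d / 2"
          using ad n \<rho> st by (intro nearest_inner_le[OF \<tau>, of "t + a"]) (auto simp: algebra_simps)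
        then have "(X \<omega> - f (\<tau> \<omega>)) \<bullet> n \<le> m / 2" using ad by linarith
        moreover have w: "?w = 1 - ramp (s - t2) s (\<tau> \<omega>)" using True by simp
        ultimately show ?thesis
          unfolding w using ramp_range[of "s - t2" s "\<tau> \<omega>"] m by (intro weight_mult_le) auto
      next
        case False
        then have "?w = 0" using t2 by (auto simp: ramp_simps indicator_def not_less)
        then show ?thesis using m by simp
      qed
    qed (use ramp_range in \<open>auto simp: indicator_def\<close>)
    moreover have "f s - f (s - t2) = t2 *\<^sub>R (- u) + (t2 / \<kappa>) *\<^sub>R (load f \<tau> (indicator {..<s}) - load f \<tau> (ramp (s - t2) s))"
      using rep[of "s - t2" s] st t2 \<rho> unfolding u2 by (simp only: chord_change[symmetric]) simp
    ultimately show ?thesis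
      using n(2) t2 \<kappa> by (simp only: inner_add_left inner_scaleR_left inner_minus_left inner_commute[of u n])
        (auto intro!: mult_left_mono simp del: times_divide_eq_left)
  qed
  have "m = (f (t + t1) - f (s - t2)) \<bullet> n" using n by (simp add: gap norm_eq_1)
  also have "\<dots> = (f (t + t1) - f t) \<bullet> n + (f s - f (s - t2)) \<bullet> n" by (simp add: eq inner_diff_left)
  also have "\<dots> \<le> t1 / \<kappa> * (m / 2) + t2 / \<kappa> * (m / 2)" by (intro add_mono left right)
  also have "\<dots> = (t1 + t2) / \<kappa> * (m / 2)" by (simp add: add_divide_distrib algebra_simps)
  also have "\<dots> \<le> 1 * (m / 2)"
    using t1 t2 \<rho>(6) \<kappa> m by (intro mult_right_mono) auto
  finally show False using m by simp
qed

end

section \<open>Open curves\<close>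

lemma widest_double_pair:
  fixes f :: "real \<Rightarrow> 'a::real_normed_vector"
  assumes f: "path f" and g: "0 \<le> g"
  obtains s t where "s \<in> {0..1}" "t \<in> {0..1}" "f s = f t" "t - s \<le> g"
    "\<And>s' t'. s' \<in> {0..1} \<Longrightarrow> t' \<in> {0..1} \<Longrightarrow> f s' = f t' \<Longrightarrow> t' - s' \<le> g \<Longrightarrow> t' - s' \<le> t - s"
proof -
  have cf: "continuous_on {0..1} f" using f by (simp add: path_def)
  define S :: "(real \<times> real) set" where "S = ({0..1} \<times> {0..1}) \<inter> {z. snd z - fst z \<le> g}"
  define K where "K = {z \<in> S. f (fst z) - f (snd z) = 0}"
  have S: "compact S"
    unfolding S_def
    by (intro compact_Int_closed compact_Times compact_Icc closed_Collect_le continuous_intros)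
  have "closed K"
    unfolding K_def
  proof (rule continuous_closed_preimage_constant[OF _ compact_imp_closed[OF S]])
    show "continuous_on S (\<lambda>z. f (fst z) - f (snd z))"
      by (intro continuous_intros continuous_on_compose2[OF cf]) (auto simp: S_def)
  qed
  then have "compact (S \<inter> K)" by (intro compact_Int_closed S)
  then have cK: "compact K" by (simp add: K_def Int_absorb1 Collect_conj_eq[symmetric] Int_def)
  have "(0, 0) \<in> K" using g by (simp add: K_def S_def)
  then have "\<exists>z\<in>K. \<forall>z'\<in>K. snd z' - fst z' \<le> snd z - fst z"
    by (intro continuous_attains_sup cK continuous_intros) auto
  then obtain z where z: "z \<in> K" "\<And>z'. z' \<in> K \<Longrightarrow> snd z' - fst z' \<le> snd z - fst z" by blast
  show ?thesis
  proof (rule that[of "fst z" "snd z"])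
    show "t' - s' \<le> snd z - fst z" if "s' \<in> {0..1}" "t' \<in> {0..1}" "f s' = f t'" "t' - s' \<le> g" for s' t'
      using z(2)[of "(s', t')"] that by (simp add: K_def S_def)
  qed (use z(1) in \<open>auto simp: K_def S_def\<close>)
qed

lemma right_velocity_near:
  assumes v: "right_velocity f x w" and x: "c \<le> x" "x < d"
    and near: "\<And>a b. c \<le> a \<Longrightarrow> a < b \<Longrightarrow> b \<le> d \<Longrightarrow> norm (f b - f a - (b - a) *\<^sub>R v) \<le> \<delta> * (b - a)"
  shows "norm (w - v) \<le> \<delta>"
proof (rule field_le_epsilon)
  fix e :: real assume e: "e > 0"
  obtain \<rho> where \<rho>: "\<rho> > 0" "\<And>a b. x \<le> a \<and> a < b \<and> b \<le> x + \<rho> \<Longrightarrow> norm (f b - f a - (b - a) *\<^sub>R w) \<le> e * (b - a)"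
    using v e unfolding right_velocity_def by metis
  define h where "h = min \<rho> (d - x)"
  have h: "0 < h" "h \<le> \<rho>" "h \<le> d - x" using \<rho> x by (auto simp: h_def)
  have "h *\<^sub>R (w - v) = (f (x + h) - f x - h *\<^sub>R v) - (f (x + h) - f x - h *\<^sub>R w)" by (simp add: algebra_simps)
  then have "norm (h *\<^sub>R (w - v)) \<le> norm (f (x + h) - f x - h *\<^sub>R v) + norm (f (x + h) - f x - h *\<^sub>R w)"
    by (metis norm_triangle_ineq4)
  also have "\<dots> \<le> \<delta> * h + e * h"
    using near[of x "x + h"] \<rho>(2)[of x "x + h"] h x by (intro add_mono) auto
  finally have "norm (w - v) * h \<le> (\<delta> + e) * h"
    unfolding norm_scaleR distrib_right using h by (simp only: abs_of_pos mult.commute[of h])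
  then show "norm (w - v) \<le> \<delta> + e" using h by simp
qed

lemma left_velocity_near:
  assumes v: "left_velocity f x w" and x: "c < x" "x \<le> d"
    and near: "\<And>a b. c \<le> a \<Longrightarrow> a < b \<Longrightarrow> b \<le> d \<Longrightarrow> norm (f b - f a - (b - a) *\<^sub>R v) \<le> \<delta> * (b - a)"
  shows "norm (w - v) \<le> \<delta>"
proof -
  have "right_velocity (\<lambda>t. f (0 - t)) (0 - x) (- w)" using v left_velocity_reflect by blast
  then have "norm (- w - (- v)) \<le> \<delta>"
  proof (rule right_velocity_near[where c = "- d" and d = "- c"])
    fix a b assume ab: "- d \<le> a" "a < b" "b \<le> - c"
    have "f (0 - b) - f (0 - a) - (b - a) *\<^sub>R - v = - (f (- a) - f (- b) - (- a - - b) *\<^sub>R v)"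
      by (simp add: algebra_simps)
    also have "norm \<dots> \<le> \<delta> * (- a - - b)" unfolding norm_minus_cancel using near[of "- b" "- a"] ab by simp
    finally show "norm (f (0 - b) - f (0 - a) - (b - a) *\<^sub>R - v) \<le> \<delta> * (b - a)" by simp
  qed (use x in auto)
  then show ?thesis by (simp add: norm_minus_commute)
qed

context length_constrained
begin

lemma velocity_exists:
  assumes opt: "optimal f"
  shows "0 \<le> x \<Longrightarrow> x < 1 \<Longrightarrow> \<exists>v. right_velocity f x v" "0 < x \<Longrightarrow> x \<le> 1 \<Longrightarrow> \<exists>v. left_velocity f x v"
proof -
  obtain \<tau> where \<tau>: "foot f \<tau>" using some_foot[OF optimal_path[OF opt]] by blast
  show "\<exists>v. right_velocity f x v" if "0 \<le> x" "x < 1"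
    by (rule velocities[OF opt \<tau>]) (use that in blast)
  show "\<exists>v. left_velocity f x v" if "0 < x" "x \<le> 1"
    by (rule velocities[OF opt \<tau>]) (use that in blast)
qed

text \<open>
  If \<open>S\<close> carries no load, the velocity at the ends belonging to \<open>S\<close> is the constant \<open>W\<close> of integration; at
  the end \<open>1\<close> this uses that the total load vanishes.
\<close>

lemma equal_end_velocities:
  assumes opt: "optimal f" and S: "S \<subseteq> {0, 1}" and y: "y \<in> {0..1} - S" "\<And>s. s \<in> S \<Longrightarrow> f y = f s"
  obtains W where "\<not> loop \<Longrightarrow> W = 0" "0 \<in> S \<Longrightarrow> right_velocity f 0 W" "1 \<in> S \<Longrightarrow> left_velocity f 1 W"
proof -
  have "\<exists>\<tau>. foot f \<tau> \<and> (\<forall>\<omega>. \<tau> \<omega> \<notin> S)"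
  proof (rule foot_exists_avoiding[OF optimal_path[OF opt], where j = "\<lambda>_. y"])
    show "S \<in> sets borel" by (rule borel_closed) (use S finite_subset finite_imp_closed in blast)
  qed (use S y in auto)
  then obtain \<tau> where \<tau>: "foot f \<tau>" "\<And>\<omega>. \<tau> \<omega> \<notin> S" by blast
  note \<tau>01 = footD(3,4)[OF \<tau>(1)]
  show ?thesis
  proof (rule velocities[OF opt \<tau>(1)])
    fix \<kappa> W assume W: "\<not> loop \<Longrightarrow> W = 0"
      "\<And>x. 0 \<le> x \<Longrightarrow> x < 1 \<Longrightarrow>
         right_velocity f x (W - load f \<tau> (indicator {..x}) /\<^sub>R \<kappa>)"
      "\<And>x. 0 < x \<Longrightarrow> x \<le> 1 \<Longrightarrow>
         left_velocity f x (W - load f \<tau> (indicator {..<x}) /\<^sub>R \<kappa>)"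
    show ?thesis
    proof (rule that[of W])
      show "right_velocity f 0 W" if "0 \<in> S"
      proof -
        have "indicator {..0} (\<tau> \<omega>) = (0 :: real)" for \<omega>
          using \<tau>(2)[of \<omega>] \<tau>01[of \<omega>] that by (auto simp: indicator_def less_le)
        then show ?thesis using W(2)[of 0] by (simp add: load_def)
      qed
      show "left_velocity f 1 W" if "1 \<in> S"
      proof -
        have "indicator {..<1} (\<tau> \<omega>) = (1 :: real)" for \<omega>
          using \<tau>(2)[of \<omega>] \<tau>01[of \<omega>] that by (auto simp: indicator_def less_le)
        then show ?thesis using W(3)[of 1] centered[OF opt \<tau>(1)] by (simp add: load_def)
      qed
    qed (rule W(1))
  qed
qed

text \<open>
  The velocity at a free end without load would be \<open>0\<close>.
\<close>

lemma open_end_not_double: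
  assumes opt: "optimal f" and "\<not> loop" and x: "x \<in> {0, 1}" and y: "y \<in> {0..1}" "y \<noteq> x"
  shows "f y \<noteq> f x"
proof
  assume eq: "f y = f x"
  obtain W where W: "\<not> loop \<Longrightarrow> W = 0" "0 \<in> {x} \<Longrightarrow> right_velocity f 0 W" "1 \<in> {x} \<Longrightarrow> left_velocity f 1 W"
    by (rule equal_end_velocities[OF opt, of "{x}" y]) (use x y eq in auto)
  then show False
    using \<open>\<not> loop\<close> x right_velocity_nonzero[OF opt, of 0 W] left_velocity_nonzero[OF opt, of 1 W] by auto
qed

end

context planar_length_constrained
begin

text \<open>
  A widest double pair would have both parameters inside \<open>(0, 1)\<close>, and then there is a wider one.
\<close>

lemma optimal_open_injective:
  assumes opt: "optimal f" and "\<not> loop"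
  shows "inj_on f {0..1}"
proof (rule ccontr)
  assume "\<not> inj_on f {0..1}"
  then obtain x y where xy: "x \<in> {0..1}" "y \<in> {0..1}" "x < y" "f x = f y"
    unfolding inj_on_def by (metis linorder_neqE_linordered_idom)
  obtain s t where st: "s \<in> {0..1}" "t \<in> {0..1}" "f s = f t"
    and max: "\<And>s' t'. s' \<in> {0..1} \<Longrightarrow> t' \<in> {0..1} \<Longrightarrow> f s' = f t' \<Longrightarrow> t' - s' \<le> 1 \<Longrightarrow> t' - s' \<le> t - s"
    using widest_double_pair[OF optimal_path[OF opt], of 1] by auto
  have "s < t" using max[OF xy(1,2,4)] xy by auto
  then have "0 < s" "t < 1"
    using open_end_not_double[OF opt \<open>\<not> loop\<close>, of 0 t] open_end_not_double[OF opt \<open>\<not> loop\<close>, of 1 s] st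
    by (auto simp: less_le)
  then obtain a b where "0 < a" "a \<le> s" "0 < b" "t + b \<le> 1" "f (s - a) = f (t + b)"
    using outward_double_point[OF opt _ \<open>s < t\<close> _ st(3), of 1] by auto
  then show False using max[of "s - a" "t + b"] st by auto
qed

end

section \<open>Closed curves\<close>

locale planar_closed_optimum = planar_length_constrained M X L True
  for M :: "'w measure" and X :: "'w \<Rightarrow> real ^ 2" and L :: real
begin

lemma closed_optimal:
  assumes "optimal f"
  shows "f 1 = f 0"
  using optimal_loop[OF assms TrueI] by simp

lemma optimal_shiftpath:
  assumes opt: "optimal f" and a: "a \<in> {0..1}"
  shows "optimal (shiftpath a f)"
proof (rule optimal_reparametrized[OF opt])
  have d: "norm (f y - f x) \<le> L * (y - x)" if "0 \<le> x" "x \<le> y" "y \<le> 1" for x y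
    using lipschitz_dominated[OF optimal_lipschitz[OF opt]] that by (simp add: dominated_def right_diff_distrib)
  show "dominated 0 1 (shiftpath a f) (\<lambda>x. L * x)"
  proof (rule dominated_glue[where b = "1 - a"])
    show "dominated 0 (1 - a) (shiftpath a f) (\<lambda>x. L * x)"
    proof (rule dominatedI)
      fix x y assume "0 \<le> x" "x \<le> y" "y \<le> 1 - a"
      then show "norm (shiftpath a f y - shiftpath a f x) \<le> L * y - L * x"
        using d[of "a + x" "a + y"] a by (simp add: shiftpath_def right_diff_distrib)
    qed
    have s: "shiftpath a f x = f (a + x - 1)" if "1 - a \<le> x" for x
      using that closed_optimal[OF opt] by (cases "x = 1 - a") (auto simp: shiftpath_def)
    show "dominated (1 - a) 1 (shiftpath a f) (\<lambda>x. L * x)"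
    proof (rule dominatedI)
      fix x y assume "1 - a \<le> x" "x \<le> y" "y \<le> 1"
      then show "norm (shiftpath a f y - shiftpath a f x) \<le> L * y - L * x"
        using d[of "a + x - 1" "a + y - 1"] a by (simp add: s right_diff_distrib)
    qed
  qed
  show "path_image (shiftpath a f) = path_image f"
    using a closed_optimal[OF opt] by (intro path_image_shiftpath) (auto simp: pathstart_def pathfinish_def)
  show "shiftpath a f 0 = shiftpath a f 1" using a closed_optimal[OF opt] by (auto simp: shiftpath_def)
qed

lemma not_inj_shiftpath:
  assumes opt: "optimal f" and a: "a \<in> {0..1}" and "\<not> inj_on f {0..<1}"
  shows "\<not> inj_on (shiftpath a f) {0..<1}"
proof
  assume inj: "inj_on (shiftpath a f) {0..<1}"
  define \<phi> where "\<phi> s = (if a \<le> s then s - a else s - a + 1)" for s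
  have \<phi>: "\<phi> s \<in> {0..<1}" "shiftpath a f (\<phi> s) = f s" if "s \<in> {0..<1}" for s
    using that a closed_optimal[OF opt] by (auto simp: \<phi>_def shiftpath_def)
  have "inj_on f {0..<1}"
  proof (rule inj_onI)
    fix s t assume st: "s \<in> {0..<1}" "t \<in> {0..<1}" "f s = f t"
    then have "\<phi> s = \<phi> t" using inj_onD[OF inj] \<phi> by metis
    then show "s = t" using st a by (auto simp: \<phi>_def split: if_splits)
  qed
  then show False using assms(3) by simp
qed

text \<open>
  Suppose that the base point is not a double point. Among the double pairs with \<open>t - s \<le> 1 - \<epsilon>\<close>, a
  widest one has parameters different from \<open>0\<close> and \<open>1\<close>, and as it cannot be widened further,
  \<open>t - s = 1 - \<epsilon>\<close>. The velocities at \<open>s\<close> and \<open>t\<close> are opposite, and as \<open>\<epsilon>\<close> tends to \<open>0\<close> they tend to the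
  velocities on the two sides of the base point.
\<close>

lemma base_point_partner_or_turn:
  assumes opt: "optimal f" and ninj: "\<not> inj_on f {0..<1}"
  shows "(\<exists>t. 0 < t \<and> t < 1 \<and> f t = f 0) \<or> (\<exists>v. right_velocity f 0 v \<and> left_velocity f 1 (- v))"
proof (unfold disj_imp, rule impI)
  assume np: "\<not> (\<exists>t. 0 < t \<and> t < 1 \<and> f t = f 0)"
  obtain s0 t0 where st0: "s0 \<in> {0..<1}" "t0 \<in> {0..<1}" "s0 < t0" "f s0 = f t0"
    using ninj unfolding inj_on_def by (metis linorder_neqE_linordered_idom)
  have squeeze: "\<exists>s t w. 0 < s \<and> s < \<epsilon> \<and> 1 - \<epsilon> < t \<and> t < 1 \<and> right_velocity f s (- w) \<and> left_velocity f t w"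
    if \<epsilon>: "0 < \<epsilon>" "\<epsilon> \<le> 1 - (t0 - s0)" for \<epsilon>
  proof -
    obtain s t where st: "s \<in> {0..1}" "t \<in> {0..1}" "f s = f t" "t - s \<le> 1 - \<epsilon>"
      and max: "\<And>s' t'. s' \<in> {0..1} \<Longrightarrow> t' \<in> {0..1} \<Longrightarrow> f s' = f t' \<Longrightarrow> t' - s' \<le> 1 - \<epsilon> \<Longrightarrow> t' - s' \<le> t - s"
      using widest_double_pair[OF optimal_path[OF opt], of "1 - \<epsilon>"] \<epsilon> st0 by auto
    have "t0 - s0 \<le> t - s" using max[of s0 t0] st0 \<epsilon> by auto
    then have "s < t" using st0 by simp
    have "s \<noteq> 0"
    proof
      assume "s = 0"
      then have "0 < t" "t < 1" "f t = f 0" using st \<epsilon> \<open>s < t\<close> by simp_all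
      then show False using np by blast
    qed
    have "t \<noteq> 1"
    proof
      assume "t = 1"
      then have "0 < s" "s < 1" "f s = f 0" using st \<epsilon> \<open>s < t\<close> \<open>s \<noteq> 0\<close> closed_optimal[OF opt] by simp_all
      then show False using np by blast
    qed
    have s0: "0 < s" and t1: "t < 1" using st \<open>s \<noteq> 0\<close> \<open>t \<noteq> 1\<close> by auto
    have "t - s = 1 - \<epsilon>"
    proof (rule ccontr)
      assume "t - s \<noteq> 1 - \<epsilon>"
      then have "0 < (1 - \<epsilon> - (t - s)) / 2" using st by simp
      from outward_double_point[OF opt s0 \<open>s < t\<close> t1 st(3) this] obtain a b where
        "0 < a" "a < (1 - \<epsilon> - (t - s)) / 2" "a \<le> s" "0 < b" "b < (1 - \<epsilon> - (t - s)) / 2" "t + b \<le> 1"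
        "f (s - a) = f (t + b)" by blast
      then show False using max[of "s - a" "t + b"] st by auto
    qed
    then have "s < \<epsilon>" "1 - \<epsilon> < t" using s0 t1 by auto
    then show ?thesis
      by - (rule opposite_velocities[OF opt s0 \<open>s < t\<close> t1 st(3)], use s0 t1 in blast)
  qed
  obtain v where v: "right_velocity f 0 v" using velocity_exists(1)[OF opt, of 0] by auto
  obtain v' where v': "left_velocity f 1 v'" using velocity_exists(2)[OF opt, of 1] by auto
  have "v' = - v"
  proof (rule ccontr)
    assume "v' \<noteq> - v"
    define \<delta> where "\<delta> = norm (v' + v) / 3"
    have \<delta>: "0 < \<delta>" using \<open>v' \<noteq> - v\<close> by (simp add: \<delta>_def eq_neg_iff_add_eq_0)
    obtain \<rho> where \<rho>: "\<rho> > 0" "\<And>a b. 0 \<le> a \<and> a < b \<and> b \<le> 0 + \<rho> \<Longrightarrow> norm (f b - f a - (b - a) *\<^sub>R v) \<le> \<delta> * (b - a)"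
      using v \<delta> unfolding right_velocity_def by metis
    obtain \<rho>' where \<rho>': "\<rho>' > 0" "\<And>a b. 1 - \<rho>' \<le> a \<and> a < b \<and> b \<le> 1 \<Longrightarrow> norm (f b - f a - (b - a) *\<^sub>R v') \<le> \<delta> * (b - a)"
      using v' \<delta> unfolding left_velocity_def by metis
    define \<epsilon> where "\<epsilon> = Min {\<rho>, \<rho>', 1 - (t0 - s0)}"
    have \<epsilon>: "0 < \<epsilon>" "\<epsilon> \<le> 1 - (t0 - s0)" "\<epsilon> \<le> \<rho>" "\<epsilon> \<le> \<rho>'"
      using \<rho>(1) \<rho>'(1) st0 by (auto simp: \<epsilon>_def)
    obtain s t w where w': "0 < s" "s < \<epsilon>" "1 - \<epsilon> < t" "t < 1" "right_velocity f s (- w)" "left_velocity f t w"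
      using squeeze[OF \<epsilon>(1,2)] by blast
    have w: "0 < s" "s < \<rho>" "1 - \<rho>' < t" "t < 1" "right_velocity f s (- w)" "left_velocity f t w"
      using w' \<epsilon> by auto
    have "norm (- w - v) \<le> \<delta>"
      by (rule right_velocity_near[OF w(5), of 0 \<rho>]) (use w \<rho>(2) in auto)
    moreover have "norm (w - v') \<le> \<delta>"
      by (rule left_velocity_near[OF w(6), of "1 - \<rho>'" 1]) (use w \<rho>'(2) in auto)
    ultimately have "norm ((- w - v) + (w - v')) \<le> \<delta> + \<delta>" by (intro norm_triangle_mono)
    moreover have "(- w - v) + (w - v') = - (v' + v)" by simp
    ultimately have "norm (v' + v) \<le> \<delta> + \<delta>" by (simp only: norm_minus_cancel)
    then show False using \<delta> by (simp add: \<delta>_def)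
  qed
  then show "\<exists>v. right_velocity f 0 v \<and> left_velocity f 1 (- v)" using v v' by blast
qed

text \<open>
  Take \<open>x\<close> as the new base point.
\<close>

lemma partner_or_turn:
  assumes opt: "optimal f" and ninj: "\<not> inj_on f {0..<1}" and x: "0 < x" "x < 1"
  shows "(\<exists>y\<in>{0..<1}. y \<noteq> x \<and> f y = f x) \<or> (\<exists>v. right_velocity f x v \<and> left_velocity f x (- v))"
proof -
  have x01: "x \<in> {0..1}" using x by simp
  let ?g = "shiftpath x f"
  have og: "optimal ?g" by (rule optimal_shiftpath[OF opt x01])
  have g0: "?g 0 = f x" using x by (simp add: shiftpath_def)
  from base_point_partner_or_turn[OF og not_inj_shiftpath[OF opt x01 ninj]] show ?thesis
  proof
    assume "\<exists>t. 0 < t \<and> t < 1 \<and> ?g t = ?g 0"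
    then obtain t where t: "0 < t" "t < 1" "?g t = f x" using g0 by auto
    have "\<exists>y\<in>{0..<1}. y \<noteq> x \<and> f y = ?g t"
    proof (cases "x + t < 1")
      case True
      then show ?thesis using t x by (intro bexI[of _ "x + t"]) (auto simp: shiftpath_def)
    next
      case False
      then have "?g t = f (x + t - 1)"
        using closed_optimal[OF opt] by (cases "x + t = 1") (simp_all add: shiftpath_def)
      then show ?thesis using t x False by (intro bexI[of _ "x + t - 1"]) auto
    qed
    then show ?thesis using t by simp
  next
    assume "\<exists>v. right_velocity ?g 0 v \<and> left_velocity ?g 1 (- v)"
    then obtain v where v: "right_velocity ?g 0 v" "left_velocity ?g 1 (- v)" by blast
    have "right_velocity f (0 + x) v"
      by (rule right_velocity_shift[OF _ _ v(1), of "1 - x"]) (use x in \<open>auto simp: shiftpath_def add.commute\<close>)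
    moreover have "left_velocity f (1 + (x - 1)) (- v)"
      by (rule left_velocity_shift[OF _ _ v(2), of "x / 2"]) (use x in \<open>auto simp: shiftpath_def algebra_simps\<close>)
    ultimately show ?thesis by auto
  qed
qed

text \<open>
  Close to \<open>0\<close> on the right, the velocities are so near to each other that no two of them are opposite.
  So there are no U-turns, and no two parameters of this arc \<open>J\<close> have the same image; hence every point of
  \<open>J\<close> is visited outside \<open>J\<close>. A nearest parameter that avoids \<open>J\<close> leaves \<open>J\<close> unloaded.
\<close>

lemma straight_start:
  assumes opt: "optimal f" and ninj: "\<not> inj_on f {0..<1}"
  shows "\<exists>\<rho> v. 0 < \<rho> \<and> \<rho> < 1 \<and> v \<noteq> 0 \<and> right_velocity f 0 v \<and> (\<forall>h\<in>{0..\<rho>}. f h = f 0 + h *\<^sub>R v)"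
proof -
  have f: "path f" using opt by (rule optimal_path)
  obtain v where v: "right_velocity f 0 v" using velocity_exists(1)[OF opt, of 0] by auto
  have v0: "v \<noteq> 0" using right_velocity_nonzero[OF opt _ _ v] by simp
  define \<delta> where "\<delta> = norm v / 2"
  have \<delta>: "0 < \<delta>" using v0 by (simp add: \<delta>_def)
  obtain \<rho>' where \<rho>': "\<rho>' > 0" "\<And>a b. 0 \<le> a \<and> a < b \<and> b \<le> 0 + \<rho>' \<Longrightarrow> norm (f b - f a - (b - a) *\<^sub>R v) \<le> \<delta> * (b - a)"
    using v \<delta> unfolding right_velocity_def by metis
  define \<rho> where "\<rho> = min \<rho>' (1 / 2)"
  have \<rho>: "0 < \<rho>" "\<rho> < 1" using \<rho>'(1) by (auto simp: \<rho>_def)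
  have near: "norm (f b - f a - (b - a) *\<^sub>R v) \<le> \<delta> * (b - a)" if "0 \<le> a" "a < b" "b \<le> \<rho>" for a b
    using \<rho>'(2)[of a b] that by (simp add: \<rho>_def)
  have injJ: "f a \<noteq> f b" if "0 \<le> a" "a < b" "b \<le> \<rho>" for a b
  proof
    assume "f a = f b"
    then have "(b - a) * norm v \<le> \<delta> * (b - a)" using near[OF that] that by simp
    then have "norm v \<le> \<delta>" using that by (simp add: mult.commute)
    then show False using \<delta> by (simp add: \<delta>_def)
  qed
  have partner: "\<exists>y\<in>{0..1} - {0<..<\<rho>}. f y = f x" if x: "0 < x" "x < \<rho>" for x
  proof -
    have "\<not> (\<exists>w. right_velocity f x w \<and> left_velocity f x (- w))"
    proof
      assume "\<exists>w. right_velocity f x w \<and> left_velocity f x (- w)"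
      then obtain w where w: "right_velocity f x w" "left_velocity f x (- w)" by blast
      have "norm (w - v) \<le> \<delta>" by (rule right_velocity_near[OF w(1), of 0 \<rho>]) (use x near in auto)
      moreover have "norm (- w - v) \<le> \<delta>" by (rule left_velocity_near[OF w(2), of 0 \<rho>]) (use x near in auto)
      ultimately have "norm ((w - v) + (- w - v)) \<le> \<delta> + \<delta>" by (intro norm_triangle_mono)
      moreover have "(w - v) + (- w - v) = - (2 *\<^sub>R v)" by (simp add: scaleR_2)
      ultimately have "2 * norm v \<le> \<delta> + \<delta>" by (simp only: norm_minus_cancel norm_scaleR abs_numeral)
      then show False using \<delta> by (simp add: \<delta>_def)
    qed
    then obtain y where y: "y \<in> {0..<1}" "y \<noteq> x" "f y = f x"
      using partner_or_turn[OF opt ninj x(1)] x \<rho> by auto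
    have "y \<notin> {0<..<\<rho>}"
    proof
      assume "y \<in> {0<..<\<rho>}"
      then have "x < y \<Longrightarrow> f x \<noteq> f y" "y < x \<Longrightarrow> f y \<noteq> f x" using injJ x by simp_all
      then show False using y(2,3) by (metis linorder_neqE_linordered_idom)
    qed
    then show ?thesis using y by auto
  qed
  have cl: "closed ({0..1} - {0<..<\<rho>})" by (intro closed_Diff) auto
  have im: "f ` ({0..1} - {0<..<\<rho>}) = path_image f"
  proof -
    have "f x \<in> f ` ({0..1} - {0<..<\<rho>})" if "x \<in> {0..1}" for x
    proof (cases "x \<in> {0<..<\<rho>}")
      case True
      then show ?thesis using partner[of x] by (metis greaterThanLessThan_iff image_eqI)
    qed (use that in blast)
    then show ?thesis by (auto simp: path_image_def)
  qed
  obtain \<tau> where \<tau>: "foot f \<tau>" "\<And>\<omega>. \<tau> \<omega> \<in> {0..1} - {0<..<\<rho>}"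
    using foot_exists[OF f cl _ im] by blast
  have "\<forall>h\<in>{0..\<rho>}. f h = f 0 + h *\<^sub>R v"
  proof (rule velocities[OF opt \<tau>(1)], rule ballI)
    fix \<kappa> W h
    assume rep: "\<And>a b. 0 \<le> a \<Longrightarrow> a < b \<Longrightarrow> b \<le> 1 \<Longrightarrow>
       f b - f a = (b - a) *\<^sub>R (W - load f \<tau> (ramp a b) /\<^sub>R \<kappa>)"
      and rv: "\<And>x. 0 \<le> x \<Longrightarrow> x < 1 \<Longrightarrow>
       right_velocity f x (W - load f \<tau> (indicator {..x}) /\<^sub>R \<kappa>)"
      and h: "h \<in> {0..\<rho>}"
    show "f h = f 0 + h *\<^sub>R v"
    proof (cases "h = 0")
      case False
      then have h': "0 < h" "h \<le> 1" using h \<rho> by auto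
      have "ramp 0 h (\<tau> \<omega>) = indicator {..0} (\<tau> \<omega>)" for \<omega>
        using \<tau>(2)[of \<omega>] h h' by (cases "\<tau> \<omega> \<le> 0") (auto simp: ramp_simps not_le not_less)
      then have "f h - f 0 = h *\<^sub>R (W - load f \<tau> (indicator {..0}) /\<^sub>R \<kappa>)"
        using rep[of 0 h] h' by (simp add: load_def)
      also have "\<dots> = h *\<^sub>R v" using right_velocity_unique[OF v rv[of 0]] by simp
      finally show ?thesis by (simp add: algebra_simps)
    qed simp
  qed
  then show ?thesis using \<rho> v v0 by blast
qed

lemma straight_end:
  assumes opt: "optimal f" and ninj: "\<not> inj_on f {0..<1}"
  shows "\<exists>\<rho> v. 0 < \<rho> \<and> \<rho> < 1 \<and> v \<noteq> 0 \<and> left_velocity f 1 v \<and> (\<forall>h\<in>{0..\<rho>}. f (1 - h) = f 1 - h *\<^sub>R v)"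
proof -
  define g where "g x = f (1 - x)" for x
  have og: "optimal g"
  proof (rule optimal_reparametrized[OF opt])
    show "dominated 0 1 g (\<lambda>x. L * x)"
    proof (rule dominatedI)
      fix x y :: real assume "0 \<le> x" "x \<le> y" "y \<le> 1"
      then show "norm (g y - g x) \<le> L * y - L * x"
        using lipschitz_onD[OF optimal_lipschitz[OF opt], of "1 - y" "1 - x"]
        by (simp add: g_def dist_norm right_diff_distrib)
    qed
    show "path_image g = path_image f"
      using path_image_reversepath[of f] by (simp add: reversepath_def g_def[abs_def])
    show "g 0 = g 1" using closed_optimal[OF opt] by (simp add: g_def)
  qed
  have "\<not> inj_on g {0..<1}"
  proof
    assume inj: "inj_on g {0..<1}"
    define \<psi> where "\<psi> s = (if s = 0 then 0 else 1 - s)" for s :: real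
    have \<psi>: "\<psi> s \<in> {0..<1}" "g (\<psi> s) = f s" if "s \<in> {0..<1}" for s
      using that closed_optimal[OF opt] by (auto simp: \<psi>_def g_def)
    have "inj_on f {0..<1}"
    proof (rule inj_onI)
      fix s t assume st: "s \<in> {0..<1}" "t \<in> {0..<1}" "f s = f t"
      then have "\<psi> s = \<psi> t" using inj_onD[OF inj] \<psi> by metis
      then show "s = t" using st by (auto simp: \<psi>_def split: if_splits)
    qed
    then show False using ninj by simp
  qed
  from straight_start[OF og this] obtain \<rho> v where \<rho>: "0 < \<rho>" "\<rho> < 1" "v \<noteq> 0" "right_velocity g 0 v"
    "\<forall>h\<in>{0..\<rho>}. g h = g 0 + h *\<^sub>R v" by blast
  then show ?thesis
    using left_velocity_reflect[of f 1 "- v" 1] by (intro exI[of _ \<rho>] exI[of _ "- v"]) (simp add: g_def[abs_def])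
qed

text \<open>
  The velocities on the two sides are equal if the base point is a double point, as it then carries
  no load, and opposite if it is a U-turn.
\<close>

lemma straight_around_base_point:
  assumes opt: "optimal f" and ninj: "\<not> inj_on f {0..<1}"
  shows "\<exists>\<rho> v k. 0 < \<rho> \<and> \<rho> < 1 \<and> v \<noteq> 0 \<and> k \<noteq> 0 \<and>
    (\<forall>h\<in>{0..\<rho>}. f h = f 0 + h *\<^sub>R v \<and> f (1 - h) = f 0 + (h * k) *\<^sub>R v)"
proof -
  obtain \<rho>1 v where 1: "0 < \<rho>1" "\<rho>1 < 1" "v \<noteq> 0" "right_velocity f 0 v" "\<forall>h\<in>{0..\<rho>1}. f h = f 0 + h *\<^sub>R v"
    using straight_start[OF opt ninj] by blast
  obtain \<rho>2 w where 2: "0 < \<rho>2" "\<rho>2 < 1" "w \<noteq> 0" "left_velocity f 1 w" "\<forall>h\<in>{0..\<rho>2}. f (1 - h) = f 1 - h *\<^sub>R w"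
    using straight_end[OF opt ninj] by blast
  have "w = v \<or> w = - v"
    using base_point_partner_or_turn[OF opt ninj]
  proof
    assume "\<exists>t. 0 < t \<and> t < 1 \<and> f t = f 0"
    then obtain t where t: "0 < t" "t < 1" "f t = f 0" by blast
    obtain W where "right_velocity f 0 W" "left_velocity f 1 W"
      by (rule equal_end_velocities[OF opt, of "{0, 1}" t]) (use t closed_optimal[OF opt] in auto)
    then show ?thesis using right_velocity_unique[OF 1(4)] left_velocity_unique[OF 2(4)] by metis
  next
    assume "\<exists>v. right_velocity f 0 v \<and> left_velocity f 1 (- v)"
    then show ?thesis using right_velocity_unique[OF 1(4)] left_velocity_unique[OF 2(4)] by metis
  qed
  then have "- w = (- 1) *\<^sub>R v \<or> - w = 1 *\<^sub>R v" by auto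
  then obtain k :: real where k: "k \<noteq> 0" "- w = k *\<^sub>R v" by (metis zero_neq_neg_one zero_neq_one)
  have 3: "f (1 - h) = f 0 + (h * k) *\<^sub>R v" if "h \<in> {0..\<rho>2}" for h
  proof -
    have "f (1 - h) = f 0 + h *\<^sub>R (- w)" using 2(5) that closed_optimal[OF opt] by simp
    then show ?thesis by (simp only: k(2) scaleR_scaleR)
  qed
  show ?thesis
  proof (intro exI conjI ballI)
    show "0 < min \<rho>1 \<rho>2" "min \<rho>1 \<rho>2 < 1" using 1(1,2) 2(1) by auto
    show "f h = f 0 + h *\<^sub>R v" if "h \<in> {0..min \<rho>1 \<rho>2}" for h using 1(5) that by (meson atLeastAtMost_iff min.boundedE)
    show "f (1 - h) = f 0 + (h * k) *\<^sub>R v" if "h \<in> {0..min \<rho>1 \<rho>2}" for h using that by (intro 3) simp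
  qed (fact 1(3) k(1))+
qed

lemma straight_around_interior_point:
  assumes opt: "optimal f" and ninj: "\<not> inj_on f {0..<1}" and x: "0 < x" "x < 1"
  shows "\<exists>\<rho> v k. 0 < \<rho> \<and> v \<noteq> 0 \<and> k \<noteq> 0 \<and>
    (\<forall>h\<in>{0..\<rho>}. f (x + h) = f x + h *\<^sub>R v \<and> f (x - h) = f x + (h * k) *\<^sub>R v)"
proof -
  have x01: "x \<in> {0..1}" using x by simp
  let ?g = "shiftpath x f"
  obtain \<rho> v k where *: "0 < \<rho>" "\<rho> < 1" "v \<noteq> 0" "k \<noteq> 0"
    "\<forall>h\<in>{0..\<rho>}. ?g h = ?g 0 + h *\<^sub>R v \<and> ?g (1 - h) = ?g 0 + (h * k) *\<^sub>R v"
    using straight_around_base_point[OF optimal_shiftpath[OF opt x01] not_inj_shiftpath[OF opt x01 ninj]] by blast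
  define r where "r = Min {\<rho>, 1 - x, x / 2}"
  have r: "0 < r" "r \<le> \<rho>" "r \<le> 1 - x" "r \<le> x / 2" using * x
    by (auto simp: r_def min_def)
  have "f (x + h) = f x + h *\<^sub>R v \<and> f (x - h) = f x + (h * k) *\<^sub>R v" if h: "h \<in> {0..r}" for h
  proof -
    have "?g h = f (x + h)" "?g (1 - h) = f (x - h)" "?g 0 = f x"
      using h r x by (auto simp: shiftpath_def)
    moreover have "h \<in> {0..\<rho>}" using h r by simp
    ultimately show ?thesis using *(5) by metis
  qed
  then show ?thesis using r(1) *(3,4) by blast
qed

end

lemma collinear_scaled_direction:
  assumes "collinear S" "p \<in> S" "q \<in> S" "p - q = r *\<^sub>R v" "r \<noteq> 0" "v \<noteq> 0" "x \<in> S" "y \<in> S"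
  shows "\<exists>c. x - y = c *\<^sub>R v"
proof -
  obtain u where u: "\<And>x y. x \<in> S \<Longrightarrow> y \<in> S \<Longrightarrow> \<exists>c. x - y = c *\<^sub>R u" using assms(1) unfolding collinear_def by blast
  obtain c where c: "p - q = c *\<^sub>R u" using u assms(2,3) by blast
  then have "c \<noteq> 0" using assms by auto
  then have "u = inverse c *\<^sub>R (c *\<^sub>R u)" by simp
  also have "c *\<^sub>R u = r *\<^sub>R v" using c assms(4) by simp
  finally have "u = (inverse c * r) *\<^sub>R v" by simp
  then show ?thesis using u[OF assms(7,8)] by auto
qed

lemma collinear_along: "(\<And>x. x \<in> S \<Longrightarrow> \<exists>c. x = p + c *\<^sub>R v) \<Longrightarrow> collinear S"
  unfolding collinear_def
proof (intro exI[of _ v] ballI)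
  fix x y assume *: "\<And>x. x \<in> S \<Longrightarrow> \<exists>c. x = p + c *\<^sub>R v" "x \<in> S" "y \<in> S"
  obtain c d where "x = p + c *\<^sub>R v" "y = p + d *\<^sub>R v" using * by blast
  then show "\<exists>c. x - y = c *\<^sub>R v" by (intro exI[of _ "c - d"]) (simp add: scaleR_diff_left)
qed

context planar_closed_optimum
begin

text \<open>
  Collinearity of the images of adjacent intervals propagates to their union, because the curve moves
  along one and the same line on both sides of the common endpoint.
\<close>

lemma collinear_image:
  assumes opt: "optimal f" and ninj: "\<not> inj_on f {0..<1}"
  shows "collinear (path_image f)"
proof -
  have "0 \<le> (0::real) \<longrightarrow> (1::real) \<le> 1 \<longrightarrow> collinear (f ` {0..1})"
  proof (rule Bolzano[of 0 1 "\<lambda>a b. 0 \<le> a \<longrightarrow> b \<le> 1 \<longrightarrow> collinear (f ` {a..b})"])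
    fix a b c :: real
    assume ab: "0 \<le> a \<longrightarrow> b \<le> 1 \<longrightarrow> collinear (f ` {a..b})" and bc: "0 \<le> b \<longrightarrow> c \<le> 1 \<longrightarrow> collinear (f ` {b..c})"
      and le: "a \<le> b" "b \<le> c"
    show "0 \<le> a \<longrightarrow> c \<le> 1 \<longrightarrow> collinear (f ` {a..c})"
    proof (intro impI)
      assume ac: "0 \<le> a" "c \<le> 1"
      show "collinear (f ` {a..c})"
      proof (cases "a = b \<or> b = c")
        case True
        then show ?thesis using ab bc ac le by auto
      next
        case False
        then have b: "a < b" "b < c" "0 < b" "b < 1" using le ac by auto
        obtain \<rho> v k where *: "0 < \<rho>" "v \<noteq> 0" "k \<noteq> 0"
          "\<forall>h\<in>{0..\<rho>}. f (b + h) = f b + h *\<^sub>R v \<and> f (b - h) = f b + (h * k) *\<^sub>R v"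
          using straight_around_interior_point[OF opt ninj b(3,4)] by blast
        define h where "h = Min {\<rho>, b - a, c - b}"
        have h: "0 < h" "h \<le> \<rho>" "h \<le> b - a" "h \<le> c - b" using * b by (auto simp: h_def)
        have e: "f (b - h) - f b = (h * k) *\<^sub>R v" "f (b + h) - f b = h *\<^sub>R v"
          using *(4)[rule_format, of h] h by auto
        have m: "f (b - h) \<in> f ` {a..b}" "f b \<in> f ` {a..b}" "f (b + h) \<in> f ` {b..c}" "f b \<in> f ` {b..c}"
          using h b by auto
        have "\<exists>d. x = f b + d *\<^sub>R v" if "x \<in> f ` {a..c}" for x
        proof -
          obtain y where y: "y \<in> {a..c}" "x = f y" using \<open>x \<in> f ` {a..c}\<close> by blast
          then consider "x \<in> f ` {a..b}" | "x \<in> f ` {b..c}" by (cases "y \<le> b") auto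
          then have "\<exists>d. x - f b = d *\<^sub>R v"
          proof cases
            case 1
            show ?thesis
              by (rule collinear_scaled_direction[of "f ` {a..b}" "f (b - h)" "f b" "h * k"])
                (use 1 e m(1,2) *(2,3) h(1) ab ac b in auto)
          next
            case 2
            show ?thesis
              by (rule collinear_scaled_direction[of "f ` {b..c}" "f (b + h)" "f b" h])
                (use 2 e m(3,4) *(2) h(1) bc ac b in auto)
          qed
          then show ?thesis by (metis add.commute diff_add_cancel)
        qed
        then show ?thesis by (rule collinear_along)
      qed
    qed
  next
    fix x :: real assume x: "0 \<le> x" "x \<le> 1"
    obtain \<rho> v p where \<rho>: "0 < \<rho>" and near: "\<And>y. 0 \<le> y \<Longrightarrow> y \<le> 1 \<Longrightarrow> \<bar>y - x\<bar> < \<rho> \<Longrightarrow> \<exists>c. f y = p + c *\<^sub>R v"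
    proof (cases "0 < x \<and> x < 1")
      case True
      then obtain \<rho> v k where *: "0 < \<rho>" "v \<noteq> 0"
          "\<forall>h\<in>{0..\<rho>}. f (x + h) = f x + h *\<^sub>R v \<and> f (x - h) = f x + (h * k) *\<^sub>R v"
        using straight_around_interior_point[OF opt ninj] by blast
      show thesis
      proof (rule that[OF *(1), of "f x" v])
        fix y assume "\<bar>y - x\<bar> < \<rho>"
        then show "\<exists>c. f y = f x + c *\<^sub>R v"
          using *(3)[rule_format, of "\<bar>y - x\<bar>"] by (cases "x \<le> y") auto
      qed
    next
      case False
      obtain \<rho> v k where *: "0 < \<rho>" "\<rho> < 1" "v \<noteq> 0"
          "\<forall>h\<in>{0..\<rho>}. f h = f 0 + h *\<^sub>R v \<and> f (1 - h) = f 0 + (h * k) *\<^sub>R v"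
        using straight_around_base_point[OF opt ninj] by blast
      show thesis
      proof (rule that[OF *(1), of "f 0" v])
        fix y assume "0 \<le> y" "y \<le> 1" "\<bar>y - x\<bar> < \<rho>"
        then show "\<exists>c. f y = f 0 + c *\<^sub>R v"
          using *(4)[rule_format, of "\<bar>y - x\<bar>"] False x by (cases "x = 0") auto
      qed
    qed
    have "collinear (f ` {a..b})" if "0 \<le> a" "b \<le> 1" "a \<le> x" "x \<le> b" "b - a < \<rho>" for a b
      by (rule collinear_along[of _ p v]) (use that near in auto)
    then show "\<exists>d>0. \<forall>a b. a \<le> x \<and> x \<le> b \<and> b - a < d \<longrightarrow> 0 \<le> a \<longrightarrow> b \<le> 1 \<longrightarrow> collinear (f ` {a..b})"
      using \<rho> by blast
  qed simp
  then show ?thesis by (simp add: path_image_def)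
qed

lemma optimal_closed_injective_or_segment:
  assumes opt: "optimal f"
  shows "inj_on f {0..<1} \<or> (\<exists>a b. a \<noteq> b \<and> path_image f = closed_segment a b)"
proof (unfold disj_imp, rule impI)
  assume ninj: "\<not> inj_on f {0..<1}"
  have f: "path f" using opt by (rule optimal_path)
  obtain a b where ab: "path_image f = closed_segment a b"
    by (rule compact_convex_collinear_segment_alt[of "path_image f"])
      (use f collinear_image[OF opt ninj] in \<open>auto simp: compact_path_image connected_path_image\<close>)
  have "a \<noteq> b"
  proof
    assume "a = b"
    then have const: "f x = a" if "x \<in> {0..1}" for x using ab that by (auto simp: path_image_def)
    obtain \<rho> v where "0 < \<rho>" "\<rho> < 1" "v \<noteq> 0" "\<forall>h\<in>{0..\<rho>}. f h = f 0 + h *\<^sub>R v"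
      using straight_start[OF opt ninj] by blast
    then show False using const[of 0] const[of \<rho>] by auto
  qed
  then show "\<exists>a b. a \<noteq> b \<and> path_image f = closed_segment a b" using ab by blast
qed

end

section \<open>Injectivity of optimal curves\<close>

lemma distortion_nonneg: "0 \<le> distortion M X \<phi>"
  unfolding distortion_def by simp

lemma opt_distortion_le: "\<phi> \<in> C \<Longrightarrow> opt_distortion M X C \<le> distortion M X \<phi>"
  unfolding opt_distortion_def
  by (rule cINF_lower) (auto intro!: bdd_belowI2[of _ 0] distortion_nonneg)

theorem proposition4p1:
  fixes M :: "'w measure" and X :: "'w \<Rightarrow> real ^ 2"
    and L :: real and f :: "real \<Rightarrow> real ^ 2"
  assumes "prob_space M"
    and "X \<in> borel_measurable M"
    and "integrable M (\<lambda>\<omega>. (norm (X \<omega>))\<^sup>2)"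
    and "L > 0"
    and "L-lipschitz_on {0..1} f"
  shows "(opt_distortion M X (curves L) > 0 \<and> f \<in> curves L
            \<and> distortion M X f = opt_distortion M X (curves L)
          \<longrightarrow> inj_on f {0..1})
       \<and> (opt_distortion M X (closed_curves L) > 0 \<and> f \<in> closed_curves L
            \<and> distortion M X f = opt_distortion M X (closed_curves L)
          \<longrightarrow> inj_on f {0..<1} \<or> (\<exists>a b. a \<noteq> b \<and> path_image f = closed_segment a b))"
proof (intro conjI impI; elim conjE)
  assume *: "0 < opt_distortion M X (curves L)" "f \<in> curves L" "distortion M X f = opt_distortion M X (curves L)"
  interpret planar_length_constrained M X L False
    by (intro planar_length_constrained.intro length_constrained.intro length_constrained_axioms.intro assms)
  have "optimal f"
    unfolding optimal_def using * assms(5) opt_distortion_le[of _ "curves L" M X] by (auto simp: curves_def)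
  then show "inj_on f {0..1}" by (rule optimal_open_injective) simp
next
  assume *: "0 < opt_distortion M X (closed_curves L)" "f \<in> closed_curves L"
    "distortion M X f = opt_distortion M X (closed_curves L)"
  interpret planar_closed_optimum M X L
    by (intro planar_closed_optimum.intro planar_length_constrained.intro length_constrained.intro
        length_constrained_axioms.intro assms)
  have "optimal f"
    unfolding optimal_def using * assms(5) opt_distortion_le[of _ "closed_curves L" M X]
    by (auto simp: closed_curves_def)
  then show "inj_on f {0..<1} \<or> (\<exists>a b. a \<noteq> b \<and> path_image f = closed_segment a b)"
    by (rule optimal_closed_injective_or_segment)
qed

end
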